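(* Let $P$ be a Borel probability measure on $\mathbb{R}_+$ with finite mean $\mu\neq0$, and let $t>0$. Let $S^{ex}(t)$, $S^+(t)$ and $S^-(t)$ denote random variables distributed as the limiting transient search-cost $S(t)$, i.e. as the limit in distribution of $S^{(n)}(n\mu t)/n$ as $n\to\infty$ for the move-to-front Markov chain, respectively under the assumptions LLN-$P$-ex, LLN-$P^+$ and LLN-$P^-$ (defined in the context). Then $$S^-(t)\preceq S^{ex}(t)\preceq S^+(t),$$ where $X\preceq Y$ means that $X$ is stochastically smaller than $Y$, i.e. $\mathbb{P}(X\le z)\ge\mathbb{P}(Y\le z)$ for all $z\in\mathbb{R}$.
   Context: Condition LLN-$P$. A sequence of random or deterministic vectors $\mathbf{w}^{(n)}=(w_1^{(n)},\ldots,w_n^{(n)})$, $n\in\mathbb{N}$, with nonnegative coordinates satisfies LLN-$P$, where $P$ is a Borel probability measure on $\mathbb{R}_+=[0,\infty)$ with finite first moment $\mu\neq0$, if there exist positive random variables $Z_n$ (with $Z_n$ defined on the same probability space as $\mathbf{w}^{(n)}$) such that the random probability measures $\hat\nu^{(n)}:=\frac1n\sum_{i=1}^n\delta_{Z_nw_i^{(n)}}$ converge in law to the deterministic limit $P$ (as random elements of the space $\mathcal{P}(\mathbb{R}_+)$ of Borel probability measures with the weak topology), and the empirical means $\frac1n\sum_{i=1}^nZ_nw_i^{(n)}$ converge in law to $\mu$. Move-to-front chain. Let $p_i^{(n)}:=w_i^{(n)}/\sum_{j=1}^nw_j^{(n)}$ (convention $0/0:=0$). Objects labeled $1,\ldots,n$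 are kept in a list; at time $0$ object $i$ is at position $\pi(i)$, where $\pi$ is some permutation of $\{1,\ldots,n\}$ (position $1$ is the front of the list). Conditionally on $\mathbf{w}^{(n)}$, object $i$ is requested at the instants of a Poisson process on $[0,\infty)$ of rate $p_i^{(n)}$, independently for different $i$. Instantaneously after a request the requested object is moved to the front of the list, the relative order of the other objects being unchanged. The search-cost $S^{(n)}(t)$ is the position, in the list at time $t$ (before any modification due to a request at time $t$), of the first object requested in $[t,\infty)$; if all $w_j^{(n)}$ are zero, $S^{(n)}(t)=0$. LLN-$P$-ex: LLN-$P$ holds, $\pi$ is the identity, and for each $n$ the vector $\mathbf{w}^{(n)}$ is exchangeable. LLN-$P^-$: LLN-$P$ holds, $\pi$ is the identity, and for each $n$, $w_1^{(n)}\ge\cdots\ge w_n^{(n)}$ a.s. LLN-$P^+$: LLN-$P$ holds, $\pi$ is the identity, and for each $n$, $w_1^{(n)}\le\cdots\le w_n^{(n)}$ a.s. Existence and form of the limits. In each of the three cases the limit in distribution $S(t)$ exists and its law depends only on $P$ and $t$. With $\phi(s)=\int e^{-sx}P(dx)$, $\mathbf{p}_0=P(\{0\})$ and $f_{S^{(\infty)}}(x)=-\frac1\mu\frac{\phi''(\phi^{-1}(1-x))}{\phi'(\phi^{-1}(1-x))}\mathbf{1}_{[0,1-\mathbf{p}_0]}(x)$, the density of $S(t)$ is $f_{S^{(\infty)}}(x)$ on $[0,1-\phi(t)]$ in all three cases, and on $[1-\phi(t),1]$ it is: $\frac{|\phi'(t)|}{\mu\phi(t)}$ for $S^{ex}(t)$;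 $\frac1\mu g_t^{-1}(1-x)$ with $g_t(y)=\int_{[0,y]}e^{-zt}P(dz)$ for $S^-(t)$; and $\frac1\mu(1-g_t)^{-1}(x)$ with $g_t(y)=\int_{(y,\infty)}e^{-zt}P(dz)$ for $S^+(t)$. Here $g^{-1}(x)=\inf\{s\ge0:g(s)\ge x\}$ is the generalized inverse of a nondecreasing right-continuous function $g$. *)

theory Defs
  imports "HOL-Probability.Probability"
begin

section \<open>Probability measures on the half-line and convergence in law\<close>

text \<open>Borel probability measures on \<open>[0,\<infinity>)\<close>, viewed as measures on the line carried by \<open>[0,\<infinity>)\<close>.\<close>

definition nonneg_laws :: "real measure set" where
  "nonneg_laws = {\<nu>. real_distribution \<nu> \<and> (AE x in \<nu>. 0 \<le> x)}"

text \<open>The weak topology: the coarsest one for which \<open>\<nu> \<mapsto> \<integral>f d\<nu>\<close> is continuous for every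
  bounded continuous \<open>f\<close>. (Every bounded continuous function on \<open>[0,\<infinity>)\<close> extends to the line,
  so test functions on the line suffice. \<open>euclidean\<close> is here the product topology.)\<close>

definition weak_topology :: "real measure topology" where
  "weak_topology =
     pullback_topology nonneg_laws (\<lambda>\<nu> (f :: real \<Rightarrow>\<^sub>C real). \<integral>x. apply_bcontfun f x \<partial>\<nu>) euclidean"

definition converges_in_law_to_point ::
    "'b topology \<Rightarrow> (nat \<Rightarrow> 'a measure) \<Rightarrow> (nat \<Rightarrow> 'a \<Rightarrow> 'b) \<Rightarrow> 'b \<Rightarrow> bool" where
  "converges_in_law_to_point T M X c \<longleftrightarrow>
     (\<forall>\<Phi> :: 'b \<Rightarrow> real. continuous_map T euclideanreal \<Phi> \<and> bounded (\<Phi> ` topspace T) \<longrightarrow>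
        (\<lambda>n. \<integral>\<omega>. \<Phi> (X n \<omega>) \<partial>M n) \<longlonglongrightarrow> \<Phi> c)"

definition stochastically_smaller ::
    "'a measure \<Rightarrow> ('a \<Rightarrow> real) \<Rightarrow> 'b measure \<Rightarrow> ('b \<Rightarrow> real) \<Rightarrow> bool" where
  "stochastically_smaller A X B Y \<longleftrightarrow>
     (\<forall>z. measure A {\<omega> \<in> space A. X \<omega> \<le> z} \<ge> measure B {\<omega> \<in> space B. Y \<omega> \<le> z})"


section \<open>The move-to-front chain\<close>

text \<open>Objects are labelled \<open>1, \<dots>, n\<close>. Field \<open>requests X i \<omega>\<close> is the set of instants at which
  object \<open>i\<close> is requested, and \<open>init_pos X i\<close> is the position of object \<open>i\<close> at time 0.\<close>

record 'a mtf =
  sample :: "'a measure"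
  weight :: "nat \<Rightarrow> 'a \<Rightarrow> real"
  requests :: "nat \<Rightarrow> 'a \<Rightarrow> real set"
  init_pos :: "nat \<Rightarrow> nat"

definition request_rate :: "nat \<Rightarrow> 'a mtf \<Rightarrow> nat \<Rightarrow> 'a \<Rightarrow> real" where
  "request_rate n X i \<omega> = weight X i \<omega> / (\<Sum>j = 1..n. weight X j \<omega>)"

definition weight_vector :: "nat \<Rightarrow> 'a mtf \<Rightarrow> 'a \<Rightarrow> nat \<Rightarrow> real" where
  "weight_vector n X \<omega> = (\<lambda>i\<in>{1..n}. weight X i \<omega>)"

definition weight_algebra :: "nat \<Rightarrow> 'a mtf \<Rightarrow> 'a measure" where
  "weight_algebra n X =
     vimage_algebra (space (sample X)) (weight_vector n X) (\<Pi>\<^sub>M i\<in>{1..n}. borel)"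

definition request_count :: "'a mtf \<Rightarrow> nat \<Rightarrow> real \<Rightarrow> real \<Rightarrow> 'a \<Rightarrow> nat" where
  "request_count X i a b \<omega> = card (requests X i \<omega> \<inter> {a..<b})"

text \<open>Conditionally on the weights, the request processes are independent Poisson processes on
  \<open>[0,\<infinity>)\<close> with rates \<^term>\<open>request_rate\<close>: they are locally finite point processes whose counts over
  finitely many successive intervals are conditionally independent (jointly over intervals and
  objects) and Poisson distributed. The Poisson weights are spelled out because \<^const>\<open>poisson_pmf\<close> is
  unspecified at rate 0.\<close>

definition conditionally_poisson :: "nat \<Rightarrow> 'a mtf \<Rightarrow> bool" where
  "conditionally_poisson n X \<longleftrightarrow>
     (\<forall>i\<in>{1..n}. \<forall>\<omega>\<in>space (sample X).
        requests X i \<omega> \<subseteq> {0..} \<and> (\<forall>b. finite (requests X i \<omega> \<inter> {..b}))) \<and>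
     (\<forall>i\<in>{1..n}. \<forall>a b. request_count X i a b \<in> measurable (sample X) (count_space UNIV)) \<and>
     (\<forall>(K::nat) (\<tau> :: nat \<Rightarrow> real) (m :: nat \<Rightarrow> nat \<Rightarrow> nat).
        0 \<le> \<tau> 0 \<and> (\<forall>k<K. \<tau> k \<le> \<tau> (Suc k)) \<longrightarrow>
        (AE \<omega> in sample X.
           real_cond_exp (sample X) (weight_algebra n X)
             (indicator {\<omega> \<in> space (sample X).
                \<forall>i\<in>{1..n}. \<forall>k<K. request_count X i (\<tau> k) (\<tau> (Suc k)) \<omega> = m i k}) \<omega> =
           (\<Prod>i = 1..n. \<Prod>k<K.
              let r = request_rate n X i \<omega> * (\<tau> (Suc k) - \<tau> k)
              in r ^ m i k / fact (m i k) * exp (- r))))"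

definition mtf_chain :: "nat \<Rightarrow> 'a mtf \<Rightarrow> bool" where
  "mtf_chain n X \<longleftrightarrow>
     prob_space (sample X) \<and>
     (\<forall>i\<in>{1..n}. weight X i \<in> borel_measurable (sample X)) \<and>
     (\<forall>i\<in>{1..n}. \<forall>\<omega>\<in>space (sample X). 0 \<le> weight X i \<omega>) \<and>
     init_pos X permutes {1..n} \<and>
     conditionally_poisson n X"

definition move_to_front :: "'b \<Rightarrow> 'b list \<Rightarrow> 'b list" where
  "move_to_front x xs = x # remove1 x xs"

definition request_times :: "nat \<Rightarrow> 'a mtf \<Rightarrow> 'a \<Rightarrow> real set" where
  "request_times n X \<omega> = (\<Union>i\<in>{1..n}. requests X i \<omega>)"

text \<open>Two objects are almost surely never requested simultaneously; \<open>LEAST\<close> merely resolves that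
  null event.\<close>

definition requested_at :: "nat \<Rightarrow> 'a mtf \<Rightarrow> 'a \<Rightarrow> real \<Rightarrow> nat" where
  "requested_at n X \<omega> s = (LEAST i. i \<in> {1..n} \<and> s \<in> requests X i \<omega>)"

text \<open>The list at time \<open>t\<close> before any modification due to a request at time \<open>t\<close>: the requests made
  in \<open>[0,t)\<close> are served in chronological order, starting from the initial list, whose entry at
  position \<open>k\<close> is the object \<open>i\<close> with \<open>init_pos X i = k\<close>.\<close>

definition mtf_list :: "nat \<Rightarrow> 'a mtf \<Rightarrow> real \<Rightarrow> 'a \<Rightarrow> nat list" where
  "mtf_list n X t \<omega> =
     fold (\<lambda>s. move_to_front (requested_at n X \<omega> s))
       (sorted_list_of_set (request_times n X \<omega> \<inter> {0..<t}))
       (map (inv (init_pos X)) [1..<Suc n])"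

definition position :: "'b \<Rightarrow> 'b list \<Rightarrow> nat" where
  "position x xs = Suc (length (takeWhile (\<lambda>y. y \<noteq> x) xs))"

text \<open>By local finiteness the infimum is attained as soon as there is a request in \<open>[t,\<infinity>)\<close>, which
  is almost surely the case unless all weights vanish.\<close>

definition search_cost :: "nat \<Rightarrow> 'a mtf \<Rightarrow> real \<Rightarrow> 'a \<Rightarrow> nat" where
  "search_cost n X t \<omega> =
     (if \<forall>j\<in>{1..n}. weight X j \<omega> = 0 then 0
      else position (requested_at n X \<omega> (Inf (request_times n X \<omega> \<inter> {t..}))) (mtf_list n X t \<omega>))"


section \<open>The conditions on the weights\<close>

text \<open>The random probability measure \<open>(1/n) \<Sum>\<^sub>i \<delta>\<close> with atoms at \<open>Z w\<^sub>i\<close>.\<close>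

definition empirical_law :: "nat \<Rightarrow> 'a mtf \<Rightarrow> ('a \<Rightarrow> real) \<Rightarrow> 'a \<Rightarrow> real measure" where
  "empirical_law n X Z \<omega> =
     distr (uniform_count_measure {1..n}) borel (\<lambda>i. Z \<omega> * weight X i \<omega>)"

definition empirical_mean :: "nat \<Rightarrow> 'a mtf \<Rightarrow> ('a \<Rightarrow> real) \<Rightarrow> 'a \<Rightarrow> real" where
  "empirical_mean n X Z \<omega> = (\<Sum>i = 1..n. Z \<omega> * weight X i \<omega>) / real n"

definition LLN :: "real measure \<Rightarrow> (nat \<Rightarrow> 'a mtf) \<Rightarrow> bool" where
  "LLN P X \<longleftrightarrow>
     (\<exists>Z. (\<forall>n\<ge>1. Z n \<in> borel_measurable (sample (X n)) \<and> (\<forall>\<omega>\<in>space (sample (X n)). 0 < Z n \<omega>)) \<and>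
        converges_in_law_to_point weak_topology
          (\<lambda>n. sample (X n)) (\<lambda>n. empirical_law n (X n) (Z n)) P \<and>
        weak_conv_m (\<lambda>n. distr (sample (X n)) borel (empirical_mean n (X n) (Z n)))
          (return borel (\<integral>x. x \<partial>P)))"

definition exchangeable_weights :: "nat \<Rightarrow> 'a mtf \<Rightarrow> bool" where
  "exchangeable_weights n X \<longleftrightarrow>
     (\<forall>\<sigma>. \<sigma> permutes {1..n} \<longrightarrow>
        distr (sample X) (\<Pi>\<^sub>M i\<in>{1..n}. borel) (\<lambda>\<omega>. \<lambda>i\<in>{1..n}. weight X (\<sigma> i) \<omega>) =
        distr (sample X) (\<Pi>\<^sub>M i\<in>{1..n}. borel) (weight_vector n X))"

definition LLN_ex :: "real measure \<Rightarrow> (nat \<Rightarrow> 'a mtf) \<Rightarrow> bool" where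
  "LLN_ex P X \<longleftrightarrow> LLN P X \<and> (\<forall>n\<ge>1. init_pos (X n) = id) \<and>
     (\<forall>n\<ge>1. exchangeable_weights n (X n))"

definition LLN_minus :: "real measure \<Rightarrow> (nat \<Rightarrow> 'a mtf) \<Rightarrow> bool" where
  "LLN_minus P X \<longleftrightarrow> LLN P X \<and> (\<forall>n\<ge>1. init_pos (X n) = id) \<and>
     (\<forall>n\<ge>1. AE \<omega> in sample (X n). antimono_on {1..n} (\<lambda>i. weight (X n) i \<omega>))"

definition LLN_plus :: "real measure \<Rightarrow> (nat \<Rightarrow> 'a mtf) \<Rightarrow> bool" where
  "LLN_plus P X \<longleftrightarrow> LLN P X \<and> (\<forall>n\<ge>1. init_pos (X n) = id) \<and>
     (\<forall>n\<ge>1. AE \<omega> in sample (X n). mono_on {1..n} (\<lambda>i. weight (X n) i \<omega>))"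

definition limiting_search_cost ::
    "real measure \<Rightarrow> real \<Rightarrow> (nat \<Rightarrow> 'a mtf) \<Rightarrow> 'b measure \<Rightarrow> ('b \<Rightarrow> real) \<Rightarrow> bool" where
  "limiting_search_cost P t X N S \<longleftrightarrow>
     prob_space N \<and> S \<in> borel_measurable N \<and>
     weak_conv_m
       (\<lambda>n. distr (sample (X n)) borel
          (\<lambda>\<omega>. real (search_cost n (X n) (real n * (\<integral>x. x \<partial>P) * t) \<omega>) / real n))
       (distr N borel S)"

end

theory Submission
  imports Defs
begin

text \<open>The initial order of the list matters only through the objects that are not requested before the
  time \<open>T = n \<mu> t\<close> of the search, and this makes the three laws comparable.

  Fix the weights, hence the rates \<open>p\<^sub>i\<close>, and a duration \<open>a \<le> T\<close>. Let \<open>R\<close> be the set of objects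
  requested in \<open>[T - a, T)\<close> and \<open>U\<close> the first object requested from time \<open>T\<close> on. At time \<open>T\<close> the objects
  of \<open>R\<close> stand in front of all others, so the search cost is at most \<open>|R|\<close> if \<open>U\<close> is in \<open>R\<close> and exceeds
  \<open>|R|\<close> otherwise. Given the weights, \<open>R\<close> contains each object independently of the others, and \<open>U\<close> is
  independent of \<open>R\<close> and equal to \<open>i\<close> with probability \<open>p\<^sub>i\<close> (\<open>joint_law_lower_bound\<close>). By
  Chebyshev's inequality \<open>|R| / n\<close> concentrates, and for \<open>a = n \<mu> b\<close> the law of large numbers for the
  weights (\<open>rate_average_tendsto\<close>) sends it to \<open>1 - \<phi>(b)\<close>, where \<open>\<phi>\<close> is the Laplace transform of \<open>P\<close>,
  and sends the probability that \<open>U\<close> is outside \<open>R\<close> to \<open>\<beta>(b) = |\<phi>'(b)| / \<mu>\<close>. So for \<open>b \<le> t\<close> the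
  limiting search cost exceeds \<open>1 - \<phi>(b)\<close> with probability about \<open>\<beta>(b)\<close>, whatever the initial order:
  below \<open>1 - \<phi>(t)\<close> the three laws agree (\<open>limit_cdf_le_below\<close>, \<open>limit_cdf_ge_above\<close>).

  Above \<open>1 - \<phi>(t)\<close> take \<open>a = T\<close>. A cost beyond \<open>z n\<close> then means, up to events of small probability,
  that \<open>U\<close> is outside \<open>R\<close> and is one of the last \<open>k = n - \<lfloor>z n\<rfloor>\<close> of the \<open>l = n - |R|\<close> unrequested
  objects, which still are in their initial order. If the weights are exchangeable, a swap of two
  unrequested objects shows that each of them is equally likely to be \<open>U\<close>, so exactly the fraction
  \<open>k / l\<close> of the probability that \<open>U\<close> is outside \<open>R\<close> is obtained (\<open>exchangeable_tail_ranks\<close>). If the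
  weights decrease along the list, the last unrequested objects are the least popular ones, and
  Chebyshev's sum inequality (\<open>sum_upper_part_le\<close>) bounds the probability by the same fraction from
  above; if they increase, it does so from below. The common comparison value converges to
  \<open>(1 - z) / \<phi>(t) \<cdot> \<beta>(t)\<close>, and the order of the three distribution functions at continuity
  points extends to all points by right continuity.\<close>

section \<open>Random subsets with independent membership\<close>

text \<open>The law of a random subset of \<open>I\<close> that contains each \<open>j\<close> independently with probability \<open>r j\<close>.\<close>

definition random_subset_prob :: "'i set \<Rightarrow> ('i \<Rightarrow> real) \<Rightarrow> 'i set \<Rightarrow> real" where
  "random_subset_prob I r R = (\<Prod>j\<in>R. r j) * (\<Prod>j\<in>I - R. 1 - r j)"

lemma random_subset_prob_nonneg:
  assumes "\<And>j. j \<in> I \<Longrightarrow> 0 \<le> r j \<and> r j \<le> 1" "R \<subseteq> I"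
  shows "0 \<le> random_subset_prob I r R"
  unfolding random_subset_prob_def using assms
  by (intro mult_nonneg_nonneg prod_nonneg) auto

text \<open>Conditioning on whether the new point \<open>x\<close> belongs to the subset; all expectations below are computed
  by induction with this step.\<close>

lemma sum_random_subset_prob_insert:
  assumes "finite I" "x \<notin> I"
  shows "(\<Sum>R\<in>Pow (insert x I). random_subset_prob (insert x I) r R * f R) =
    (\<Sum>R\<in>Pow I. random_subset_prob I r R * ((1 - r x) * f R + r x * f (insert x R)))"
proof -
  have out: "random_subset_prob (insert x I) r R = (1 - r x) * random_subset_prob I r R"
    if "R \<in> Pow I" for R
  proof -
    have "insert x I - R = insert x (I - R)" using that assms by auto
    then show ?thesis using assms by (simp add: random_subset_prob_def)
  qed
  have ins: "random_subset_prob (insert x I) r (insert x R) = r x * random_subset_prob I r R"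
    if "R \<in> Pow I" for R
  proof -
    have "insert x I - insert x R = I - R" "x \<notin> R" "finite R"
      using that assms by (auto intro: finite_subset)
    then show ?thesis by (simp add: random_subset_prob_def)
  qed
  have "inj_on (insert x) (Pow I)"
    using assms(2) by (auto simp: inj_on_def)
  moreover have "Pow I \<inter> insert x ` Pow I = {}"
    using assms(2) by auto
  ultimately show ?thesis
    using assms(1)
    by (simp add: Pow_insert sum.union_disjoint sum.reindex out ins distrib_left sum.distrib
        mult_ac)
qed

lemma sum_random_subset_prob:
  "finite I \<Longrightarrow> (\<Sum>R\<in>Pow I. random_subset_prob I r R) = 1"
proof (induction rule: finite_induct)
  case (insert x I)
  then show ?case
    using sum_random_subset_prob_insert[of I x r "\<lambda>_. 1"] by simp
qed (simp add: random_subset_prob_def)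

lemma sum_random_subset_prob_not_mem:
  assumes "finite I" "i \<in> I"
  shows "(\<Sum>R\<in>Pow I. random_subset_prob I r R * (if i \<in> R then 0 else 1)) = 1 - r i"
proof -
  have I: "I = insert i (I - {i})" "finite (I - {i})" "i \<notin> I - {i}" using assms by auto
  have "(\<Sum>R\<in>Pow I. random_subset_prob I r R * (if i \<in> R then 0 else 1)) =
    (\<Sum>R\<in>Pow (I - {i}). random_subset_prob (I - {i}) r R *
       ((1 - r i) * (if i \<in> R then 0 else 1) + r i * (if i \<in> insert i R then 0 else 1)))"
    by (subst (1 2) I(1), subst sum_random_subset_prob_insert) (use I in auto)
  also have "\<dots> = (\<Sum>R\<in>Pow (I - {i}). (1 - r i) * random_subset_prob (I - {i}) r R)"
    by (intro sum.cong refl) auto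
  also have "\<dots> = 1 - r i"
    by (simp add: sum_distrib_left[symmetric] sum_random_subset_prob[OF I(2)])
  finally show ?thesis .
qed

text \<open>Linearity of expectation: \<open>i\<close> is outside the subset with probability \<open>1 - r i\<close>.\<close>

lemma sum_random_subset_prob_complement:
  assumes "finite I"
  shows "(\<Sum>R\<in>Pow I. random_subset_prob I r R * (\<Sum>i\<in>I - R. p i)) = (\<Sum>i\<in>I. p i * (1 - r i))"
proof -
  have "(\<Sum>R\<in>Pow I. random_subset_prob I r R * (\<Sum>i\<in>I - R. p i)) =
    (\<Sum>R\<in>Pow I. \<Sum>i\<in>I. p i * (random_subset_prob I r R * (if i \<in> R then 0 else 1)))"
  proof (intro sum.cong refl)
    fix R assume "R \<in> Pow I"
    have "(\<Sum>i\<in>I - R. p i) = (\<Sum>i\<in>I. if i \<in> R then 0 else p i)"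
      using assms by (intro sum.mono_neutral_cong_left) auto
    then show "random_subset_prob I r R * (\<Sum>i\<in>I - R. p i) =
      (\<Sum>i\<in>I. p i * (random_subset_prob I r R * (if i \<in> R then 0 else 1)))"
      by (auto simp: sum_distrib_left intro!: sum.cong)
  qed
  also have "\<dots> = (\<Sum>i\<in>I. p i * (\<Sum>R\<in>Pow I. random_subset_prob I r R * (if i \<in> R then 0 else 1)))"
    by (subst sum.swap) (simp only: sum_distrib_left)
  also have "\<dots> = (\<Sum>i\<in>I. p i * (1 - r i))"
    by (intro sum.cong refl) (simp only: sum_random_subset_prob_not_mem[OF assms])
  finally show ?thesis .
qed

text \<open>Variance plus squared bias. The centre \<open>c\<close> is arbitrary because adding a point to the subset amounts
  to replacing \<open>c\<close> by \<open>c - 1\<close>, which is how the induction proceeds.\<close>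

lemma random_subset_second_moment:
  assumes "finite I"
  shows "(\<Sum>R\<in>Pow I. random_subset_prob I r R * (real (card R) - c)\<^sup>2) =
    (\<Sum>j\<in>I. r j * (1 - r j)) + ((\<Sum>j\<in>I. r j) - c)\<^sup>2"
  using assms
proof (induction arbitrary: c rule: finite_induct)
  case (insert x I)
  have "(\<Sum>R\<in>Pow (insert x I). random_subset_prob (insert x I) r R * (real (card R) - c)\<^sup>2) =
    (\<Sum>R\<in>Pow I. random_subset_prob I r R *
      ((1 - r x) * (real (card R) - c)\<^sup>2 + r x * (real (card R) - (c - 1))\<^sup>2))"
    using insert.hyps
    by (subst sum_random_subset_prob_insert)
       (auto intro!: sum.cong simp: card_insert_if finite_subset algebra_simps dest: finite_subset)
  also have "\<dots> = (1 - r x) * (\<Sum>R\<in>Pow I. random_subset_prob I r R * (real (card R) - c)\<^sup>2)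
     + r x * (\<Sum>R\<in>Pow I. random_subset_prob I r R * (real (card R) - (c - 1))\<^sup>2)"
    unfolding sum_distrib_left sum.distrib[symmetric]
    by (intro sum.cong refl) (simp only: algebra_simps)
  also have "\<dots> = (\<Sum>j\<in>insert x I. r j * (1 - r j)) + ((\<Sum>j\<in>insert x I. r j) - c)\<^sup>2"
    using insert.hyps unfolding insert.IH
    by (simp add: power2_eq_square algebra_simps)
  finally show ?case .
qed (simp add: random_subset_prob_def)


text \<open>The variance of the cardinality is at most \<open>n\<close>. The bias has absolute value at most 1, so its
  square is at most its absolute value, a quantity that the law of large numbers makes small in mean.\<close>

lemma random_subset_deviation:
  assumes "finite I" "\<And>j. j \<in> I \<Longrightarrow> 0 \<le> r j \<and> r j \<le> 1"
    and n: "card I = n" "n > 0" and c: "0 \<le> c" "c \<le> 1"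
  shows "(\<Sum>R\<in>Pow I. random_subset_prob I r R * (real (card R) / n - c)\<^sup>2)
    \<le> 1 / n + \<bar>(\<Sum>j\<in>I. r j) / n - c\<bar>"
proof -
  have sq: "(real k / n - c)\<^sup>2 = (real k - n * c)\<^sup>2 / n\<^sup>2" for k
    using n by (simp add: power2_eq_square field_simps)
  let ?M = "\<Sum>j\<in>I. r j"
  have "(\<Sum>R\<in>Pow I. random_subset_prob I r R * (real (card R) / n - c)\<^sup>2) =
     (\<Sum>R\<in>Pow I. random_subset_prob I r R * (real (card R) - n * c)\<^sup>2) / n\<^sup>2"
    by (simp add: sq sum_divide_distrib)
  also have "\<dots> = (\<Sum>j\<in>I. r j * (1 - r j)) / n\<^sup>2 + (?M - n * c)\<^sup>2 / n\<^sup>2"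
    unfolding random_subset_second_moment[OF assms(1)] by (simp add: add_divide_distrib)
  also have "(?M - n * c)\<^sup>2 / n\<^sup>2 = (?M / n - c)\<^sup>2"
    using n by (simp add: power2_eq_square field_simps)
  also have "\<dots> \<le> \<bar>?M / n - c\<bar>"
  proof -
    have "0 \<le> ?M" "?M \<le> (\<Sum>j\<in>I. 1)"
      by (intro sum_nonneg sum_mono; use assms(2) in simp)+
    then have "0 \<le> ?M / n" "?M / n \<le> 1" using n by (auto simp: field_simps)
    then have "\<bar>?M / n - c\<bar> \<le> 1" using c by linarith
    then have "\<bar>?M / n - c\<bar> * \<bar>?M / n - c\<bar> \<le> \<bar>?M / n - c\<bar>"
      by (rule mult_left_le) auto
    then show ?thesis by (simp add: power2_eq_square)
  qed
  also have "(\<Sum>j\<in>I. r j * (1 - r j)) \<le> (\<Sum>j\<in>I. 1)"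
    using assms(2) by (intro sum_mono) (auto intro!: mult_le_one)
  then have "(\<Sum>j\<in>I. r j * (1 - r j)) / n\<^sup>2 \<le> 1 / n"
    using n by (simp add: power2_eq_square field_simps)
  finally show ?thesis by simp
qed

section \<open>The list after a sequence of requests\<close>

lemma remdups_snoc: "remdups (xs @ [x]) = filter (\<lambda>y. y \<noteq> x) (remdups xs) @ [x]"
  by (induction xs) auto

text \<open>The requested objects come first, the latest request leading: \<^const>\<open>remdups\<close> keeps the last
  occurrence of each object, and \<^const>\<open>rev\<close> puts the latest in front.\<close>

lemma fold_move_to_front:
  assumes "distinct xs" "set os \<subseteq> set xs"
  shows "fold move_to_front os xs = rev (remdups os) @ filter (\<lambda>x. x \<notin> set os) xs"
  using assms(2)
proof (induction os rule: rev_induct)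
  case (snoc x os)
  let ?ys = "rev (remdups os) @ filter (\<lambda>x. x \<notin> set os) xs"
  have "distinct ?ys" using assms(1) by auto
  then have "remove1 x ?ys = filter (\<lambda>y. y \<noteq> x) ?ys"
    by (simp only: distinct_remove1_removeAll removeAll_filter_not_eq) (simp add: eq_commute)
  then have "fold move_to_front (os @ [x]) xs = x # filter (\<lambda>y. y \<noteq> x) ?ys"
    using snoc.IH snoc.prems
    by (simp add: move_to_front_def[of x ?ys] del: filter_append)
  also have "\<dots> = rev (remdups (os @ [x])) @ filter (\<lambda>y. y \<notin> set (os @ [x])) xs"
    by (auto simp: remdups_snoc rev_filter intro!: filter_cong)
  finally show ?case .
qed (use filter_True in auto)

lemma position_append_notin: "x \<notin> set ys \<Longrightarrow> position x (ys @ zs) = length ys + position x zs"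
proof -
  assume "x \<notin> set ys"
  then have "takeWhile (\<lambda>y. y \<noteq> x) (ys @ zs) = ys @ takeWhile (\<lambda>y. y \<noteq> x) zs"
    by (intro takeWhile_append2) auto
  then show ?thesis by (simp add: position_def)
qed

lemma position_append_le: "x \<in> set ys \<Longrightarrow> position x (ys @ zs) \<le> length ys"
proof -
  assume x: "x \<in> set ys"
  then have "takeWhile (\<lambda>y. y \<noteq> x) (ys @ zs) = takeWhile (\<lambda>y. y \<noteq> x) ys"
    by (intro takeWhile_append1) auto
  moreover have "length (takeWhile (\<lambda>y. y \<noteq> x) ys) < length ys"
    using x by (induction ys) auto
  ultimately show ?thesis by (simp add: position_def)
qed

lemma position_filter_upt:
  assumes "i \<in> {1..n}" "P i"
  shows "position i (filter P [1..<Suc n]) = card {j\<in>{1..n}. j \<le> i \<and> P j}"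
proof -
  have split: "[1..<Suc n] = [1..<i] @ i # [Suc i..<Suc n]"
    using assms(1) upt_add_eq_append[of 1 i "Suc n - i"] upt_conv_Cons[of i "Suc n"] by simp
  have "position i (filter P [1..<Suc n]) = length (filter P [1..<i]) + 1"
    unfolding split using assms(2) by (simp add: position_append_notin) (simp add: position_def)
  also have "length (filter P [1..<i]) = card (set (filter P [1..<i]))"
    by (intro distinct_card[symmetric]) simp
  also have "\<dots> + 1 = card (insert i (set (filter P [1..<i])))"
    by (subst card_insert_disjoint) auto
  also have "insert i (set (filter P [1..<i])) = {j\<in>{1..n}. j \<le> i \<and> P j}"
    using assms by auto
  finally show ?thesis .
qed

lemma sorted_list_of_set_Un_less:
  fixes A B :: "'b :: linorder set"
  assumes "finite A" "finite B" "\<And>x y. x \<in> A \<Longrightarrow> y \<in> B \<Longrightarrow> x < y"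
  shows "sorted_list_of_set (A \<union> B) = sorted_list_of_set A @ sorted_list_of_set B"
proof -
  have "sorted (sorted_list_of_set A @ sorted_list_of_set B)"
    using assms(1,2) by (auto simp: sorted_append dest: assms(3))
  moreover have "distinct (sorted_list_of_set A @ sorted_list_of_set B)"
    using assms(1,2) by (auto dest: assms(3))
  ultimately have "sorted_list_of_set (set (sorted_list_of_set A @ sorted_list_of_set B)) =
      sorted_list_of_set A @ sorted_list_of_set B"
    by (rule sorted_list_of_set.idem_if_sorted_distinct)
  then show ?thesis using assms(1,2) by simp
qed

definition requested_in :: "nat \<Rightarrow> 'a mtf \<Rightarrow> real \<Rightarrow> real \<Rightarrow> 'a \<Rightarrow> nat set" where
  "requested_in n X b c \<omega> = {i\<in>{1..n}. requests X i \<omega> \<inter> {b..<c} \<noteq> {}}"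

text \<open>When two objects are requested at the same instant, \<^const>\<open>requested_at\<close> serves only one of them, so a
  requested object may fail to move. This has to be excluded for the times before \<open>T\<close>.\<close>

definition no_simultaneous_requests :: "nat \<Rightarrow> 'a mtf \<Rightarrow> real \<Rightarrow> 'a \<Rightarrow> bool" where
  "no_simultaneous_requests n X T \<omega> \<longleftrightarrow>
     (\<forall>i\<in>{1..n}. \<forall>j\<in>{1..n}. \<forall>s\<in>requests X i \<omega> \<inter> requests X j \<omega>. s < T \<longrightarrow> i = j)"

definition first_requested :: "nat \<Rightarrow> 'a mtf \<Rightarrow> real \<Rightarrow> 'a \<Rightarrow> nat" where
  "first_requested n X T \<omega> = requested_at n X \<omega> (Inf (request_times n X \<omega> \<inter> {T..}))"

lemma requested_at_eqI:
  assumes "i \<in> {1..n}" "s \<in> requests X i \<omega>"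
    and "\<And>j. j \<in> {1..n} \<Longrightarrow> s \<in> requests X j \<omega> \<Longrightarrow> j = i"
  shows "requested_at n X \<omega> s = i"
  unfolding requested_at_def
proof (rule Least_equality)
  show "i \<in> {1..n} \<and> s \<in> requests X i \<omega>" using assms(1,2) by blast
  show "i \<le> j" if "j \<in> {1..n} \<and> s \<in> requests X j \<omega>" for j
    using assms(3)[of j] that by blast
qed

text \<open>Serve the requests before time \<open>b\<close> first. Whatever list \<open>zs\<close> they leave, the requests in \<open>[b, T)\<close>
  bring precisely the objects requested there to its front.\<close>

lemma mtf_list_split:
  assumes fin: "\<And>i. i \<in> {1..n} \<Longrightarrow> finite (requests X i \<omega> \<inter> {..T})"
    and simult: "no_simultaneous_requests n X T \<omega>"
    and init: "init_pos X = id"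
    and b: "0 \<le> b" "b \<le> T"
  obtains ys zs where
    "mtf_list n X T \<omega> = ys @ filter (\<lambda>j. j \<notin> requested_in n X b T \<omega>) zs"
    "distinct ys" "set ys = requested_in n X b T \<omega>" "set zs = {1..n}"
    "b = 0 \<Longrightarrow> zs = [1..<Suc n]"
proof -
  let ?rt = "request_times n X \<omega>" and ?ra = "requested_at n X \<omega>"
  let ?A = "?rt \<inter> {0..<b}" and ?B = "?rt \<inter> {b..<T}"
  have "finite (?rt \<inter> {..T})"
    unfolding request_times_def UN_extend_simps by (intro finite_UN_I fin) auto
  moreover have "?A \<subseteq> ?rt \<inter> {..T}" "?B \<subseteq> ?rt \<inter> {..T}" using b by auto
  ultimately have finA: "finite ?A" and finB: "finite ?B" by (meson finite_subset)+
  have ra: "?ra s = i" if "s \<in> requests X i \<omega>" "i \<in> {1..n}" "s < T" for s i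
  proof (rule requested_at_eqI)
    show "j = i" if "j \<in> {1..n}" "s \<in> requests X j \<omega>" for j
      using simult that \<open>s \<in> requests X i \<omega>\<close> \<open>i \<in> {1..n}\<close> \<open>s < T\<close>
      unfolding no_simultaneous_requests_def by blast
  qed (use that in auto)
  have ra_mem: "?ra s \<in> {1..n}" if s: "s \<in> ?rt" "s < T" for s
  proof -
    obtain i where "i \<in> {1..n}" "s \<in> requests X i \<omega>"
      using s unfolding request_times_def by blast
    then show ?thesis using ra[of s i] s by simp
  qed
  define os1 where "os1 = map ?ra (sorted_list_of_set ?A)"
  define os2 where "os2 = map ?ra (sorted_list_of_set ?B)"
  define zs where "zs = fold move_to_front os1 [1..<Suc n]"
  have "{0..<T} = {0..<b} \<union> {b..<T}" using b by auto
  then have "?rt \<inter> {0..<T} = ?A \<union> ?B" by (simp only: Int_Un_distrib)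
  then have "sorted_list_of_set (?rt \<inter> {0..<T}) = sorted_list_of_set ?A @ sorted_list_of_set ?B"
    by (simp only:) (intro sorted_list_of_set_Un_less finA finB, auto)
  moreover have "fold (\<lambda>s. move_to_front (?ra s)) ts = fold move_to_front (map ?ra ts)" for ts
    by (simp add: fold_map o_def)
  ultimately have list: "mtf_list n X T \<omega> = fold move_to_front os2 zs"
    unfolding mtf_list_def os1_def os2_def zs_def by (simp add: init)
  have os1: "set os1 \<subseteq> {1..n}"
    unfolding os1_def set_map set_sorted_list_of_set[OF finA]
    by (rule image_subsetI, rule ra_mem) (use b in auto)
  have os2_sub: "set os2 \<subseteq> {1..n}"
    unfolding os2_def set_map set_sorted_list_of_set[OF finB]
    by (rule image_subsetI, rule ra_mem) auto
  have zs_eq: "zs = rev (remdups os1) @ filter (\<lambda>x. x \<notin> set os1) [1..<Suc n]"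
    unfolding zs_def using os1 by (intro fold_move_to_front) auto
  have "distinct zs" unfolding zs_eq by (auto simp del: upt_Suc)
  moreover have "set zs = set os1 \<union> ({1..n} - set os1)" unfolding zs_eq by auto
  ultimately have zs: "distinct zs" "set zs = {1..n}" using os1 by (simp_all only: Un_Diff_cancel Un_absorb1)
  have os2: "set os2 = requested_in n X b T \<omega>"
  proof (intro equalityI subsetI)
    fix i assume "i \<in> set os2"
    then obtain s where s: "s \<in> ?rt" "s \<in> {b..<T}" "i = ?ra s"
      unfolding os2_def set_map set_sorted_list_of_set[OF finB] by blast
    then obtain j where j: "j \<in> {1..n}" "s \<in> requests X j \<omega>" unfolding request_times_def by blast
    then have "i = j" using s ra[of s j] by simp
    then show "i \<in> requested_in n X b T \<omega>"
      using s j unfolding requested_in_def by blast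
  next
    fix i assume "i \<in> requested_in n X b T \<omega>"
    then obtain s where s: "i \<in> {1..n}" "s \<in> requests X i \<omega>" "s \<in> {b..<T}"
      unfolding requested_in_def by blast
    then have "?ra s = i" using ra[of s i] by simp
    moreover have "s \<in> ?B" using s unfolding request_times_def by blast
    ultimately show "i \<in> set os2"
      unfolding os2_def set_map set_sorted_list_of_set[OF finB] by blast
  qed
  show thesis
  proof (rule that[of "rev (remdups os2)" zs])
    show "mtf_list n X T \<omega> = rev (remdups os2) @ filter (\<lambda>j. j \<notin> requested_in n X b T \<omega>) zs"
      unfolding list os2[symmetric] using zs os2_sub by (intro fold_move_to_front) simp_all
    show "zs = [1..<Suc n]" if "b = 0" unfolding zs_def os1_def using that by simp
  qed (simp_all only: zs os2 set_rev set_remdups distinct_rev distinct_remdups)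
qed

lemma position_mtf_list:
  assumes "\<And>i. i \<in> {1..n} \<Longrightarrow> finite (requests X i \<omega> \<inter> {..T})"
    and "no_simultaneous_requests n X T \<omega>" "init_pos X = id" "0 \<le> b" "b \<le> T"
    and i: "i \<in> {1..n}"
  defines "R \<equiv> requested_in n X b T \<omega>"
  shows "i \<in> R \<Longrightarrow> position i (mtf_list n X T \<omega>) \<le> card R"
    and "i \<notin> R \<Longrightarrow> card R < position i (mtf_list n X T \<omega>)"
    and "i \<notin> R \<Longrightarrow> b = 0 \<Longrightarrow>
      position i (mtf_list n X T \<omega>) = card R + card {j\<in>{1..n} - R. j \<le> i}"
proof -
  obtain ys zs where *: "mtf_list n X T \<omega> = ys @ filter (\<lambda>j. j \<notin> R) zs"
    "distinct ys" "set ys = R" "set zs = {1..n}" "b = 0 \<Longrightarrow> zs = [1..<Suc n]"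
    using mtf_list_split[OF assms(1-5), folded R_def] by metis
  have len: "length ys = card R" using *(2,3) distinct_card by metis
  show "i \<in> R \<Longrightarrow> position i (mtf_list n X T \<omega>) \<le> card R"
    unfolding *(1) len[symmetric] by (rule position_append_le) (simp only: *(3))
  assume "i \<notin> R"
  then have pos: "position i (mtf_list n X T \<omega>) = card R + position i (filter (\<lambda>j. j \<notin> R) zs)"
    using position_append_notin[of i ys "filter (\<lambda>j. j \<notin> R) zs"] by (simp add: *(1,3) len)
  then show "card R < position i (mtf_list n X T \<omega>)" by (simp add: position_def)
  assume "b = 0"
  moreover have "{j\<in>{1..n}. j \<le> i \<and> j \<notin> R} = {j\<in>{1..n} - R. j \<le> i}" by auto
  ultimately show "position i (mtf_list n X T \<omega>) = card R + card {j\<in>{1..n} - R. j \<le> i}"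
    using pos position_filter_upt[OF i, of "\<lambda>j. j \<notin> R"] \<open>i \<notin> R\<close> *(5) by (simp del: upt_Suc)
qed

text \<open>The first object requested from time \<open>T\<close> on is determined by the request counts in two intervals,
  whose probabilities the model provides.\<close>

lemma first_requested_eqI:
  assumes i: "i \<in> {1..n}"
    and fin: "\<And>j. j \<in> {1..n} \<Longrightarrow> finite (requests X j \<omega> \<inter> {..d})"
    and "T \<le> c" "requested_in n X T c \<omega> = {}" "requested_in n X c d \<omega> = {i}"
  shows "first_requested n X T \<omega> = i"
proof -
  let ?A = "requests X i \<omega> \<inter> {c..<d}"
  have "finite ?A" by (rule finite_subset[OF _ fin[OF i]]) auto
  moreover have "?A \<noteq> {}" using assms(5) by (auto simp: requested_in_def)
  ultimately have A: "finite ?A" "?A \<noteq> {}" by auto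
  have none: "j = i" if "j \<in> {1..n}" "s \<in> requests X j \<omega>" "c \<le> s" "s < d" for j s
  proof -
    have "j \<in> requested_in n X c d \<omega>" using that by (auto simp: requested_in_def)
    then show ?thesis using assms(5) by simp
  qed
  have after: "c \<le> s" if "j \<in> {1..n}" "s \<in> requests X j \<omega>" "T \<le> s" for j s
  proof (rule ccontr)
    assume "\<not> c \<le> s"
    then have "j \<in> requested_in n X T c \<omega>" using that by (auto simp: requested_in_def)
    then show False using assms(4) by simp
  qed
  define m where "m = Min ?A"
  have "m \<in> ?A" unfolding m_def using A by (rule Min_in)
  then have m: "m \<in> requests X i \<omega>" "c \<le> m" "m < d" by auto
  have m_le: "m \<le> s" if "s \<in> ?A" for s
    unfolding m_def using A(1) that by (rule Min_le)
  have "Inf (request_times n X \<omega> \<inter> {T..}) = m"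
  proof (rule cInf_eq_minimum)
    show "m \<in> request_times n X \<omega> \<inter> {T..}"
      using m i assms(3) unfolding request_times_def by auto
  next
    fix s assume "s \<in> request_times n X \<omega> \<inter> {T..}"
    then obtain j where j: "j \<in> {1..n}" "s \<in> requests X j \<omega>" "T \<le> s"
      unfolding request_times_def by blast
    show "m \<le> s"
    proof (cases "s < d")
      case True
      have "c \<le> s" by (rule after[OF j])
      then have "j = i" using none[OF j(1,2)] True by blast
      then show ?thesis using j(2) \<open>c \<le> s\<close> True by (intro m_le) simp
    next
      case False
      then show ?thesis using m(3) by linarith
    qed
  qed
  moreover have "requested_at n X \<omega> m = i"
    using i m(1) none[OF _ _ m(2,3)] by (rule requested_at_eqI)
  ultimately show ?thesis unfolding first_requested_def by simp
qed

section \<open>Request counts\<close>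

text \<open>The Poisson law, extended to rate 0, the rate of an object of weight 0.\<close>

definition poisson_or_zero :: "real \<Rightarrow> nat pmf" where
  "poisson_or_zero r = (if r > 0 then poisson_pmf r else return_pmf 0)"

lemma pmf_poisson_or_zero: "0 \<le> r \<Longrightarrow> pmf (poisson_or_zero r) k = r ^ k / fact k * exp (- r)"
  by (cases "r = 0") (auto simp: poisson_or_zero_def pmf_return indicator_def zero_power)

lemma prob_poisson_or_zero_none: "0 \<le> r \<Longrightarrow> measure_pmf.prob (poisson_or_zero r) {0} = exp (- r)"
  by (simp add: measure_pmf_single pmf_poisson_or_zero)

lemma prob_poisson_or_zero_some: "0 \<le> r \<Longrightarrow> measure_pmf.prob (poisson_or_zero r) {0<..} = 1 - exp (- r)"
proof -
  assume "0 \<le> r"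
  have "{0<..} = (UNIV - {0} :: nat set)" by auto
  then show ?thesis
    using measure_pmf.prob_compl[of "{0}" "poisson_or_zero r"] prob_poisson_or_zero_none[OF \<open>0 \<le> r\<close>]
    by simp
qed

lemma measurable_prob_poisson_or_zero [measurable]:
  "(\<lambda>r. measure_pmf.prob (poisson_or_zero r) B) \<in> borel_measurable borel"
proof -
  have pmf: "(\<lambda>r. pmf (poisson_or_zero r) k) \<in> borel_measurable borel" for k
  proof -
    have "pmf (poisson_or_zero r) k =
        (if r > 0 then r ^ k / fact k * exp (- r) else indicator {0} k)" for r
      by (simp add: poisson_or_zero_def pmf_return indicator_def)
    then show ?thesis by (simp only:) measurable
  qed
  have "measure_pmf.prob (poisson_or_zero r) B =
      enn2real (\<Sum>k. ennreal (pmf (poisson_or_zero r) k) * indicator B k)" for r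
    unfolding measure_def
    by (simp only: nn_integral_pmf[symmetric] nn_integral_count_space_nat
        nn_integral_count_space_indicator[of B "\<lambda>k. ennreal (pmf (poisson_or_zero r) k)"])
       (simp add: nn_integral_count_space_indicator nn_integral_count_space_nat)
  then show ?thesis
    by (simp only:) (intro borel_measurable_enn2real borel_measurable_suminf_order
      borel_measurable_times_ennreal borel_measurable_const measurable_compose[OF pmf measurable_ennreal])
qed

locale mtf_model =
  fixes n :: nat and X :: "'a mtf"
  assumes chain: "mtf_chain n X"
begin

abbreviation "M \<equiv> sample X"
abbreviation "p \<equiv> request_rate n X"

sublocale prob_space M
  using chain by (simp add: mtf_chain_def)

lemma weight_measurable [measurable (raw)]: "i \<in> {1..n} \<Longrightarrow> weight X i \<in> borel_measurable M"
  using chain by (simp add: mtf_chain_def)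

lemma weight_nonneg: "i \<in> {1..n} \<Longrightarrow> \<omega> \<in> space M \<Longrightarrow> 0 \<le> weight X i \<omega>"
  using chain by (simp add: mtf_chain_def)

lemma rate_measurable [measurable (raw)]: "i \<in> {1..n} \<Longrightarrow> p i \<in> borel_measurable M"
proof -
  assume i: "i \<in> {1..n}"
  have [measurable]: "(\<lambda>\<omega>. \<Sum>j = 1..n. weight X j \<omega>) \<in> borel_measurable M"
    by (intro borel_measurable_sum weight_measurable)
  note [measurable] = weight_measurable[OF i]
  show ?thesis unfolding request_rate_def[abs_def] by measurable
qed

lemma rate_nonneg: "i \<in> {1..n} \<Longrightarrow> \<omega> \<in> space M \<Longrightarrow> 0 \<le> p i \<omega>"
  unfolding request_rate_def by (intro divide_nonneg_nonneg sum_nonneg weight_nonneg) auto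

lemma sum_rate: "\<omega> \<in> space M \<Longrightarrow> (\<Sum>i = 1..n. p i \<omega>) = (if \<forall>i\<in>{1..n}. weight X i \<omega> = 0 then 0 else 1)"
proof -
  assume "\<omega> \<in> space M"
  then have "(\<Sum>i = 1..n. weight X i \<omega>) = 0 \<longleftrightarrow> (\<forall>i\<in>{1..n}. weight X i \<omega> = 0)"
    by (intro sum_nonneg_eq_0_iff weight_nonneg) auto
  moreover have "(\<Sum>i = 1..n. p i \<omega>) = (\<Sum>i = 1..n. weight X i \<omega>) / (\<Sum>i = 1..n. weight X i \<omega>)"
    unfolding request_rate_def by (simp only: sum_divide_distrib)
  ultimately show ?thesis by auto
qed

lemma sum_rate_le_1: "\<omega> \<in> space M \<Longrightarrow> (\<Sum>i = 1..n. p i \<omega>) \<le> 1"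
  using sum_rate[of \<omega>] by (simp split: if_splits)

lemma count_measurable [measurable (raw)]:
  "i \<in> {1..n} \<Longrightarrow> request_count X i a b \<in> measurable M (count_space UNIV)"
  using chain by (simp add: mtf_chain_def conditionally_poisson_def)

lemma count_event [measurable (raw)]:
  "i \<in> {1..n} \<Longrightarrow> {\<omega>\<in>space M. request_count X i a b \<omega> \<in> B} \<in> sets M"
  using measurable_sets[OF count_measurable, of i B a b] by (simp add: vimage_def Int_def conj_commute)

lemma counts_event:
  "{\<omega>\<in>space M. \<forall>i\<in>{1..n}. \<forall>k<K. request_count X i (\<tau> k) (\<tau> (Suc k)) \<omega> \<in> B i k} \<in> sets M"
proof -
  have "{\<omega>\<in>space M. \<forall>i\<in>{1..n}. \<forall>k\<in>{..<K}. request_count X i (\<tau> k) (\<tau> (Suc k)) \<omega> \<in> B i k} \<in> sets M"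
    by (intro sets.sets_Collect_finite_All count_event) auto
  then show ?thesis by simp
qed

lemma subalgebra_weights: "subalgebra M (weight_algebra n X)"
proof -
  have "weight_vector n X \<in> measurable M (\<Pi>\<^sub>M i\<in>{1..n}. borel)"
    unfolding weight_vector_def[abs_def] by (intro measurable_restrict weight_measurable)
  then show ?thesis
    unfolding subalgebra_def weight_algebra_def by (intro conjI sets_image_in_sets) simp_all
qed

text \<open>Taking expectations in the conditional law of the counts given the weights.\<close>

lemma prob_counts_eq:
  fixes m :: "nat \<Rightarrow> nat \<Rightarrow> nat"
  assumes "0 \<le> \<tau> 0" "\<And>k. k < K \<Longrightarrow> \<tau> k \<le> \<tau> (Suc k)"
  defines "q \<equiv> \<lambda>\<omega>. \<Prod>i = 1..n. \<Prod>k<K. pmf (poisson_or_zero (p i \<omega> * (\<tau> (Suc k) - \<tau> k))) (m i k)"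
  shows "q \<in> borel_measurable M"
    and "emeasure M {\<omega>\<in>space M. \<forall>i\<in>{1..n}. \<forall>k<K. request_count X i (\<tau> k) (\<tau> (Suc k)) \<omega> = m i k}
      = (\<integral>\<^sup>+\<omega>. ennreal (q \<omega>) \<partial>M)"
proof -
  let ?E = "{\<omega>\<in>space M. \<forall>i\<in>{1..n}. \<forall>k<K. request_count X i (\<tau> k) (\<tau> (Suc k)) \<omega> = m i k}"
  let ?q = "\<lambda>\<omega>. \<Prod>i = 1..n. \<Prod>k<K. let r = p i \<omega> * (\<tau> (Suc k) - \<tau> k)
              in r ^ m i k / fact (m i k) * exp (- r)"
  have q: "q \<omega> = ?q \<omega>" if "\<omega> \<in> space M" for \<omega>
    unfolding q_def Let_def using that assms(2)
    by (intro prod.cong refl pmf_poisson_or_zero mult_nonneg_nonneg rate_nonneg) auto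
  have "?q \<in> borel_measurable M"
    unfolding Let_def
    by (intro borel_measurable_prod borel_measurable_times borel_measurable_divide
        borel_measurable_power borel_measurable_const rate_measurable
        borel_measurable_exp[THEN measurable_compose[rotated]] borel_measurable_uminus) auto
  then show q_meas: "q \<in> borel_measurable M"
    by (rule measurable_cong[THEN iffD2, rotated]) (rule q)
  have q01: "0 \<le> q \<omega>" "q \<omega> \<le> 1" for \<omega>
    unfolding q_def by (auto intro!: prod_nonneg prod_le_1 pmf_le_1)
  then have q_int: "integrable M q"
    using q_meas by (intro integrable_const_bound[where B = 1]) auto
  have E: "?E \<in> sets M"
    using counts_event[of K \<tau> "\<lambda>i k. {m i k}"] by simp
  interpret W: finite_measure_subalgebra M "weight_algebra n X"
    by standard (rule subalgebra_weights)
  have "AE \<omega> in M. real_cond_exp M (weight_algebra n X) (indicator ?E) \<omega> = ?q \<omega>"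
    using chain assms(1,2) unfolding mtf_chain_def conditionally_poisson_def by blast
  then have "AE \<omega> in M. real_cond_exp M (weight_algebra n X) (indicator ?E) \<omega> = q \<omega>"
    using AE_space by eventually_elim (simp add: q)
  then have "(\<integral>\<omega>. real_cond_exp M (weight_algebra n X) (indicator ?E) \<omega> \<partial>M) = (\<integral>\<omega>. q \<omega> \<partial>M)"
    using q_meas by (intro integral_cong_AE) auto
  moreover have "integrable M (indicator ?E :: 'a \<Rightarrow> real)"
    using E by (intro integrable_real_indicator) (auto simp: emeasure_eq_measure)
  then have "(\<integral>\<omega>. real_cond_exp M (weight_algebra n X) (indicator ?E) \<omega> \<partial>M) = (\<integral>\<omega>. indicator ?E \<omega> \<partial>M)"
    by (rule W.real_cond_exp_int(2))
  ultimately have "measure M ?E = (\<integral>\<omega>. q \<omega> \<partial>M)"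
    using E by (simp add: Int_absorb1)
  then show "emeasure M ?E = (\<integral>\<^sup>+\<omega>. ennreal (q \<omega>) \<partial>M)"
    using q_int q01 by (simp add: emeasure_eq_measure nn_integral_eq_integral)
qed


text \<open>For fixed weights the product of Poisson probabilities is the mass function of a product law, so
  its sum over a product set of count patterns factorises. There are countably many patterns, hence
  the sum may be exchanged with the expectation over the weights.\<close>

lemma prob_counts_mem:
  fixes B :: "nat \<Rightarrow> nat \<Rightarrow> nat set"
  assumes \<tau>: "0 \<le> \<tau> 0" "\<And>k. k < K \<Longrightarrow> \<tau> k \<le> \<tau> (Suc k)"
  defines "q \<equiv> \<lambda>\<omega>. \<Prod>i = 1..n. \<Prod>k<K.
      measure_pmf.prob (poisson_or_zero (p i \<omega> * (\<tau> (Suc k) - \<tau> k))) (B i k)"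
  shows "prob {\<omega>\<in>space M. \<forall>i\<in>{1..n}. \<forall>k<K. request_count X i (\<tau> k) (\<tau> (Suc k)) \<omega> \<in> B i k}
      = (\<integral>\<omega>. q \<omega> \<partial>M)"
    and "integrable M q"
proof -
  let ?D = "{1..n} \<times> {..<K}"
  let ?E = "\<lambda>m. {\<omega>\<in>space M. \<forall>i\<in>{1..n}. \<forall>k<K. request_count X i (\<tau> k) (\<tau> (Suc k)) \<omega> = m (i, k)}"
  let ?S = "{\<omega>\<in>space M. \<forall>i\<in>{1..n}. \<forall>k<K. request_count X i (\<tau> k) (\<tau> (Suc k)) \<omega> \<in> B i k}"
  define Q where "Q \<omega> = Pi_pmf ?D 0 (\<lambda>(i, k). poisson_or_zero (p i \<omega> * (\<tau> (Suc k) - \<tau> k)))" for \<omega>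
  define C where "C = PiE_dflt ?D (0::nat) (\<lambda>(i, k). B i k)"
  \<comment> \<open>a Poisson law with rate 1 gives positive mass to every count, so its product has full support\<close>
  have "C \<subseteq> set_pmf (Pi_pmf ?D 0 (\<lambda>_. poisson_pmf 1))"
    by (subst set_Pi_pmf) (auto simp: C_def PiE_dflt_def set_pmf_poisson)
  then have countable: "countable C" using countable_set_pmf countable_subset by blast
  have pmf_Q: "pmf (Q \<omega>) m =
      (\<Prod>i = 1..n. \<Prod>k<K. pmf (poisson_or_zero (p i \<omega> * (\<tau> (Suc k) - \<tau> k))) (m (i, k)))"
    if "m \<in> C" for m \<omega>
  proof -
    have "m x = 0" if "x \<notin> ?D" for x
      using that \<open>m \<in> C\<close> unfolding C_def PiE_dflt_def by blast
    then show ?thesis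
      unfolding Q_def by (subst pmf_Pi') (simp_all add: prod.cartesian_product case_prod_beta)
  qed
  have E: "?E m \<in> sets M" for m
    using counts_event[of K \<tau> "\<lambda>i k. {m (i, k)}"] by simp
  have S: "?S \<in> sets M" by (rule counts_event)
  have "?S = (\<Union>m\<in>C. ?E m)"
  proof (intro equalityI subsetI)
    fix \<omega> assume \<omega>: "\<omega> \<in> ?S"
    let ?m = "\<lambda>(i, k). if (i, k) \<in> ?D then request_count X i (\<tau> k) (\<tau> (Suc k)) \<omega> else 0"
    have "?m \<in> C" "\<omega> \<in> ?E ?m" using \<omega> by (auto simp: C_def PiE_dflt_def)
    then show "\<omega> \<in> (\<Union>m\<in>C. ?E m)" by blast
  qed (auto simp: C_def PiE_dflt_def)
  moreover have "disjoint_family_on ?E C"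
    unfolding disjoint_family_on_def
  proof (intro ballI impI)
    fix m m' assume m: "m \<in> C" "m' \<in> C" "m \<noteq> m'"
    then obtain i k where "m (i, k) \<noteq> m' (i, k)" by (auto simp: fun_eq_iff)
    moreover have "m (i, k) = 0 \<and> m' (i, k) = 0" if "(i, k) \<notin> ?D"
      using that m unfolding C_def PiE_dflt_def by blast
    ultimately have "m (i, k) \<noteq> m' (i, k)" "(i, k) \<in> ?D" by metis+
    then show "?E m \<inter> ?E m' = {}" by auto
  qed
  ultimately have "emeasure M ?S = (\<integral>\<^sup>+m. emeasure M (?E m) \<partial>count_space C)"
    using E countable by (simp add: emeasure_UN_countable)
  also have "\<dots> = (\<integral>\<^sup>+m. \<integral>\<^sup>+\<omega>. ennreal (pmf (Q \<omega>) m) \<partial>M \<partial>count_space C)"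
  proof (intro nn_integral_cong)
    fix m assume "m \<in> space (count_space C)"
    then show "emeasure M (?E m) = (\<integral>\<^sup>+\<omega>. ennreal (pmf (Q \<omega>) m) \<partial>M)"
      using prob_counts_eq(2)[OF \<tau>, of K "\<lambda>i k. m (i, k)"] by (simp add: pmf_Q)
  qed
  also have "\<dots> = (\<integral>\<^sup>+\<omega>. \<integral>\<^sup>+m. ennreal (pmf (Q \<omega>) m) \<partial>count_space C \<partial>M)"
    using prob_counts_eq(1)[OF \<tau>]
    by (intro nn_integral_count_space_nn_integral[symmetric] countable) (simp add: pmf_Q)
  also have "\<dots> = (\<integral>\<^sup>+\<omega>. ennreal (q \<omega>) \<partial>M)"
  proof (intro nn_integral_cong)
    fix \<omega>
    have "measure (Q \<omega>) C = q \<omega>"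
      unfolding Q_def C_def q_def
      by (subst measure_Pi_pmf_PiE_dflt) (auto simp: prod.cartesian_product intro!: prod.cong)
    then show "(\<integral>\<^sup>+m. ennreal (pmf (Q \<omega>) m) \<partial>count_space C) = ennreal (q \<omega>)"
      by (simp add: nn_integral_pmf measure_pmf.emeasure_eq_measure)
  qed
  finally have em: "emeasure M ?S = (\<integral>\<^sup>+\<omega>. ennreal (q \<omega>) \<partial>M)" .
  have q_meas: "q \<in> borel_measurable M"
    unfolding q_def
    by (intro borel_measurable_prod measurable_compose[OF _ measurable_prob_poisson_or_zero]
        borel_measurable_times rate_measurable borel_measurable_const)
  have q01: "0 \<le> q \<omega>" "q \<omega> \<le> 1" for \<omega>
    unfolding q_def by (auto intro!: prod_nonneg prod_le_1)
  then show q_int: "integrable M q"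
    using q_meas by (intro integrable_const_bound[where B = 1]) auto
  show "prob ?S = (\<integral>\<omega>. q \<omega> \<partial>M)"
    using em q_int q01 by (simp add: emeasure_eq_measure nn_integral_eq_integral integral_nonneg)
qed

end

section \<open>Simultaneous requests\<close>

lemma random_subset_prob_alt:
  assumes "finite I" "R \<subseteq> I"
  shows "random_subset_prob I r R = (\<Prod>j\<in>I. if j \<in> R then r j else 1 - r j)"
proof -
  have "I \<inter> {j. j \<in> R} = R" "I \<inter> - {j. j \<in> R} = I - R" using assms(2) by auto
  then show ?thesis unfolding random_subset_prob_def using assms(1) by (simp add: prod.If_cases)
qed

lemma one_minus_exp_bounds:
  fixes x :: real
  shows "x * exp (- x) \<le> 1 - exp (- x)" "1 - exp (- x) \<le> x"
proof -
  have "(1 + x) * exp (- x) \<le> exp x * exp (- x)"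
    by (intro mult_right_mono exp_ge_add_one_self) auto
  then show "x * exp (- x) \<le> 1 - exp (- x)" by (simp add: exp_minus algebra_simps)
  show "1 - exp (- x) \<le> x" using exp_ge_add_one_self[of "- x"] by linarith
qed

context mtf_model
begin

lemma requests_finite: "i \<in> {1..n} \<Longrightarrow> \<omega> \<in> space M \<Longrightarrow> finite (requests X i \<omega> \<inter> {..b})"
  using chain unfolding mtf_chain_def conditionally_poisson_def by blast

lemma requests_nonneg: "i \<in> {1..n} \<Longrightarrow> \<omega> \<in> space M \<Longrightarrow> s \<in> requests X i \<omega> \<Longrightarrow> 0 \<le> s"
  using chain unfolding mtf_chain_def conditionally_poisson_def by (meson atLeast_iff subsetD)

lemma requested_in_iff:
  assumes "i \<in> {1..n}" "\<omega> \<in> space M"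
  shows "i \<in> requested_in n X b c \<omega> \<longleftrightarrow> 0 < request_count X i b c \<omega>"
proof -
  have "finite (requests X i \<omega> \<inter> {b..<c})"
    by (rule finite_subset[OF _ requests_finite[OF assms, of c]]) auto
  then show ?thesis
    using assms(1) by (simp add: requested_in_def request_count_def card_gt_0_iff)
qed

lemma requested_in_subset: "requested_in n X b c \<omega> \<subseteq> {1..n}"
  by (auto simp: requested_in_def)

lemma requested_in_mono: "b' \<le> b \<Longrightarrow> c \<le> c' \<Longrightarrow> requested_in n X b c \<omega> \<subseteq> requested_in n X b' c' \<omega>"
  unfolding requested_in_def by fastforce

lemma rate_le_1: "i \<in> {1..n} \<Longrightarrow> \<omega> \<in> space M \<Longrightarrow> p i \<omega> \<le> 1"
  using member_le_sum[of i "{1..n}" "\<lambda>i. p i \<omega>"] sum_rate_le_1[of \<omega>] rate_nonneg[of _ \<omega>] by force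

definition hit_prob :: "real \<Rightarrow> 'a \<Rightarrow> nat \<Rightarrow> real" where
  "hit_prob a \<omega> j = 1 - exp (- (p j \<omega> * a))"

lemma hit_prob_01: "0 \<le> a \<Longrightarrow> j \<in> {1..n} \<Longrightarrow> \<omega> \<in> space M \<Longrightarrow> 0 \<le> hit_prob a \<omega> j \<and> hit_prob a \<omega> j \<le> 1"
  unfolding hit_prob_def using rate_nonneg[of j \<omega>] by simp

lemma hit_prob_measurable: "j \<in> {1..n} \<Longrightarrow> (\<lambda>\<omega>. hit_prob a \<omega> j) \<in> borel_measurable M"
  unfolding hit_prob_def
  by (intro borel_measurable_diff borel_measurable_const borel_measurable_exp[THEN measurable_compose[rotated]]
      borel_measurable_uminus borel_measurable_times rate_measurable)


lemma prob_both_requested: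
  assumes "0 \<le> b" "b \<le> c" "i \<in> {1..n}" "j \<in> {1..n}" "i \<noteq> j"
  shows "{\<omega>\<in>space M. i \<in> requested_in n X b c \<omega> \<and> j \<in> requested_in n X b c \<omega>} \<in> sets M"
    and "prob {\<omega>\<in>space M. i \<in> requested_in n X b c \<omega> \<and> j \<in> requested_in n X b c \<omega>} \<le> (c - b)\<^sup>2"
proof -
  let ?\<tau> = "\<lambda>k::nat. if k = 0 then b else c"
  let ?B = "\<lambda>l (k::nat). if l = i \<or> l = j then {0<..} else (UNIV :: nat set)"
  let ?S = "{\<omega>\<in>space M. i \<in> requested_in n X b c \<omega> \<and> j \<in> requested_in n X b c \<omega>}"
  have S: "?S = {\<omega>\<in>space M. \<forall>l\<in>{1..n}. \<forall>k<1. request_count X l (?\<tau> k) (?\<tau> (Suc k)) \<omega> \<in> ?B l k}"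
    using assms by (auto simp: requested_in_iff)
  show "?S \<in> sets M" unfolding S by (rule counts_event)
  let ?q = "\<lambda>\<omega>. \<Prod>l = 1..n. \<Prod>k<1.
      measure_pmf.prob (poisson_or_zero (p l \<omega> * (?\<tau> (Suc k) - ?\<tau> k))) (?B l k)"
  have int: "integrable M ?q" by (rule prob_counts_mem(2)) (use assms(1,2) in auto)
  have "prob ?S = (\<integral>\<omega>. ?q \<omega> \<partial>M)"
    unfolding S by (rule prob_counts_mem(1)) (use assms(1,2) in auto)
  also have "(\<integral>\<omega>. ?q \<omega> \<partial>M) \<le> (\<integral>\<omega>. (c - b)\<^sup>2 \<partial>M)"
  proof (intro integral_mono int)
    fix \<omega> assume \<omega>: "\<omega> \<in> space M"
    have "?q \<omega> = (\<Prod>l\<in>{i, j}. measure_pmf.prob (poisson_or_zero (p l \<omega> * (c - b))) {0<..})"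
      using assms(3,4) by (simp, intro prod.mono_neutral_cong_right) auto
    also have "\<dots> \<le> (\<Prod>l\<in>{i, j}. c - b)"
    proof (intro prod_mono conjI)
      fix l assume "l \<in> {i, j}"
      then have l: "l \<in> {1..n}" using assms by auto
      have "measure_pmf.prob (poisson_or_zero (p l \<omega> * (c - b))) {0<..} \<le> p l \<omega> * (c - b)"
        using one_minus_exp_bounds(2) rate_nonneg[OF l \<omega>] assms(2)
        by (subst prob_poisson_or_zero_some) auto
      also have "\<dots> \<le> c - b"
        using rate_nonneg[OF l \<omega>] rate_le_1[OF l \<omega>] assms(2) by (simp add: mult_left_le_one_le)
      finally show "measure_pmf.prob (poisson_or_zero (p l \<omega> * (c - b))) {0<..} \<le> c - b" .
    qed simp
    finally show "?q \<omega> \<le> (c - b)\<^sup>2" using assms(5) by (simp add: power2_eq_square)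
  qed simp
  finally show "prob ?S \<le> (c - b)\<^sup>2" by (simp add: prob_space)
qed

text \<open>Cut \<open>[0, T)\<close> into \<open>N\<close> windows. Two given objects are both requested in a given window with
  probability at most \<open>(T / N)\<^sup>2\<close>, so by the union bound two requests share some window with
  probability of order \<open>1 / N\<close>.\<close>

lemma AE_no_simultaneous_requests: "AE \<omega> in M. no_simultaneous_requests n X T \<omega>"
proof (cases "T > 0")
  case False
  show ?thesis
    using AE_space
  proof eventually_elim
    fix \<omega> assume "\<omega> \<in> space M"
    then show "no_simultaneous_requests n X T \<omega>"
      using requests_nonneg[of _ \<omega>] False unfolding no_simultaneous_requests_def by fastforce
  qed
next
  case True
  let ?P = "{(i, j). i \<in> {1..n} \<and> j \<in> {1..n} \<and> i \<noteq> j}"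
  define S where "S N = (\<lambda>((i, j), m). {\<omega>\<in>space M.
      i \<in> requested_in n X (real m * T / real N) ((real m + 1) * T / real N) \<omega> \<and>
      j \<in> requested_in n X (real m * T / real N) ((real m + 1) * T / real N) \<omega>})" for N :: nat
  define bad where "bad N = (\<Union>x\<in>?P \<times> {..<N}. S N x)" for N
  have finP: "finite ?P" by (rule finite_subset[of _ "{1..n} \<times> {1..n}"]) auto
  have S: "S N x \<in> sets M" "prob (S N x) \<le> (T / N)\<^sup>2" if x: "x \<in> ?P \<times> {..<N}" for N x
  proof -
    obtain i j m where x_eq: "x = ((i, j), m)" by (metis surj_pair)
    let ?b = "real m * T / real N" and ?c = "(real m + 1) * T / real N"
    have *: "0 \<le> ?b" "?b \<le> ?c" "?c - ?b = T / N" "i \<in> {1..n}" "j \<in> {1..n}" "i \<noteq> j"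
      using True x by (auto simp: x_eq field_simps divide_right_mono)
    show "S N x \<in> sets M" "prob (S N x) \<le> (T / N)\<^sup>2"
      using prob_both_requested[OF *(1,2,4,5,6)] unfolding *(3) by (simp_all add: S_def x_eq)
  qed
  have bad: "bad N \<in> sets M" for N
    unfolding bad_def using finP S(1) by (intro sets.finite_UN) auto
  have prob_bad: "prob (bad N) \<le> card ?P * T\<^sup>2 / N" if "N > 0" for N
  proof -
    have "prob (bad N) \<le> (\<Sum>x\<in>?P \<times> {..<N}. prob (S N x))"
      unfolding bad_def using finP S(1) by (intro finite_measure_subadditive_finite) auto
    also have "\<dots> \<le> (\<Sum>x\<in>?P \<times> {..<N}. (T / N)\<^sup>2)"
      by (intro sum_mono S(2))
    also have "\<dots> = card ?P * T\<^sup>2 / N"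
      using that by (simp add: card_cartesian_product power2_eq_square)
    finally show ?thesis .
  qed
  have sub: "\<omega> \<in> bad N" if \<omega>: "\<omega> \<in> space M" "\<not> no_simultaneous_requests n X T \<omega>" and N: "N > 0" for \<omega> N
  proof -
    obtain i j s where ij: "i \<in> {1..n}" "j \<in> {1..n}" "i \<noteq> j"
      and s: "s \<in> requests X i \<omega>" "s \<in> requests X j \<omega>" "s < T"
      using \<omega>(2) unfolding no_simultaneous_requests_def by blast
    have "0 \<le> s" using requests_nonneg ij(1) \<omega>(1) s(1) by blast
    define m where "m = nat \<lfloor>s * N / T\<rfloor>"
    have m: "real m \<le> s * N / T" "s * N / T < real m + 1"
      unfolding m_def using \<open>0 \<le> s\<close> True by (auto simp: of_nat_nat)
    then have "s \<in> {real m * T / real N..<(real m + 1) * T / real N}"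
      using True N by (auto simp: field_simps)
    moreover have "real m < N"
    proof -
      have "s * N / T < N" using s(3) True N by (simp add: field_simps)
      then show ?thesis using m(1) by linarith
    qed
    ultimately have "\<omega> \<in> S N ((i, j), m)" "((i, j), m) \<in> ?P \<times> {..<N}"
      using ij s \<omega>(1) unfolding S_def requested_in_def by auto
    then show ?thesis unfolding bad_def by blast
  qed
  let ?bad = "\<Inter>N\<in>{1..}. bad N"
  have bad_sets: "?bad \<in> sets M"
    using bad by (intro sets.countable_INT') auto
  have "prob ?bad \<le> card ?P * T\<^sup>2 / real N" if "N > 0" for N
    using finite_measure_mono[OF _ bad[of N], of ?bad] prob_bad[OF that] that by force
  moreover have "(\<lambda>N. card ?P * T\<^sup>2 / real N) \<longlonglongrightarrow> 0"
    by (rule lim_const_over_n)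
  ultimately have "prob ?bad \<le> 0"
    by (intro LIMSEQ_le_const[of _ 0]) (auto intro!: exI[of _ 1])
  then have "emeasure M ?bad = 0"
    by (simp add: emeasure_eq_measure measure_le_0_iff)
  then show ?thesis
    using sub by (intro AE_I[OF _ _ bad_sets]) auto
qed

end

section \<open>The joint law of the recent requests and the next one\<close>

context mtf_model
begin

text \<open>The time after \<open>T\<close> is cut into cells of length \<open>\<delta>\<close>. The event says that the set of objects requested
  in \<open>[b, T)\<close> is \<open>fst Ri\<close> and that the first cell with a request is the \<open>k\<close>-th one, where only the
  object \<open>snd Ri\<close> is requested. It depends on the counts in three intervals only.\<close>

definition request_event :: "real \<Rightarrow> real \<Rightarrow> real \<Rightarrow> nat set \<times> nat \<Rightarrow> nat \<Rightarrow> 'a set" where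
  "request_event b T \<delta> Ri k = {\<omega>\<in>space M. requested_in n X b T \<omega> = fst Ri \<and>
     requested_in n X T (T + k * \<delta>) \<omega> = {} \<and>
     requested_in n X (T + k * \<delta>) (T + (real k + 1) * \<delta>) \<omega> = {snd Ri}}"

text \<open>The exact probability is a product over the objects. It is simplified by \<open>x e\<^sup>-\<^sup>x \<le> 1 - e\<^sup>-\<^sup>x\<close> for the
  object requested in the \<open>k\<close>-th cell, and by the fact that the rates add up to at most 1.\<close>

lemma prob_request_event:
  assumes b: "0 \<le> b" "b \<le> T" and \<delta>: "0 \<le> \<delta>" and R: "R \<subseteq> {1..n}" and i: "i \<in> {1..n}"
  shows "request_event b T \<delta> (R, i) k \<in> sets M"
    and "(\<integral>\<omega>. \<delta> * exp (- (real k + 1) * \<delta>) *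
            (random_subset_prob {1..n} (hit_prob (T - b) \<omega>) R * p i \<omega>) \<partial>M)
         \<le> prob (request_event b T \<delta> (R, i) k)"
proof -
  let ?E = "request_event b T \<delta> (R, i) k"
  let ?\<tau> = "\<lambda>m::nat. if m = 0 then b else if m = 1 then T
      else if m = 2 then T + k * \<delta> else T + (real k + 1) * \<delta>"
  let ?B = "\<lambda>j m::nat. if m = 0 then (if j \<in> R then {0<..} else {0})
      else if m = 1 then {0} else (if j = i then {0<..} else {0::nat})"
  have E: "?E = {\<omega>\<in>space M. \<forall>j\<in>{1..n}. \<forall>m<3. request_count X j (?\<tau> m) (?\<tau> (Suc m)) \<omega> \<in> ?B j m}"
    unfolding request_event_def
  proof (intro Collect_cong conj_cong refl)
    fix \<omega> assume \<omega>: "\<omega> \<in> space M"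
    have eq: "requested_in n X c d \<omega> = A \<longleftrightarrow>
        (\<forall>j\<in>{1..n}. request_count X j c d \<omega> \<in> (if j \<in> A then {0<..} else {0}))"
      if "A \<subseteq> {1..n}" for A c d
    proof -
      have "requested_in n X c d \<omega> = A \<longleftrightarrow> (\<forall>j\<in>{1..n}. j \<in> requested_in n X c d \<omega> \<longleftrightarrow> j \<in> A)"
        using that requested_in_subset[of c d \<omega>] by blast
      also have "\<dots> \<longleftrightarrow> (\<forall>j\<in>{1..n}. request_count X j c d \<omega> \<in> (if j \<in> A then {0<..} else {0}))"
        by (intro ball_cong refl) (auto simp only: requested_in_iff[OF _ \<omega>] split: if_splits)
      finally show ?thesis .
    qed
    have all3: "(\<forall>m<3. Q m) \<longleftrightarrow> Q 0 \<and> Q 1 \<and> Q 2" for Q :: "nat \<Rightarrow> bool"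
      by (auto simp: numeral_3_eq_3 numeral_2_eq_2 All_less_Suc)
    show "(requested_in n X b T \<omega> = fst (R, i) \<and> requested_in n X T (T + k * \<delta>) \<omega> = {} \<and>
       requested_in n X (T + k * \<delta>) (T + (real k + 1) * \<delta>) \<omega> = {snd (R, i)}) \<longleftrightarrow>
       (\<forall>j\<in>{1..n}. \<forall>m<3. request_count X j (?\<tau> m) (?\<tau> (Suc m)) \<omega> \<in> ?B j m)"
      using i R by (simp add: eq all3 ball_conj_distrib)
  qed
  show "?E \<in> sets M" unfolding E by (rule counts_event)
  have \<tau>: "0 \<le> ?\<tau> 0" "\<And>m. m < 3 \<Longrightarrow> ?\<tau> m \<le> ?\<tau> (Suc m)"
    using b \<delta> by (auto simp: algebra_simps)
  let ?q = "\<lambda>\<omega>. \<Prod>j = 1..n. \<Prod>m<3.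
      measure_pmf.prob (poisson_or_zero (p j \<omega> * (?\<tau> (Suc m) - ?\<tau> m))) (?B j m)"
  let ?g = "\<lambda>\<omega>. \<delta> * exp (- (real k + 1) * \<delta>) *
            (random_subset_prob {1..n} (hit_prob (T - b) \<omega>) R * p i \<omega>)"
  have int: "integrable M ?q" by (rule prob_counts_mem(2)) (use \<tau> in auto)
  have bern: "0 \<le> random_subset_prob {1..n} (hit_prob (T - b) \<omega>) R" if "\<omega> \<in> space M" for \<omega>
    using that b R by (intro random_subset_prob_nonneg hit_prob_01) auto
  have le: "?g \<omega> \<le> ?q \<omega>" if \<omega>: "\<omega> \<in> space M" for \<omega>
  proof -
    note nn = rate_nonneg[OF _ \<omega>]
    let ?P = "\<lambda>j \<delta>. measure_pmf.prob (poisson_or_zero (p j \<omega> * \<delta>))"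
    have "?q \<omega> = (\<Prod>j = 1..n. ?P j (T - b) (if j \<in> R then {0<..} else {0})) *
        (\<Prod>j = 1..n. ?P j (k * \<delta>) {0}) * (\<Prod>j = 1..n. ?P j \<delta> (if j = i then {0<..} else {0}))"
      by (simp add: numeral_3_eq_3 numeral_2_eq_2 prod.distrib algebra_simps)
    also have "(\<Prod>j = 1..n. ?P j (T - b) (if j \<in> R then {0<..} else {0})) =
        random_subset_prob {1..n} (hit_prob (T - b) \<omega>) R"
      using R b nn by (subst random_subset_prob_alt)
        (auto intro!: prod.cong simp: hit_prob_def prob_poisson_or_zero_none prob_poisson_or_zero_some)
    also have "(\<Prod>j = 1..n. ?P j (k * \<delta>) {0}) = exp (- (\<Sum>j = 1..n. p j \<omega>) * (k * \<delta>))"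
      using \<delta> nn by (simp add: prob_poisson_or_zero_none exp_sum sum_distrib_right flip: sum_negf)
    also have "(\<Prod>j = 1..n. ?P j \<delta> (if j = i then {0<..} else {0})) =
        (1 - exp (- (p i \<omega> * \<delta>))) * exp (- (\<Sum>j\<in>{1..n} - {i}. p j \<omega>) * \<delta>)"
      using \<delta> nn i by (simp add: prod.remove[of _ i] prob_poisson_or_zero_none
          prob_poisson_or_zero_some exp_sum sum_distrib_right flip: sum_negf)
    finally have q: "?q \<omega> = random_subset_prob {1..n} (hit_prob (T - b) \<omega>) R *
        exp (- (\<Sum>j = 1..n. p j \<omega>) * (k * \<delta>)) *
        ((1 - exp (- (p i \<omega> * \<delta>))) * exp (- (\<Sum>j\<in>{1..n} - {i}. p j \<omega>) * \<delta>))" .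
    have sum: "(\<Sum>j = 1..n. p j \<omega>) = p i \<omega> + (\<Sum>j\<in>{1..n} - {i}. p j \<omega>)"
      using i by (simp add: sum.remove)
    have "(\<Sum>j = 1..n. p j \<omega>) * (k * \<delta>) \<le> 1 * (k * \<delta>)"
      using sum_rate_le_1[OF \<omega>] \<delta> by (intro mult_right_mono) auto
    then have 1: "exp (- (k * \<delta>)) \<le> exp (- (\<Sum>j = 1..n. p j \<omega>) * (k * \<delta>))" by simp
    have "(\<Sum>j = 1..n. p j \<omega>) * \<delta> \<le> 1 * \<delta>"
      using sum_rate_le_1[OF \<omega>] \<delta> by (intro mult_right_mono) auto
    then have "exp (- \<delta>) \<le> exp (- (p i \<omega> * \<delta>)) * exp (- (\<Sum>j\<in>{1..n} - {i}. p j \<omega>) * \<delta>)"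
      unfolding mult_exp_exp sum by (simp add: algebra_simps)
    then have "(p i \<omega> * \<delta>) * exp (- \<delta>) \<le>
        (p i \<omega> * \<delta>) * (exp (- (p i \<omega> * \<delta>)) * exp (- (\<Sum>j\<in>{1..n} - {i}. p j \<omega>) * \<delta>))"
      using nn[OF i] \<delta> by (intro mult_left_mono) auto
    also have "\<dots> \<le> (1 - exp (- (p i \<omega> * \<delta>))) * exp (- (\<Sum>j\<in>{1..n} - {i}. p j \<omega>) * \<delta>)"
      using one_minus_exp_bounds(1)[of "p i \<omega> * \<delta>"]
      unfolding mult.assoc[symmetric] by (intro mult_right_mono) auto
    finally have 2: "(p i \<omega> * \<delta>) * exp (- \<delta>) \<le> \<dots>" .
    have "?g \<omega> = random_subset_prob {1..n} (hit_prob (T - b) \<omega>) R *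
        exp (- (k * \<delta>)) * ((p i \<omega> * \<delta>) * exp (- \<delta>))"
      by (simp add: algebra_simps exp_add[symmetric] flip: exp_minus)
    also have "\<dots> \<le> ?q \<omega>"
      unfolding q
      by (intro mult_mono[OF mult_left_mono[OF 1 bern[OF \<omega>]] 2])
         (use bern[OF \<omega>] nn[OF i] \<delta> in auto)
    finally show ?thesis .
  qed
  have "(\<integral>\<omega>. ?g \<omega> \<partial>M) \<le> (\<integral>\<omega>. ?q \<omega> \<partial>M)"
    using int le by (intro integral_mono_AE' AE_I2) (auto intro!: prod_nonneg)
  also have "\<dots> = prob ?E"
    unfolding E by (rule prob_counts_mem(1)[symmetric]) (use \<tau> in auto)
  finally show "(\<integral>\<omega>. ?g \<omega> \<partial>M) \<le> prob ?E" .
qed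

lemma request_event_disjoint:
  assumes "0 \<le> \<delta>" "\<omega> \<in> request_event b T \<delta> Ri k" "\<omega> \<in> request_event b T \<delta> Ri' k'"
  shows "Ri = Ri' \<and> k = k'"
proof -
  have *: False if "k < k'" "\<omega> \<in> request_event b T \<delta> Ri k" "\<omega> \<in> request_event b T \<delta> Ri' k'"
    for Ri Ri' and k k' :: nat
  proof -
    have "real k + 1 \<le> real k'" using that(1) by linarith
    then have "T + (real k + 1) * \<delta> \<le> T + k' * \<delta>" "T \<le> T + k * \<delta>"
      using assms(1) by (auto intro: mult_right_mono)
    then have "requested_in n X (T + k * \<delta>) (T + (real k + 1) * \<delta>) \<omega> \<subseteq> requested_in n X T (T + k' * \<delta>) \<omega>"
      by (intro requested_in_mono)
    then show False using that(2,3) unfolding request_event_def by auto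
  qed
  have "k = k'" using *[of k k' Ri Ri'] *[of k' k Ri' Ri] assms(2,3) by (meson linorder_neqE_nat)
  then show ?thesis using assms(2,3) unfolding request_event_def by (auto simp: prod_eq_iff)
qed

lemma request_event_first_requested:
  assumes "0 \<le> \<delta>" "\<omega> \<in> request_event b T \<delta> (R, i) k"
  shows "\<omega> \<in> space M" "requested_in n X b T \<omega> = R" "first_requested n X T \<omega> = i"
proof -
  show "\<omega> \<in> space M" "requested_in n X b T \<omega> = R"
    using assms(2) by (auto simp: request_event_def)
  show "first_requested n X T \<omega> = i"
  proof (rule first_requested_eqI)
    show "requested_in n X T (T + k * \<delta>) \<omega> = {}"
      "requested_in n X (T + k * \<delta>) (T + (real k + 1) * \<delta>) \<omega> = {i}"
      using assms(2) by (auto simp: request_event_def)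
    then show "i \<in> {1..n}" using requested_in_subset by blast
  qed (use assms requests_finite \<open>\<omega> \<in> space M\<close> in auto)
qed

definition zero_weights_event :: "'a set" where
  "zero_weights_event = {\<omega>\<in>space M. \<forall>j\<in>{1..n}. weight X j \<omega> = 0}"

lemma zero_weights_event [measurable]: "zero_weights_event \<in> sets M"
  unfolding zero_weights_event_def
  by (intro sets.sets_Collect_finite_All) (auto intro!: borel_measurable_eq weight_measurable)

abbreviation "hit_set_prob a \<omega> \<equiv> random_subset_prob {1..n} (hit_prob a \<omega>)"

text \<open>Given the weights, the probability that the set of objects requested during a time \<open>a\<close> is \<open>fst Ri\<close>
  and that the next requested object is \<open>snd Ri\<close>.\<close>

definition joint_prob :: "real \<Rightarrow> 'a \<Rightarrow> nat set \<times> nat \<Rightarrow> real" where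
  "joint_prob a \<omega> Ri = hit_set_prob a \<omega> (fst Ri) * p (snd Ri) \<omega>"

lemma random_subset_prob_hit_le_1:
  assumes "0 \<le> a" "\<omega> \<in> space M" "R \<subseteq> {1..n}"
  shows "0 \<le> hit_set_prob a \<omega> R" "hit_set_prob a \<omega> R \<le> 1"
proof -
  have nonneg: "0 \<le> hit_set_prob a \<omega> R'" if "R' \<in> Pow {1..n}" for R'
    using that assms(1,2) by (intro random_subset_prob_nonneg hit_prob_01) auto
  then show "0 \<le> hit_set_prob a \<omega> R" using assms(3) by auto
  show "hit_set_prob a \<omega> R \<le> 1"
    using member_le_sum[of R "Pow {1..n}" "hit_set_prob a \<omega>"] nonneg
      sum_random_subset_prob[of "{1..n}" "hit_prob a \<omega>"] assms(3) by auto
qed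

lemma random_subset_prob_hit_measurable:
  assumes "R \<subseteq> {1..n}"
  shows "(\<lambda>\<omega>. hit_set_prob a \<omega> R) \<in> borel_measurable M"
  unfolding random_subset_prob_def using assms
  by (intro borel_measurable_times borel_measurable_prod borel_measurable_diff borel_measurable_const
      hit_prob_measurable) auto

lemma joint_prob_nonneg:
  "0 \<le> a \<Longrightarrow> \<omega> \<in> space M \<Longrightarrow> Ri \<in> Pow {1..n} \<times> {1..n} \<Longrightarrow> 0 \<le> joint_prob a \<omega> Ri"
  unfolding joint_prob_def
  by (intro mult_nonneg_nonneg random_subset_prob_hit_le_1 rate_nonneg) auto

lemma joint_prob_integrable:
  assumes "0 \<le> a" "Ri \<in> Pow {1..n} \<times> {1..n}"
  shows "integrable M (\<lambda>\<omega>. joint_prob a \<omega> Ri)"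
proof (rule integrable_const_bound[where B = 1])
  show "AE \<omega> in M. norm (joint_prob a \<omega> Ri) \<le> 1"
    using AE_space
  proof eventually_elim
    fix \<omega> assume \<omega>: "\<omega> \<in> space M"
    have "joint_prob a \<omega> Ri \<le> 1"
      unfolding joint_prob_def using assms \<omega>
      by (intro mult_le_one random_subset_prob_hit_le_1 rate_le_1 rate_nonneg) auto
    then show "norm (joint_prob a \<omega> Ri) \<le> 1" using joint_prob_nonneg[OF assms(1) \<omega> assms(2)] by simp
  qed
  show "(\<lambda>\<omega>. joint_prob a \<omega> Ri) \<in> borel_measurable M"
    unfolding joint_prob_def using assms(2)
    by (intro borel_measurable_times random_subset_prob_hit_measurable rate_measurable) auto
qed

text \<open>Adding up \<open>prob_request_event\<close> over the first \<open>N\<close> cells gives the claim with the factor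
  \<open>\<Sum>k<N. \<delta> e\<^bsup>-(k+1)\<delta>\<^esup>\<close>, which tends to 1 if \<open>\<delta>\<close> tends to 0 and \<open>N \<delta>\<close> to infinity. The event of
  vanishing weights is set apart since the search cost is 0 there by convention. A lower bound is
  enough: the masses of all pairs add up to 1, so applying it to the complement of \<open>G\<close> yields the
  upper bound \<open>prob_le_pair_mass\<close>.\<close>

lemma joint_law_lower_bound:
  assumes a: "0 \<le> a" "a \<le> T" and G: "G \<subseteq> Pow {1..n} \<times> {1..n}" and V: "V \<in> sets M"
    and GV: "\<And>\<omega>. \<omega> \<in> space M \<Longrightarrow> \<omega> \<notin> zero_weights_event \<Longrightarrow> no_simultaneous_requests n X T \<omega> \<Longrightarrow>
       (requested_in n X (T - a) T \<omega>, first_requested n X T \<omega>) \<in> G \<Longrightarrow> \<omega> \<in> V"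
  shows "(\<integral>\<omega>. (\<Sum>Ri\<in>G. joint_prob a \<omega> Ri) \<partial>M) \<le> prob V + prob zero_weights_event"
proof -
  have finG: "finite G" by (rule finite_subset[OF G]) auto
  let ?A = "\<Sum>Ri\<in>G. \<integral>\<omega>. joint_prob a \<omega> Ri \<partial>M"
  have A: "0 \<le> ?A"
    using G a by (intro sum_nonneg integral_nonneg_AE AE_I2 joint_prob_nonneg) auto
  have bound: "?A * (\<Sum>k<N. \<delta> * exp (- (real k + 1) * \<delta>)) \<le> prob V + prob zero_weights_event"
    if \<delta>: "0 < \<delta>" for \<delta> N
  proof -
    let ?E = "\<lambda>(Ri, k). request_event (T - a) T \<delta> Ri k"
    have E: "?E x \<in> sets M" if "x \<in> G \<times> {..<N}" for x
      using prob_request_event(1)[of "T - a" T \<delta>] that G a \<delta> by auto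
    have "?A * (\<Sum>k<N. \<delta> * exp (- (real k + 1) * \<delta>)) =
        (\<Sum>(Ri, k)\<in>G \<times> {..<N}. \<integral>\<omega>. \<delta> * exp (- (real k + 1) * \<delta>) * joint_prob a \<omega> Ri \<partial>M)"
      by (simp add: sum_product sum.cartesian_product mult_ac)
    also have "\<dots> \<le> (\<Sum>x\<in>G \<times> {..<N}. prob (?E x))"
    proof (intro sum_mono)
      fix x assume "x \<in> G \<times> {..<N}"
      moreover obtain R i k where x: "x = ((R, i), k)" by (metis surj_pair)
      ultimately have "(\<integral>\<omega>. \<delta> * exp (- (real k + 1) * \<delta>) * joint_prob a \<omega> (R, i) \<partial>M)
          \<le> prob (request_event (T - a) T \<delta> (R, i) k)"
        using prob_request_event(2)[of "T - a" T \<delta> R i k] G a \<delta> by (auto simp: joint_prob_def)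
      then show "(case x of (Ri, k) \<Rightarrow>
          \<integral>\<omega>. \<delta> * exp (- (real k + 1) * \<delta>) * joint_prob a \<omega> Ri \<partial>M) \<le> prob (?E x)"
        by (simp add: x)
    qed
    also have "\<dots> = prob (\<Union>x\<in>G \<times> {..<N}. ?E x)"
    proof (intro finite_measure_finite_Union[symmetric])
      show "disjoint_family_on ?E (G \<times> {..<N})"
        unfolding disjoint_family_on_def
      proof (intro ballI impI equals0I)
        fix x y \<omega> assume "x \<noteq> y" "\<omega> \<in> ?E x \<inter> ?E y"
        then show False
          using request_event_disjoint[of \<delta> \<omega> "T - a" T "fst x" "snd x" "fst y" "snd y"] \<delta>
          by (simp add: case_prod_beta prod_eq_iff)
      qed
    qed (use E finG in auto)
    also have "\<dots> \<le> prob (V \<union> zero_weights_event)"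
    proof (rule finite_measure_mono_AE)
      show "AE \<omega> in M. \<omega> \<in> (\<Union>x\<in>G \<times> {..<N}. ?E x) \<longrightarrow> \<omega> \<in> V \<union> zero_weights_event"
        using AE_no_simultaneous_requests[of T]
      proof (eventually_elim, intro impI)
        fix \<omega> assume ns: "no_simultaneous_requests n X T \<omega>"
          and "\<omega> \<in> (\<Union>x\<in>G \<times> {..<N}. ?E x)"
        then obtain R i k where "(R, i) \<in> G" "\<omega> \<in> request_event (T - a) T \<delta> (R, i) k" by auto
        with request_event_first_requested[OF _ this(2)] \<delta> GV[of \<omega>] ns
        show "\<omega> \<in> V \<union> zero_weights_event" by auto
      qed
    qed (use V in auto)
    also have "\<dots> \<le> prob V + prob zero_weights_event"
      using V by (intro measure_Un_le) auto
    finally show ?thesis .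
  qed
  have geometric: "exp (- \<delta>) * (1 - exp (- (real N * \<delta>))) \<le> (\<Sum>k<N. \<delta> * exp (- (real k + 1) * \<delta>))"
    if \<delta>: "0 < \<delta>" for \<delta> N
  proof -
    have "(1 - exp (- \<delta>)) * (\<Sum>k<N. exp (- \<delta>) ^ k) = 1 - exp (- \<delta>) ^ N"
      by (rule one_diff_power_eq[symmetric])
    then have "exp (- \<delta>) * (1 - exp (- (real N * \<delta>))) =
        exp (- \<delta>) * ((1 - exp (- \<delta>)) * (\<Sum>k<N. exp (- \<delta>) ^ k))"
      by (simp add: exp_of_nat_mult[symmetric])
    also have "\<dots> \<le> exp (- \<delta>) * (\<delta> * (\<Sum>k<N. exp (- \<delta>) ^ k))"
      using one_minus_exp_bounds(2)[of \<delta>] by (intro mult_left_mono mult_right_mono sum_nonneg) auto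
    also have "\<dots> = (\<Sum>k<N. \<delta> * exp (- (real k + 1) * \<delta>))"
      unfolding sum_distrib_left
    proof (intro sum.cong refl)
      fix k
      have "exp (- (real k + 1) * \<delta>) = exp (- \<delta>) * exp (- \<delta>) ^ k"
        by (simp add: exp_of_nat_mult[symmetric] mult_exp_exp algebra_simps)
      then show "exp (- \<delta>) * (\<delta> * exp (- \<delta>) ^ k) = \<delta> * exp (- (real k + 1) * \<delta>)" by simp
    qed
    finally show ?thesis .
  qed
  \<comment> \<open>mesh \<open>1 / (m + 1)\<close> and \<open>(m + 1)\<^sup>2\<close> cells, which cover a time interval of length \<open>m + 1\<close>\<close>
  have "?A * (exp (- (1 / real (Suc m))) * (1 - exp (- real (Suc m)))) \<le> prob V + prob zero_weights_event" for m
  proof -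
    have "exp (- (1 / real (Suc m))) * (1 - exp (- real (Suc m))) \<le>
        (\<Sum>k<Suc m * Suc m. 1 / real (Suc m) * exp (- (real k + 1) * (1 / real (Suc m))))"
    proof -
      have "real (Suc m * Suc m) * (1 / real (Suc m)) = real (Suc m)"
        by (simp only: of_nat_mult) simp
      then show ?thesis using geometric[of "1 / real (Suc m)" "Suc m * Suc m"]
        by (simp only: zero_less_divide_1_iff of_nat_0_less_iff zero_less_Suc simp_thms)
    qed
    then show ?thesis
      using bound[of "1 / real (Suc m)" "Suc m * Suc m"] A by (meson mult_left_mono order_trans zero_less_divide_1_iff of_nat_0_less_iff zero_less_Suc)
  qed
  moreover have "(\<lambda>m. ?A * (exp (- (1 / real (Suc m))) * (1 - exp (- real (Suc m))))) \<longlonglongrightarrow> ?A * (exp (- 0) * (1 - 0))"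
  proof (intro tendsto_intros)
    show "(\<lambda>m. 1 / real (Suc m)) \<longlonglongrightarrow> 0" by (rule lim_1_over_n[THEN LIMSEQ_Suc])
    show "(\<lambda>m. exp (- real (Suc m))) \<longlonglongrightarrow> 0"
      by (intro filterlim_compose[OF exp_at_bot] filterlim_compose[OF filterlim_uminus_at_bot_at_top]
          filterlim_compose[OF filterlim_real_sequentially filterlim_Suc])
  qed
  ultimately have "?A \<le> prob V + prob zero_weights_event"
    by (intro LIMSEQ_le_const2[of _ ?A]) auto
  moreover have "(\<integral>\<omega>. (\<Sum>Ri\<in>G. joint_prob a \<omega> Ri) \<partial>M) = ?A"
    using G a by (intro Bochner_Integration.integral_sum joint_prob_integrable) auto
  ultimately show ?thesis by simp
qed

end

section \<open>Tails of the search cost\<close>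

context mtf_model
begin

text \<open>Given the weights, the probability that the next requested object lies in \<open>A R\<close>, where \<open>R\<close> is the
  set of objects requested during the preceding time \<open>a\<close>.\<close>

definition pair_mass :: "real \<Rightarrow> (nat set \<Rightarrow> nat set) \<Rightarrow> 'a \<Rightarrow> real" where
  "pair_mass a A \<omega> =
     (\<Sum>R\<in>Pow {1..n}. hit_set_prob a \<omega> R * (\<Sum>i\<in>A R. p i \<omega>))"

text \<open>Given the weights, the expected fraction of objects that are not requested during a time \<open>a\<close>.\<close>

definition miss_fraction :: "real \<Rightarrow> 'a \<Rightarrow> real" where
  "miss_fraction a \<omega> = (\<Sum>i = 1..n. exp (- (p i \<omega> * a))) / n"

text \<open>Given the weights, the probability that the next requested object has not been requested during the
  preceding time \<open>a\<close>.\<close>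

definition miss_rate :: "real \<Rightarrow> 'a \<Rightarrow> real" where
  "miss_rate a \<omega> = (\<Sum>i = 1..n. p i \<omega> * exp (- (p i \<omega> * a)))"

lemma pair_mass_eq_sum_joint_prob:
  assumes "\<And>R. A R \<subseteq> {1..n}"
  shows "pair_mass a A = (\<lambda>\<omega>. \<Sum>Ri\<in>Sigma (Pow {1..n}) A. joint_prob a \<omega> Ri)"
proof -
  have "finite (A R)" for R by (rule finite_subset[OF assms]) simp
  then show ?thesis
    by (simp add: fun_eq_iff pair_mass_def joint_prob_def sum_distrib_left sum.Sigma case_prod_beta)
qed

lemma pair_mass_integrable:
  assumes "\<And>R. A R \<subseteq> {1..n}" "0 \<le> a"
  shows "integrable M (pair_mass a A)"
  unfolding pair_mass_eq_sum_joint_prob[OF assms(1)] using assms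
  by (intro Bochner_Integration.integrable_sum joint_prob_integrable) auto

lemma pair_mass_compl:
  assumes "\<And>R. A R \<subseteq> {1..n}"
  shows "pair_mass a A \<omega> + pair_mass a (\<lambda>R. {1..n} - A R) \<omega> = (\<Sum>i = 1..n. p i \<omega>)"
proof -
  let ?q = "hit_set_prob a \<omega>"
  have "(\<Sum>i\<in>A R. p i \<omega>) + (\<Sum>i\<in>{1..n} - A R. p i \<omega>) = (\<Sum>i = 1..n. p i \<omega>)" for R
    using sum.subset_diff[OF assms[of R], of "\<lambda>i. p i \<omega>"] by simp
  then have "pair_mass a A \<omega> + pair_mass a (\<lambda>R. {1..n} - A R) \<omega> =
      (\<Sum>R\<in>Pow {1..n}. ?q R * (\<Sum>i = 1..n. p i \<omega>))"
    unfolding pair_mass_def by (simp flip: sum.distrib distrib_left)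
  then show ?thesis
    by (simp add: sum_random_subset_prob flip: sum_distrib_right)
qed

lemma pair_mass_mono:
  assumes "\<And>R. R \<subseteq> {1..n} \<Longrightarrow> (\<Sum>i\<in>A R. p i \<omega>) \<le> (\<Sum>i\<in>B R. p i \<omega>) + e R" "0 \<le> a" "\<omega> \<in> space M"
  shows "pair_mass a A \<omega> \<le> pair_mass a B \<omega> +
     (\<Sum>R\<in>Pow {1..n}. hit_set_prob a \<omega> R * e R)"
  unfolding pair_mass_def sum.distrib[symmetric] distrib_left[symmetric]
  using assms by (intro sum_mono mult_left_mono random_subset_prob_hit_le_1) auto

lemma sum_rate_subset_le_1: "A \<subseteq> {1..n} \<Longrightarrow> \<omega> \<in> space M \<Longrightarrow> 0 \<le> (\<Sum>i\<in>A. p i \<omega>) \<and> (\<Sum>i\<in>A. p i \<omega>) \<le> 1"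
  using sum_mono2[of "{1..n}" A "\<lambda>i. p i \<omega>"] rate_nonneg[of _ \<omega>] sum_rate_le_1[of \<omega>]
  by (force intro!: sum_nonneg)

lemma pair_mass_complement: "pair_mass a (\<lambda>R. {1..n} - R) \<omega> = miss_rate a \<omega>"
  unfolding pair_mass_def miss_rate_def hit_prob_def by (simp add: sum_random_subset_prob_complement)

lemma pair_mass_complement': "pair_mass a (\<lambda>R. {1..n} - R) = miss_rate a"
  by (rule ext) (rule pair_mass_complement)

lemma miss_rate_integrable:
  assumes "0 \<le> a"
  shows "integrable M (miss_rate a)"
  unfolding pair_mass_complement'[symmetric] using assms by (intro pair_mass_integrable) auto

lemma miss_fraction_measurable: "miss_fraction a \<in> borel_measurable M"
  unfolding miss_fraction_def
  by (intro borel_measurable_divide borel_measurable_sum borel_measurable_const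
      borel_measurable_exp[THEN measurable_compose[rotated]]
      borel_measurable_uminus borel_measurable_times rate_measurable)

lemma miss_fraction_01: "0 \<le> a \<Longrightarrow> \<omega> \<in> space M \<Longrightarrow> 0 \<le> miss_fraction a \<omega> \<and> miss_fraction a \<omega> \<le> 1"
proof -
  assume a: "0 \<le> a" "\<omega> \<in> space M"
  have "(\<Sum>i = 1..n. exp (- (p i \<omega> * a))) \<le> (\<Sum>i = 1..n. 1)"
    using a rate_nonneg[of _ \<omega>] by (intro sum_mono) auto
  then show ?thesis
    unfolding miss_fraction_def by (auto intro!: divide_nonneg_nonneg sum_nonneg divide_le_eq_1[THEN iffD2])
qed

text \<open>A bound, given the weights, for the mean square distance between the fraction of objects requested
  during a time \<open>a\<close> and \<open>1 - f\<close>; see \<open>deviation_bound\<close>.\<close>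

definition deviation :: "real \<Rightarrow> real \<Rightarrow> 'a \<Rightarrow> real" where
  "deviation a f \<omega> = 1 / n + \<bar>miss_fraction a \<omega> - f\<bar>"

lemma deviation_integrable: "0 \<le> a \<Longrightarrow> integrable M (deviation a f)"
proof (rule integrable_const_bound[where B = "1 / n + (1 + \<bar>f\<bar>)"])
  show "0 \<le> a \<Longrightarrow> AE \<omega> in M. norm (deviation a f \<omega>) \<le> 1 / n + (1 + \<bar>f\<bar>)"
    using AE_space
  proof eventually_elim
    fix \<omega> assume "0 \<le> a" "\<omega> \<in> space M"
    then have "\<bar>miss_fraction a \<omega> - f\<bar> \<le> 1 + \<bar>f\<bar>"
      using miss_fraction_01[of a \<omega>] by linarith
    then show "norm (deviation a f \<omega>) \<le> 1 / n + (1 + \<bar>f\<bar>)"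
      unfolding deviation_def by simp
  qed
qed (use miss_fraction_measurable in \<open>auto simp: deviation_def[abs_def]\<close>)

lemma deviation_bound:
  assumes "n \<ge> 1" "0 \<le> a" "0 \<le> f" "f \<le> 1" "\<omega> \<in> space M"
  shows "(\<Sum>R\<in>Pow {1..n}. hit_set_prob a \<omega> R * (real (card R) / n - (1 - f))\<^sup>2)
     \<le> deviation a f \<omega>"
proof -
  have "(\<Sum>j = 1..n. hit_prob a \<omega> j) / n = 1 - miss_fraction a \<omega>"
    using assms(1) by (simp add: hit_prob_def miss_fraction_def sum_subtractf diff_divide_distrib)
  then show ?thesis
    using random_subset_deviation[of "{1..n}" "hit_prob a \<omega>" n "1 - f"] assms hit_prob_01[of a _ \<omega>]
    by (simp add: deviation_def abs_minus_commute)
qed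

lemma prob_ge_pair_mass:
  assumes a: "0 \<le> a" "a \<le> T" and A: "\<And>R. A R \<subseteq> {1..n}" and V: "V \<in> sets M"
    and AV: "\<And>\<omega>. \<omega> \<in> space M \<Longrightarrow> \<omega> \<notin> zero_weights_event \<Longrightarrow> no_simultaneous_requests n X T \<omega> \<Longrightarrow>
       first_requested n X T \<omega> \<in> A (requested_in n X (T - a) T \<omega>) \<Longrightarrow> \<omega> \<in> V"
  shows "expectation (pair_mass a A) \<le> prob V + prob zero_weights_event"
  unfolding pair_mass_eq_sum_joint_prob[OF A]
  using A AV by (intro joint_law_lower_bound[OF a _ V]) auto

text \<open>The lower bound for the complementary event. The rates add up to 1 unless all weights vanish, which
  accounts for one of the two error terms.\<close>

lemma prob_le_pair_mass:
  assumes a: "0 \<le> a" "a \<le> T" and A: "\<And>R. A R \<subseteq> {1..n}" and V: "V \<in> sets M"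
    and AV: "\<And>\<omega>. \<omega> \<in> space M \<Longrightarrow> \<omega> \<notin> zero_weights_event \<Longrightarrow> no_simultaneous_requests n X T \<omega> \<Longrightarrow>
       first_requested n X T \<omega> \<in> {1..n} - A (requested_in n X (T - a) T \<omega>) \<Longrightarrow> \<omega> \<notin> V"
  shows "prob V \<le> expectation (pair_mass a A) + 2 * prob zero_weights_event"
proof -
  let ?A' = "\<lambda>R. {1..n} - A R"
  have "expectation (pair_mass a ?A') \<le> prob (space M - V) + prob zero_weights_event"
    using AV by (intro prob_ge_pair_mass[OF a]) (use V in auto)
  moreover have "expectation (pair_mass a A) + expectation (pair_mass a ?A') =
      (\<integral>\<omega>. pair_mass a A \<omega> + pair_mass a ?A' \<omega> \<partial>M)"
    using A a by (intro Bochner_Integration.integral_add[symmetric] pair_mass_integrable) auto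
  moreover have "\<dots> = (\<integral>\<omega>. indicator (space M - zero_weights_event) \<omega> \<partial>M)"
    by (intro Bochner_Integration.integral_cong refl)
       (auto simp: pair_mass_compl[OF A] sum_rate zero_weights_event_def indicator_def simp del: One_nat_def)
  moreover have "\<dots> = 1 - prob zero_weights_event"
    by (simp add: prob_compl)
  moreover have "prob (space M - V) = 1 - prob V" using V by (rule prob_compl)
  ultimately show ?thesis by simp
qed

end

text \<open>Markov's inequality pointwise: beyond the threshold \<open>z\<close> the squared distance to \<open>c\<close> is at least that
  of \<open>z\<close>.\<close>

lemma one_le_squared_distance_ratio:
  fixes c z x :: real
  assumes "c \<noteq> z" "z < c \<and> x \<le> z \<or> c < z \<and> z \<le> x"
  shows "1 \<le> (x - c)\<^sup>2 / (z - c)\<^sup>2"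
proof -
  have "\<bar>z - c\<bar> \<le> \<bar>x - c\<bar>" using assms by auto
  then have "(z - c)\<^sup>2 \<le> (x - c)\<^sup>2" by (simp add: abs_le_square_iff)
  then show ?thesis using assms(1) by simp
qed

text \<open>If \<open>R\<close> is the set of objects requested before the search, the object of rank \<open>r\<close> among the others is at
  position \<open>|R| + r\<close>; these are the unrequested objects whose position exceeds \<open>y\<close>.\<close>

definition tail_ranks :: "nat \<Rightarrow> real \<Rightarrow> nat set \<Rightarrow> nat set" where
  "tail_ranks n y R = {i\<in>{1..n} - R. y < real (card R + card {j\<in>{1..n} - R. j \<le> i})}"

text \<open>A chain started from the identity and observed at time \<open>T\<close>. The measurability of the search cost is
  taken as an assumption here; for large \<open>n\<close> it follows from the convergence in law
  (\<open>eventually_cost_measurable\<close>).\<close>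

locale transient_mtf_model = mtf_model +
  fixes T :: real
  assumes n_pos: "n \<ge> 1" and init_id: "init_pos X = id" and T_nonneg: "0 \<le> T"
    and cost_measurable: "(\<lambda>\<omega>. real (search_cost n X T \<omega>)) \<in> borel_measurable M"
begin

definition cost_exceeds :: "real \<Rightarrow> 'a set" where
  "cost_exceeds z = {\<omega>\<in>space M. z * n < real (search_cost n X T \<omega>)}"

lemma cost_exceeds_sets: "cost_exceeds z \<in> sets M"
  unfolding cost_exceeds_def using cost_measurable by measurable

lemma search_cost_bounds:
  assumes a: "0 \<le> a" "a \<le> T" and \<omega>: "\<omega> \<in> space M" "\<omega> \<notin> zero_weights_event" "no_simultaneous_requests n X T \<omega>"
    and i: "first_requested n X T \<omega> \<in> {1..n}"
  defines "i \<equiv> first_requested n X T \<omega>" and "R \<equiv> requested_in n X (T - a) T \<omega>"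
  shows "i \<in> R \<Longrightarrow> search_cost n X T \<omega> \<le> card R"
    and "i \<notin> R \<Longrightarrow> card R < search_cost n X T \<omega>"
    and "i \<notin> R \<Longrightarrow> a = T \<Longrightarrow> search_cost n X T \<omega> = card R + card {j\<in>{1..n} - R. j \<le> i}"
proof -
  have "search_cost n X T \<omega> = position i (mtf_list n X T \<omega>)"
    using \<omega>(1,2) unfolding search_cost_def i_def first_requested_def zero_weights_event_def by auto
  moreover have "0 \<le> T - a" "T - a \<le> T" using a by auto
  note position_mtf_list[OF requests_finite[OF _ \<omega>(1)] \<omega>(3) init_id this i, folded i_def R_def]
  ultimately show "i \<in> R \<Longrightarrow> search_cost n X T \<omega> \<le> card R"
    and "i \<notin> R \<Longrightarrow> card R < search_cost n X T \<omega>"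
    and "i \<notin> R \<Longrightarrow> a = T \<Longrightarrow> search_cost n X T \<omega> = card R + card {j\<in>{1..n} - R. j \<le> i}"
    by simp_all
qed

text \<open>If the next object has not been requested recently and at least \<open>z n\<close> objects have been, the cost
  exceeds \<open>z n\<close>. That fewer than \<open>z n\<close> objects have been requested is unlikely because \<open>z < 1 - f\<close>.\<close>

lemma cost_exceeds_lower_below:
  fixes a f z :: real
  assumes a: "0 \<le> a" "a \<le> T" and f: "0 \<le> f" "f \<le> 1" and z: "z < 1 - f"
  shows "expectation (miss_rate a) - expectation (deviation a f) / (z - (1 - f))\<^sup>2
     \<le> prob (cost_exceeds z) + prob zero_weights_event"
proof -
  let ?A = "\<lambda>R. if z * n \<le> real (card R) then {1..n} - R else {}"
  have A: "?A R \<subseteq> {1..n}" for R by simp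
  let ?d = "\<lambda>R. (real (card R) / n - (1 - f))\<^sup>2 / (z - (1 - f))\<^sup>2"
  have "miss_rate a \<omega> \<le> pair_mass a ?A \<omega> + deviation a f \<omega> / (z - (1 - f))\<^sup>2" if \<omega>: "\<omega> \<in> space M" for \<omega>
  proof -
    have "miss_rate a \<omega> \<le> pair_mass a ?A \<omega> +
        (\<Sum>R\<in>Pow {1..n}. hit_set_prob a \<omega> R * ?d R)"
      unfolding pair_mass_complement[symmetric]
    proof (rule pair_mass_mono[OF _ a(1) \<omega>])
      fix R :: "nat set" assume "R \<subseteq> {1..n}"
      show "(\<Sum>i\<in>{1..n} - R. p i \<omega>) \<le> (\<Sum>i\<in>?A R. p i \<omega>) + ?d R"
      proof (cases "z * n \<le> real (card R)")
        case False
        then have "1 \<le> ?d R" using z n_pos by (intro one_le_squared_distance_ratio) (auto simp: field_simps)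
        then show ?thesis using sum_rate_subset_le_1[of "{1..n} - R" \<omega>] \<omega> False by auto
      qed auto
    qed
    also have "\<dots> \<le> pair_mass a ?A \<omega> + deviation a f \<omega> / (z - (1 - f))\<^sup>2"
      using deviation_bound[OF n_pos a(1) f \<omega>]
      by (simp add: sum_divide_distrib[symmetric] divide_right_mono)
    finally show ?thesis .
  qed
  then have "expectation (miss_rate a) \<le> (\<integral>\<omega>. pair_mass a ?A \<omega> + deviation a f \<omega> / (z - (1 - f))\<^sup>2 \<partial>M)"
    using a by (intro integral_mono miss_rate_integrable Bochner_Integration.integrable_add
      pair_mass_integrable[OF A] integrable_divide deviation_integrable) auto
  also have "\<dots> = expectation (pair_mass a ?A) + expectation (deviation a f) / (z - (1 - f))\<^sup>2"
    using a by (subst Bochner_Integration.integral_add)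
      (auto intro!: pair_mass_integrable[OF A] integrable_divide deviation_integrable simp del: One_nat_def)
  also have "expectation (pair_mass a ?A) \<le> prob (cost_exceeds z) + prob zero_weights_event"
  proof (rule prob_ge_pair_mass[OF a _ cost_exceeds_sets])
    fix \<omega> assume \<omega>: "\<omega> \<in> space M" "\<omega> \<notin> zero_weights_event" "no_simultaneous_requests n X T \<omega>"
      "first_requested n X T \<omega> \<in> ?A (requested_in n X (T - a) T \<omega>)"
    then show "\<omega> \<in> cost_exceeds z"
      using search_cost_bounds(2)[OF a \<omega>(1-3)] unfolding cost_exceeds_def by (auto split: if_splits)
  qed auto
  finally show ?thesis by simp
qed

text \<open>Let \<open>A R\<close> contain the unrequested objects that may be found beyond \<open>z n\<close>. Apart from these, a cost
  above \<open>z n\<close> needs more than \<open>z n\<close> recently requested objects, which is unlikely because \<open>1 - f < z\<close>.\<close>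

lemma cost_exceeds_upper:
  fixes a f z :: real
  assumes a: "0 \<le> a" "a \<le> T" and f: "0 \<le> f" "f \<le> 1" and z: "1 - f < z"
    and A: "\<And>R. A R \<subseteq> {1..n} - R"
    and cost: "\<And>\<omega>. \<omega> \<in> space M \<Longrightarrow> \<omega> \<notin> zero_weights_event \<Longrightarrow> no_simultaneous_requests n X T \<omega> \<Longrightarrow>
       first_requested n X T \<omega> \<in> {1..n} - requested_in n X (T - a) T \<omega> - A (requested_in n X (T - a) T \<omega>) \<Longrightarrow>
       real (search_cost n X T \<omega>) \<le> z * n"
  shows "prob (cost_exceeds z) \<le> expectation (pair_mass a A) +
     expectation (deviation a f) / (z - (1 - f))\<^sup>2 + 2 * prob zero_weights_event"
proof -
  let ?A = "\<lambda>R. if real (card R) \<le> z * n then A R else {1..n}"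
  let ?d = "\<lambda>R. (real (card R) / n - (1 - f))\<^sup>2 / (z - (1 - f))\<^sup>2"
  have A1: "A R \<subseteq> {1..n}" for R using A[of R] by auto
  then have A': "?A R \<subseteq> {1..n}" for R by simp
  have "pair_mass a ?A \<omega> \<le> pair_mass a A \<omega> + deviation a f \<omega> / (z - (1 - f))\<^sup>2" if \<omega>: "\<omega> \<in> space M" for \<omega>
  proof -
    have "pair_mass a ?A \<omega> \<le> pair_mass a A \<omega> +
        (\<Sum>R\<in>Pow {1..n}. hit_set_prob a \<omega> R * ?d R)"
    proof (rule pair_mass_mono[OF _ a(1) \<omega>])
      fix R :: "nat set" assume "R \<subseteq> {1..n}"
      show "(\<Sum>i\<in>?A R. p i \<omega>) \<le> (\<Sum>i\<in>A R. p i \<omega>) + ?d R"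
      proof (cases "real (card R) \<le> z * n")
        case False
        then have "1 \<le> ?d R" using z n_pos by (intro one_le_squared_distance_ratio) (auto simp: field_simps)
        then show ?thesis
          using sum_rate_subset_le_1[OF A1 \<omega>, of R] sum_rate_le_1[OF \<omega>] False by auto
      qed auto
    qed
    also have "\<dots> \<le> pair_mass a A \<omega> + deviation a f \<omega> / (z - (1 - f))\<^sup>2"
      using deviation_bound[OF n_pos a(1) f \<omega>]
      by (simp add: sum_divide_distrib[symmetric] divide_right_mono)
    finally show ?thesis .
  qed
  then have "expectation (pair_mass a ?A) \<le> (\<integral>\<omega>. pair_mass a A \<omega> + deviation a f \<omega> / (z - (1 - f))\<^sup>2 \<partial>M)"
    using a by (intro integral_mono Bochner_Integration.integrable_add
      pair_mass_integrable[OF A'] pair_mass_integrable[OF A1] integrable_divide deviation_integrable) auto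
  also have "\<dots> = expectation (pair_mass a A) + expectation (deviation a f) / (z - (1 - f))\<^sup>2"
    using a by (subst Bochner_Integration.integral_add)
      (auto intro!: pair_mass_integrable[OF A1] integrable_divide deviation_integrable simp del: One_nat_def)
  finally have "expectation (pair_mass a ?A) \<le>
      expectation (pair_mass a A) + expectation (deviation a f) / (z - (1 - f))\<^sup>2" .
  moreover have "prob (cost_exceeds z) \<le> expectation (pair_mass a ?A) + 2 * prob zero_weights_event"
  proof (rule prob_le_pair_mass[OF a _ cost_exceeds_sets])
    fix \<omega> assume \<omega>: "\<omega> \<in> space M" "\<omega> \<notin> zero_weights_event" "no_simultaneous_requests n X T \<omega>"
      "first_requested n X T \<omega> \<in> {1..n} - ?A (requested_in n X (T - a) T \<omega>)"
    then show "\<omega> \<notin> cost_exceeds z"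
      using search_cost_bounds(1)[OF a \<omega>(1-3)] cost[OF \<omega>(1-3)]
      unfolding cost_exceeds_def by (force split: if_splits)
  qed (use A' in auto)
  ultimately show ?thesis by simp
qed

lemma cost_exceeds_upper_above:
  fixes a f z :: real
  assumes a: "0 \<le> a" "a \<le> T" and f: "0 \<le> f" "f \<le> 1" and z: "1 - f < z"
  shows "prob (cost_exceeds z) \<le> expectation (miss_rate a) +
     expectation (deviation a f) / (z - (1 - f))\<^sup>2 + 2 * prob zero_weights_event"
  unfolding pair_mass_complement'[symmetric] by (rule cost_exceeds_upper[OF a f z]) auto

text \<open>When the whole past \<open>[0, T)\<close> is taken into account, the position of an unrequested object is known
  exactly.\<close>

lemma cost_exceeds_tail_ranks:
  fixes f z :: real
  assumes f: "0 \<le> f" "f \<le> 1" and z: "1 - f < z"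
  shows "expectation (pair_mass T (tail_ranks n (z * n))) \<le> prob (cost_exceeds z) + prob zero_weights_event"
    and "prob (cost_exceeds z) \<le> expectation (pair_mass T (tail_ranks n (z * n))) +
     expectation (deviation T f) / (z - (1 - f))\<^sup>2 + 2 * prob zero_weights_event"
proof -
  note cost = search_cost_bounds(3)[OF T_nonneg order_refl]
  show "expectation (pair_mass T (tail_ranks n (z * n))) \<le> prob (cost_exceeds z) + prob zero_weights_event"
  proof (rule prob_ge_pair_mass[OF T_nonneg order_refl _ cost_exceeds_sets])
    fix \<omega> assume \<omega>: "\<omega> \<in> space M" "\<omega> \<notin> zero_weights_event" "no_simultaneous_requests n X T \<omega>"
      "first_requested n X T \<omega> \<in> tail_ranks n (z * n) (requested_in n X (T - T) T \<omega>)"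
    then show "\<omega> \<in> cost_exceeds z"
      using cost[OF \<omega>(1-3)] unfolding cost_exceeds_def tail_ranks_def by simp
  qed (auto simp: tail_ranks_def)
  show "prob (cost_exceeds z) \<le> expectation (pair_mass T (tail_ranks n (z * n))) +
     expectation (deviation T f) / (z - (1 - f))\<^sup>2 + 2 * prob zero_weights_event"
  proof (rule cost_exceeds_upper[OF T_nonneg order_refl f z])
    fix \<omega> assume \<omega>: "\<omega> \<in> space M" "\<omega> \<notin> zero_weights_event" "no_simultaneous_requests n X T \<omega>"
      "first_requested n X T \<omega> \<in> {1..n} - requested_in n X (T - T) T \<omega> -
        tail_ranks n (z * n) (requested_in n X (T - T) T \<omega>)"
    let ?i = "first_requested n X T \<omega>" and ?R = "requested_in n X (T - T) T \<omega>"
    have i: "?i \<in> {1..n}" "?i \<notin> ?R" "?i \<notin> tail_ranks n (z * n) ?R" using \<omega>(4) by auto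
    then have "\<not> z * n < real (card ?R + card {j\<in>{1..n} - ?R. j \<le> ?i})"
      unfolding tail_ranks_def by blast
    then show "real (search_cost n X T \<omega>) \<le> z * n"
      using cost[OF \<omega>(1-3) i(1,2)] by simp
  qed (auto simp: tail_ranks_def)
qed

end

section \<open>Unrequested objects in sorted and in exchangeable order\<close>

lemma tail_ranks_subset: "tail_ranks n y R \<subseteq> {1..n} - R"
  by (auto simp: tail_ranks_def)

lemma tail_ranks_upper:
  assumes "i \<in> tail_ranks n y R" "j \<in> {1..n} - R - tail_ranks n y R"
  shows "j < i"
proof (rule ccontr)
  assume "\<not> j < i"
  then have "card {k\<in>{1..n} - R. k \<le> i} \<le> card {k\<in>{1..n} - R. k \<le> j}"
    by (intro card_mono) auto
  then show False using assms unfolding tail_ranks_def by auto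
qed

text \<open>The ranks of the unrequested objects are \<open>1, \<dots>, n - |R|\<close>, so \<open>tail_ranks\<close> consists of the last
  \<open>n - \<lfloor>y\<rfloor>\<close> of them, or of all if there are fewer.\<close>

lemma card_tail_ranks:
  assumes "R \<subseteq> {1..n}" "0 \<le> y"
  shows "card (tail_ranks n y R) = min (n - card R) (n - nat \<lfloor>y\<rfloor>)"
proof -
  define L where "L = {1..n} - R"
  define N where "N i = card {j\<in>L. j \<le> i}" for i
  have fin: "finite L" "finite R" by (simp_all add: L_def finite_subset[OF assms(1)])
  have card_L: "card L = n - card R"
    unfolding L_def using assms(1) fin by (simp add: card_Diff_subset)
  have "card R \<le> n" using card_mono[OF _ assms(1)] by simp
  have "strict_mono_on L N"
  proof (rule strict_mono_onI)
    fix i j assume "i \<in> L" "j \<in> L" "i < j"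
    then have "{k\<in>L. k \<le> i} \<subseteq> {k\<in>L. k \<le> j}" "j \<in> {k\<in>L. k \<le> j} - {k\<in>L. k \<le> i}" by auto
    then have "{k\<in>L. k \<le> i} \<subset> {k\<in>L. k \<le> j}" by blast
    then show "N i < N j" unfolding N_def using fin by (intro psubset_card_mono) auto
  qed
  then have inj: "inj_on N L" by (rule strict_mono_on_imp_inj_on)
  have "N ` L \<subseteq> {1..card L}"
  proof clarify
    fix i assume "i \<in> L"
    then have "i \<in> {k\<in>L. k \<le> i}" by simp
    then have "N i \<noteq> 0" unfolding N_def using fin by auto
    moreover have "N i \<le> card L" unfolding N_def using fin by (intro card_mono) auto
    ultimately show "N i \<in> {1..card L}" by auto
  qed
  then have N_image: "N ` L = {1..card L}"
    using card_image[OF inj] by (intro card_subset_eq) auto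
  have tail: "tail_ranks n y R = {i\<in>L. nat \<lfloor>y\<rfloor> < card R + N i}"
  proof -
    have "y < real m \<longleftrightarrow> nat \<lfloor>y\<rfloor> < m" for m
      using assms(2) by (simp add: nat_less_iff floor_less_iff)
    then show ?thesis unfolding tail_ranks_def L_def N_def by blast
  qed
  have "card (tail_ranks n y R) = card (N ` tail_ranks n y R)"
    unfolding tail by (intro card_image[symmetric] inj_on_subset[OF inj]) auto
  also have "N ` tail_ranks n y R = {r\<in>N ` L. nat \<lfloor>y\<rfloor> < card R + r}"
    unfolding tail by auto
  also have "\<dots> = {max 1 (nat \<lfloor>y\<rfloor> + 1 - card R)..card L}"
    unfolding N_image by auto
  also have "card \<dots> = min (n - card R) (n - nat \<lfloor>y\<rfloor>)"
    unfolding card_L using \<open>card R \<le> n\<close> by simp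
  finally show ?thesis .
qed


text \<open>A case of Chebyshev's sum inequality: a part \<open>B\<close> on which \<open>v\<close> takes smaller values than on the rest
  has at most its proportional share of the total.\<close>

lemma sum_upper_part_le:
  fixes v :: "'i \<Rightarrow> real"
  assumes "finite L" "B \<subseteq> L" "\<And>i j. i \<in> B \<Longrightarrow> j \<in> L - B \<Longrightarrow> v i \<le> v j"
  shows "card L * (\<Sum>i\<in>B. v i) \<le> card B * (\<Sum>i\<in>L. v i)"
proof -
  have fin: "finite B" "finite (L - B)" using assms finite_subset by auto
  have L: "card L = card B + card (L - B)"
    using assms(1,2) fin card_mono[OF assms(1,2)] by (simp add: card_Diff_subset)
  have "card (L - B) * (\<Sum>i\<in>B. v i) = (\<Sum>i\<in>B. \<Sum>j\<in>L - B. v i)"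
    by (simp add: sum_distrib_left)
  also have "\<dots> \<le> (\<Sum>i\<in>B. \<Sum>j\<in>L - B. v j)"
    using assms(3) by (intro sum_mono) auto
  also have "\<dots> = card B * (\<Sum>j\<in>L - B. v j)"
    by simp
  finally have "card (L - B) * (\<Sum>i\<in>B. v i) \<le> card B * (\<Sum>j\<in>L - B. v j)" .
  moreover have "(\<Sum>i\<in>L. v i) = (\<Sum>i\<in>L - B. v i) + (\<Sum>i\<in>B. v i)"
    using assms(1,2) by (rule sum.subset_diff[rotated])
  ultimately show ?thesis by (simp add: L algebra_simps)
qed

text \<open>The fraction of the unrequested objects that is in \<open>tail_ranks\<close>. The value 1 in the case that every
  object has been requested keeps \<open>tail_share_bound\<close> valid there.\<close>

definition tail_share :: "nat \<Rightarrow> real \<Rightarrow> nat set \<Rightarrow> real" where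
  "tail_share n y R = (if card R = n then 1 else card (tail_ranks n y R) / (n - card R))"

text \<open>With \<open>k = n - \<lfloor>y\<rfloor>\<close> and \<open>l = n - |R|\<close> the share is \<open>min l k / l\<close>. It is close to \<open>k / (n f)\<close> as soon
  as \<open>l / n\<close> is close to \<open>f\<close>, with a constant that does not depend on \<open>k\<close> since \<open>k \<le> n f\<close>.\<close>

lemma tail_share_bound:
  assumes R: "R \<subseteq> {1..n}" and "0 \<le> y" "n \<ge> 1" and f: "0 < f" "real (n - nat \<lfloor>y\<rfloor>) / n \<le> f"
  shows "\<bar>tail_share n y R - real (n - nat \<lfloor>y\<rfloor>) / n / f\<bar> \<le> \<bar>real (card R) / n - (1 - f)\<bar> / f"
proof -
  define k where "k = real (n - nat \<lfloor>y\<rfloor>)"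
  define l where "l = real (n - card R)"
  have R_n: "card R \<le> n" using card_mono[OF _ R] by simp
  have u: "\<bar>real (card R) / n - (1 - f)\<bar> = \<bar>l / n - f\<bar>"
    using R_n assms(3) by (simp add: l_def of_nat_diff diff_divide_distrib)
  have k: "0 \<le> k" "k \<le> n * f" using f(2) assms(3) by (auto simp: k_def field_simps)
  have nf: "0 < n * f" using assms(3) f by simp
  have "\<bar>tail_share n y R - k / n / f\<bar> \<le> \<bar>l / n - f\<bar> / f"
  proof (cases "card R = n")
    case True
    then show ?thesis using k nf f unfolding tail_share_def l_def by (simp add: field_simps)
  next
    case False
    then have l: "0 < l" using R_n by (simp add: l_def)
    have share: "tail_share n y R = min l k / l"
      using \<open>card R \<noteq> n\<close> card_tail_ranks[OF R assms(2)] R_n by (simp add: tail_share_def l_def k_def of_nat_min of_nat_diff)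
    have rhs: "\<bar>l / n - f\<bar> / f = \<bar>l - n * f\<bar> / (n * f)"
      using assms(3) f by (simp add: abs_if field_simps)
    show ?thesis
    proof (cases "k \<le> l")
      case True
      have "\<bar>k / l - k / (n * f)\<bar> = (k / l) * (\<bar>l - n * f\<bar> / (n * f))"
      proof -
        have "k / l - k / c = (k / l) * ((c - l) / c)" if "c \<noteq> 0" for c
          using l that by (simp add: field_simps)
        moreover have "n * f \<noteq> 0" using nf by linarith
        ultimately have "k / l - k / (n * f) = (k / l) * ((n * f - l) / (n * f))" by blast
        then have "\<bar>k / l - k / (n * f)\<bar> = \<bar>k / l\<bar> * (\<bar>n * f - l\<bar> / \<bar>n * f\<bar>)"
          by (simp only: abs_mult abs_divide)
        moreover have "\<bar>k / l\<bar> = k / l" "\<bar>n * f\<bar> = n * f" using k l nf by simp_all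
        ultimately show ?thesis by (simp only: abs_minus_commute[of "n * f" l])
      qed
      also have "\<dots> \<le> 1 * (\<bar>l - n * f\<bar> / (n * f))"
        using True l nf by (intro mult_right_mono) auto
      finally have "\<bar>k / l - k / (n * f)\<bar> \<le> \<bar>l - n * f\<bar> / (n * f)" by (simp only: mult_1_left)
      moreover have "min l k = k" using True by simp
      ultimately show ?thesis unfolding share rhs by (simp only: divide_divide_eq_left)
    next
      case False
      have "k / (n * f) \<le> 1" using k(2) nf by (simp only: divide_le_eq_1_pos)
      moreover have "l / (n * f) \<le> k / (n * f)" using False nf by (intro divide_right_mono) auto
      moreover have "\<bar>l - n * f\<bar> / (n * f) = 1 - l / (n * f)"
      proof -
        have "\<bar>l - n * f\<bar> = n * f - l" using False k by simp
        moreover have "n * f \<noteq> 0" using nf by linarith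
        ultimately show ?thesis by (simp add: diff_divide_distrib)
      qed
      ultimately have "\<bar>1 - k / (n * f)\<bar> \<le> \<bar>l - n * f\<bar> / (n * f)" by linarith
      moreover have "min l k / l = 1" using False l by simp
      ultimately show ?thesis by (simp only: share rhs divide_divide_eq_left)
    qed
  qed
  then show ?thesis unfolding u k_def .
qed

context mtf_model
begin

text \<open>What \<open>pair_mass a (tail_ranks n y)\<close> would be if the unrequested objects were in uniformly random
  order: the common term of comparison of the three cases.\<close>

definition uniform_tail_mass :: "real \<Rightarrow> real \<Rightarrow> 'a \<Rightarrow> real" where
  "uniform_tail_mass a y \<omega> = (\<Sum>R\<in>Pow {1..n}.
     hit_set_prob a \<omega> R * (tail_share n y R * (\<Sum>i\<in>{1..n} - R. p i \<omega>)))"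

lemma tail_share_mult:
  fixes S :: real
  assumes "R \<subseteq> {1..n}"
  shows "tail_share n y R * S = (if card R = n then S else card (tail_ranks n y R) * S / card ({1..n} - R))"
    and "card R = n \<longleftrightarrow> {1..n} - R = {}"
proof -
  have "finite R" using assms finite_subset by blast
  then have c: "card ({1..n} - R) = n - card R" using assms by (simp add: card_Diff_subset)
  have "card R \<le> n" using card_mono[OF _ assms] by simp
  then show "card R = n \<longleftrightarrow> {1..n} - R = {}"
    using c by (metis card_eq_0_iff diff_is_0_eq diff_diff_cancel finite_Diff finite_atLeastAtMost minus_nat.diff_0)
  show "tail_share n y R * S = (if card R = n then S else card (tail_ranks n y R) * S / card ({1..n} - R))"
    unfolding c tail_share_def using \<open>card R \<le> n\<close> by (simp add: of_nat_diff)
qed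

lemma tail_rates_le:
  assumes R: "R \<subseteq> {1..n}" and mono: "\<And>i j. i \<in> {1..n} \<Longrightarrow> j \<in> {1..n} \<Longrightarrow> j < i \<Longrightarrow> s * p i \<omega> \<le> s * p j \<omega>"
  shows "s * (\<Sum>i\<in>tail_ranks n y R. p i \<omega>) \<le> s * (tail_share n y R * (\<Sum>i\<in>{1..n} - R. p i \<omega>))"
proof (cases "card R = n")
  case True
  then have L: "{1..n} - R = {}" using tail_share_mult(2)[OF R] by simp
  then have "tail_ranks n y R = {}" using tail_ranks_subset[of n y R] by blast
  then show ?thesis by (simp only: L) simp
next
  case False
  then have "card ({1..n} - R) > 0" using tail_share_mult(2)[OF R] by (simp add: card_gt_0_iff)
  moreover have "card ({1..n} - R) * (\<Sum>i\<in>tail_ranks n y R. s * p i \<omega>) \<le>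
      card (tail_ranks n y R) * (\<Sum>i\<in>{1..n} - R. s * p i \<omega>)"
  proof (rule sum_upper_part_le)
    fix i j assume ij: "i \<in> tail_ranks n y R" "j \<in> {1..n} - R - tail_ranks n y R"
    have "i \<in> {1..n}" using ij(1) tail_ranks_subset[of n y R] by blast
    moreover have "j \<in> {1..n}" using ij(2) by blast
    ultimately show "s * p i \<omega> \<le> s * p j \<omega>" using tail_ranks_upper[OF ij] by (rule mono)
  qed (use tail_ranks_subset in auto)
  moreover have "s * (tail_share n y R * (\<Sum>i\<in>{1..n} - R. p i \<omega>)) =
      card (tail_ranks n y R) * (\<Sum>i\<in>{1..n} - R. s * p i \<omega>) / card ({1..n} - R)"
    unfolding tail_share_mult(1)[OF R] using False by (simp flip: sum_distrib_left)
  ultimately have "(\<Sum>i\<in>tail_ranks n y R. s * p i \<omega>) \<le> s * (tail_share n y R * (\<Sum>i\<in>{1..n} - R. p i \<omega>))"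
    by (simp only: pos_le_divide_eq of_nat_0_less_iff mult.commute[of "\<Sum>i\<in>tail_ranks n y R. s * p i \<omega>"])
  then show ?thesis by (simp only: sum_distrib_left[of s "\<lambda>i. p i \<omega>" "tail_ranks n y R"])
qed

text \<open>With decreasing weights the last unrequested objects have the smallest rates.\<close>

lemma pair_mass_tail_ranks_le:
  assumes "0 \<le> a" "\<omega> \<in> space M" "antimono_on {1..n} (\<lambda>i. weight X i \<omega>)"
  shows "pair_mass a (tail_ranks n y) \<omega> \<le> uniform_tail_mass a y \<omega>"
  unfolding pair_mass_def uniform_tail_mass_def
proof (intro sum_mono mult_left_mono)
  fix R assume R: "R \<in> Pow {1..n}"
  have "1 * p i \<omega> \<le> 1 * p j \<omega>" if "i \<in> {1..n}" "j \<in> {1..n}" "j < i" for i j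
  proof -
    have "weight X i \<omega> \<le> weight X j \<omega>" using monotone_onD[OF assms(3) that(2,1)] that(3) by simp
    then show ?thesis
      unfolding request_rate_def mult_1_left using assms(2)
      by (intro divide_right_mono sum_nonneg weight_nonneg)
  qed
  then show "(\<Sum>i\<in>tail_ranks n y R. p i \<omega>) \<le> tail_share n y R * (\<Sum>i\<in>{1..n} - R. p i \<omega>)"
    using tail_rates_le[of R 1 \<omega> y] R by simp
qed (use assms random_subset_prob_hit_le_1 in auto)

lemma pair_mass_tail_ranks_ge:
  assumes "0 \<le> a" "\<omega> \<in> space M" "mono_on {1..n} (\<lambda>i. weight X i \<omega>)"
  shows "uniform_tail_mass a y \<omega> \<le> pair_mass a (tail_ranks n y) \<omega>"
  unfolding pair_mass_def uniform_tail_mass_def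
proof (intro sum_mono mult_left_mono)
  fix R assume R: "R \<in> Pow {1..n}"
  have "- 1 * p i \<omega> \<le> - 1 * p j \<omega>" if "i \<in> {1..n}" "j \<in> {1..n}" "j < i" for i j
  proof -
    have "weight X j \<omega> \<le> weight X i \<omega>" using monotone_onD[OF assms(3) that(2,1)] that(3) by simp
    then have "p j \<omega> \<le> p i \<omega>"
      unfolding request_rate_def using assms(2)
      by (intro divide_right_mono sum_nonneg weight_nonneg)
    then show ?thesis by simp
  qed
  then show "tail_share n y R * (\<Sum>i\<in>{1..n} - R. p i \<omega>) \<le> (\<Sum>i\<in>tail_ranks n y R. p i \<omega>)"
    using tail_rates_le[of R "- 1" \<omega> y] R by simp
qed (use assms random_subset_prob_hit_le_1 in auto)

lemma uniform_tail_mass_eq: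
  "uniform_tail_mass a y \<omega> = (\<Sum>R\<in>Pow {1..n}. tail_share n y R * (\<Sum>i\<in>{1..n} - R. joint_prob a \<omega> (R, i)))"
  by (simp add: uniform_tail_mass_def joint_prob_def sum_distrib_left mult_ac)

lemma uniform_tail_mass_integrable: "0 \<le> a \<Longrightarrow> integrable M (uniform_tail_mass a y)"
  unfolding uniform_tail_mass_eq[abs_def]
  by (intro Bochner_Integration.integrable_sum integrable_mult_right joint_prob_integrable) auto

text \<open>The inequality \<open>\<bar>x\<bar> \<le> \<epsilon> + x\<^sup>2 / \<epsilon>\<close> turns the mean square bound \<open>deviation_bound\<close> into the mean
  absolute one that \<open>tail_share_bound\<close> asks for.\<close>

lemma uniform_tail_mass_near:
  assumes "n \<ge> 1" "0 \<le> a" "\<omega> \<in> space M" "0 \<le> y" "0 < f" "f \<le> 1" "real (n - nat \<lfloor>y\<rfloor>) / n \<le> f" "\<epsilon> > 0"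
  shows "\<bar>uniform_tail_mass a y \<omega> - real (n - nat \<lfloor>y\<rfloor>) / n / f * miss_rate a \<omega>\<bar>
     \<le> (\<epsilon> + deviation a f \<omega> / \<epsilon>) / f"
proof -
  let ?q = "hit_set_prob a \<omega>"
  let ?\<kappa> = "real (n - nat \<lfloor>y\<rfloor>) / n / f"
  let ?d = "\<lambda>R. real (card R) / n - (1 - f)"
  have q: "0 \<le> ?q R" if "R \<in> Pow {1..n}" for R
    using that assms(2,3) by (intro random_subset_prob_hit_le_1) auto
  have "uniform_tail_mass a y \<omega> - ?\<kappa> * miss_rate a \<omega> =
      (\<Sum>R\<in>Pow {1..n}. ?q R * ((tail_share n y R - ?\<kappa>) * (\<Sum>i\<in>{1..n} - R. p i \<omega>)))"
    unfolding pair_mass_complement[symmetric] pair_mass_def uniform_tail_mass_def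
    by (simp add: sum_distrib_left sum_subtractf algebra_simps)
  also have "\<bar>\<dots>\<bar> \<le> (\<Sum>R\<in>Pow {1..n}. ?q R * ((\<epsilon> + (?d R)\<^sup>2 / \<epsilon>) / f))"
  proof (intro order_trans[OF sum_abs] sum_mono)
    fix R assume R: "R \<in> Pow {1..n}"
    have "\<bar>tail_share n y R - ?\<kappa>\<bar> \<le> \<bar>?d R\<bar> / f"
      using R assms by (intro tail_share_bound) auto
    also have "\<bar>?d R\<bar> \<le> \<epsilon> + (?d R)\<^sup>2 / \<epsilon>"
    proof (cases "\<bar>?d R\<bar> \<le> \<epsilon>")
      case False
      then have "\<epsilon> * \<bar>?d R\<bar> \<le> \<bar>?d R\<bar> * \<bar>?d R\<bar>" by (intro mult_right_mono) auto
      then have "\<bar>?d R\<bar> \<le> (?d R)\<^sup>2 / \<epsilon>" using assms(8) by (simp add: field_simps power2_eq_square)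
      then show ?thesis using assms(8) by simp
    qed (use assms(8) in \<open>simp add: add_increasing2\<close>)
    finally have "\<bar>tail_share n y R - ?\<kappa>\<bar> \<le> (\<epsilon> + (?d R)\<^sup>2 / \<epsilon>) / f"
      using assms(5) by (simp add: divide_right_mono)
    moreover have "0 \<le> (\<Sum>i\<in>{1..n} - R. p i \<omega>)" "(\<Sum>i\<in>{1..n} - R. p i \<omega>) \<le> 1"
      using sum_rate_subset_le_1[of "{1..n} - R" \<omega>] assms(3) by auto
    ultimately have "\<bar>tail_share n y R - ?\<kappa>\<bar> * \<bar>\<Sum>i\<in>{1..n} - R. p i \<omega>\<bar> \<le> (\<epsilon> + (?d R)\<^sup>2 / \<epsilon>) / f * 1"
      by (intro mult_mono) auto
    then show "\<bar>?q R * ((tail_share n y R - ?\<kappa>) * (\<Sum>i\<in>{1..n} - R. p i \<omega>))\<bar>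
        \<le> ?q R * ((\<epsilon> + (?d R)\<^sup>2 / \<epsilon>) / f)"
      unfolding abs_mult abs_of_nonneg[OF q[OF R]]
      by (intro mult_left_mono[OF _ q[OF R]]) (simp only: mult_1_right)
  qed
  also have "\<dots> = (\<epsilon> * (\<Sum>R\<in>Pow {1..n}. ?q R) + (\<Sum>R\<in>Pow {1..n}. ?q R * (?d R)\<^sup>2) / \<epsilon>) / f"
  proof -
    have "?q R * ((\<epsilon> + (?d R)\<^sup>2 / \<epsilon>) / f) = (\<epsilon> * ?q R + ?q R * (?d R)\<^sup>2 / \<epsilon>) / f" for R
      by (simp add: distrib_left mult.commute)
    then show ?thesis
      by (simp only: sum_divide_distrib[symmetric] sum.distrib sum_distrib_left[symmetric])
  qed
  also have "\<dots> \<le> (\<epsilon> + deviation a f \<omega> / \<epsilon>) / f"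
    using deviation_bound[OF assms(1,2) _ assms(6,3)] assms(5,8)
    by (simp add: sum_random_subset_prob divide_right_mono)
  finally show ?thesis .
qed

text \<open>The transposition of \<open>i\<close> and \<open>j\<close> fixes \<open>R\<close> pointwise and permutes its complement, so it carries one
  integrand into the other, while exchangeability preserves the law of the weights.\<close>

lemma exchangeable_joint_prob:
  assumes ex: "exchangeable_weights n X" and R: "R \<subseteq> {1..n}" and ij: "i \<in> {1..n} - R" "j \<in> {1..n} - R"
  shows "(\<integral>\<omega>. joint_prob a \<omega> (R, i) \<partial>M) = (\<integral>\<omega>. joint_prob a \<omega> (R, j) \<partial>M)"
proof -
  let ?I = "{1..n}" and ?PM = "\<Pi>\<^sub>M i\<in>{1..n}. borel :: real measure"
  define \<sigma> where "\<sigma> = Transposition.transpose i j"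
  have \<sigma>: "\<sigma> permutes ?I" unfolding \<sigma>_def using ij by (intro permutes_swap_id) auto
  have \<sigma>_L: "\<sigma> permutes ?I - R" unfolding \<sigma>_def using ij by (intro permutes_swap_id) auto
  have \<sigma>_R: "\<sigma> k = k" if "k \<in> R" for k unfolding \<sigma>_def using ij that by (auto simp: Transposition.transpose_def)
  define r where "r v k = v k / (\<Sum>l\<in>?I. v l)" for v :: "nat \<Rightarrow> real" and k
  define \<Phi> where "\<Phi> v = random_subset_prob ?I (\<lambda>k. 1 - exp (- (r v k * a))) R * r v i" for v
  have r_meas: "(\<lambda>v. r v k) \<in> borel_measurable ?PM" if "k \<in> ?I" for k
    unfolding r_def using that
    by (intro borel_measurable_divide borel_measurable_sum measurable_component_singleton) auto
  have \<Phi>_meas: "\<Phi> \<in> borel_measurable ?PM"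
    unfolding \<Phi>_def[abs_def] random_subset_prob_def using R ij
    by (intro borel_measurable_times borel_measurable_prod borel_measurable_diff borel_measurable_const
        borel_measurable_exp[THEN measurable_compose[rotated]] borel_measurable_uminus r_meas) auto
  have vec: "(\<lambda>\<omega>. \<lambda>k\<in>?I. weight X (s k) \<omega>) \<in> measurable M ?PM" if "s permutes ?I" for s
    using that permutes_in_image[OF that] by (intro measurable_restrict weight_measurable) auto
  have "(\<integral>\<omega>. \<Phi> (\<lambda>k\<in>?I. weight X (\<sigma> k) \<omega>) \<partial>M) = (\<integral>v. \<Phi> v \<partial>distr M ?PM (\<lambda>\<omega>. \<lambda>k\<in>?I. weight X (\<sigma> k) \<omega>))"
    by (intro integral_distr[symmetric] vec \<sigma> \<Phi>_meas)
  also have "\<dots> = (\<integral>v. \<Phi> v \<partial>distr M ?PM (\<lambda>\<omega>. \<lambda>k\<in>?I. weight X (id k) \<omega>))"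
    using ex \<sigma> unfolding exchangeable_weights_def weight_vector_def[abs_def] by simp
  also have "\<dots> = (\<integral>\<omega>. \<Phi> (\<lambda>k\<in>?I. weight X (id k) \<omega>) \<partial>M)"
    by (intro integral_distr vec permutes_id \<Phi>_meas)
  finally have "(\<integral>\<omega>. \<Phi> (\<lambda>k\<in>?I. weight X (\<sigma> k) \<omega>) \<partial>M) = (\<integral>\<omega>. \<Phi> (\<lambda>k\<in>?I. weight X (id k) \<omega>) \<partial>M)" .
  moreover have "\<Phi> (\<lambda>k\<in>?I. weight X (s k) \<omega>) = joint_prob a \<omega> (R, s i)"
    if s: "s permutes ?I" "s permutes ?I - R" "\<And>k. k \<in> R \<Longrightarrow> s k = k" for s \<omega>
  proof -
    have "(\<Sum>l\<in>?I. weight X (s l) \<omega>) = (\<Sum>l\<in>?I. weight X l \<omega>)"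
      using sum.permute[OF s(1), of "\<lambda>l. weight X l \<omega>"] by (simp add: o_def)
    then have r: "r (\<lambda>k\<in>?I. weight X (s k) \<omega>) k = p (s k) \<omega>" if "k \<in> ?I" for k
      using that by (simp add: r_def request_rate_def)
    have "random_subset_prob ?I (\<lambda>k. 1 - exp (- (r (\<lambda>k\<in>?I. weight X (s k) \<omega>) k * a))) R =
        (\<Prod>k\<in>R. hit_prob a \<omega> (s k)) * (\<Prod>k\<in>?I - R. 1 - hit_prob a \<omega> (s k))"
      unfolding random_subset_prob_def hit_prob_def using R
      by (intro arg_cong2[where f = "(*)"] prod.cong refl) (auto simp: r simp del: One_nat_def)
    also have "(\<Prod>k\<in>R. hit_prob a \<omega> (s k)) = (\<Prod>k\<in>R. hit_prob a \<omega> k)"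
      by (intro prod.cong refl) (simp add: s(3))
    also have "(\<Prod>k\<in>?I - R. 1 - hit_prob a \<omega> (s k)) = (\<Prod>k\<in>?I - R. 1 - hit_prob a \<omega> k)"
      using prod.permute[OF s(2), of "\<lambda>k. 1 - hit_prob a \<omega> k"] by (simp add: o_def)
    also have "(\<Prod>k\<in>R. hit_prob a \<omega> k) * (\<Prod>k\<in>?I - R. 1 - hit_prob a \<omega> k) =
        random_subset_prob ?I (hit_prob a \<omega>) R"
      by (simp only: random_subset_prob_def)
    finally show ?thesis
      using r[of i] ij unfolding \<Phi>_def joint_prob_def by (simp only: fst_conv snd_conv Diff_iff)
  qed
  note this[OF \<sigma> \<sigma>_L \<sigma>_R] this[of id, OF permutes_id permutes_id]
  ultimately show ?thesis by (simp add: \<sigma>_def)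
qed

lemma exchangeable_tail_ranks:
  assumes "exchangeable_weights n X" "0 \<le> a"
  shows "expectation (pair_mass a (tail_ranks n y)) = expectation (uniform_tail_mass a y)"
proof -
  let ?e = "\<lambda>R i. \<integral>\<omega>. joint_prob a \<omega> (R, i) \<partial>M"
  have int: "integrable M (\<lambda>\<omega>. joint_prob a \<omega> (R, i))" if "R \<in> Pow {1..n}" "i \<in> {1..n}" for R i
    using that assms(2) by (intro joint_prob_integrable) auto
  have tail: "i \<in> {1..n}" if "i \<in> tail_ranks n y R" for i R
    using that tail_ranks_subset by blast
  have "expectation (pair_mass a (tail_ranks n y)) =
      (\<integral>\<omega>. (\<Sum>R\<in>Pow {1..n}. \<Sum>i\<in>tail_ranks n y R. joint_prob a \<omega> (R, i)) \<partial>M)"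
    by (simp add: pair_mass_def[abs_def] joint_prob_def sum_distrib_left)
  also have "\<dots> = (\<Sum>R\<in>Pow {1..n}. \<integral>\<omega>. (\<Sum>i\<in>tail_ranks n y R. joint_prob a \<omega> (R, i)) \<partial>M)"
    by (intro Bochner_Integration.integral_sum Bochner_Integration.integrable_sum int tail)
  also have "\<dots> = (\<Sum>R\<in>Pow {1..n}. \<Sum>i\<in>tail_ranks n y R. ?e R i)"
    by (intro sum.cong refl Bochner_Integration.integral_sum int tail)
  also have "\<dots> = (\<Sum>R\<in>Pow {1..n}. tail_share n y R * (\<Sum>i\<in>{1..n} - R. ?e R i))"
  proof (intro sum.cong refl)
    fix R assume "R \<in> Pow {1..n}"
    then have R: "R \<subseteq> {1..n}" by simp
    show "(\<Sum>i\<in>tail_ranks n y R. ?e R i) = tail_share n y R * (\<Sum>i\<in>{1..n} - R. ?e R i)"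
    proof (cases "{1..n} - R = {}")
      case True
      then have "tail_ranks n y R = {}" using tail_ranks_subset[of n y R] by blast
      then show ?thesis by (simp only: True) simp
    next
      case False
      then obtain l where l: "l \<in> {1..n} - R" by blast
      have e: "?e R i = ?e R l" if "i \<in> {1..n} - R" for i
        by (rule exchangeable_joint_prob[OF assms(1) R that l])
      have "(\<Sum>i\<in>tail_ranks n y R. ?e R i) = (\<Sum>i\<in>tail_ranks n y R. ?e R l)"
        using tail_ranks_subset by (intro sum.cong refl e) blast
      moreover have "(\<Sum>i\<in>{1..n} - R. ?e R i) = (\<Sum>i\<in>{1..n} - R. ?e R l)"
        by (intro sum.cong refl e)
      moreover have "card ({1..n} - R) \<noteq> 0" using False by (simp only: card_eq_0_iff) simp
      moreover have "card R \<noteq> n" using False tail_share_mult(2)[OF R] by blast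
      ultimately show ?thesis by (simp only: tail_share_mult(1)[OF R] sum_constant if_False) simp
    qed
  qed
  also have "\<dots> = (\<Sum>R\<in>Pow {1..n}. \<integral>\<omega>. tail_share n y R * (\<Sum>i\<in>{1..n} - R. joint_prob a \<omega> (R, i)) \<partial>M)"
  proof (intro sum.cong refl)
    fix R assume R: "R \<in> Pow {1..n}"
    have "(\<integral>\<omega>. (\<Sum>i\<in>{1..n} - R. joint_prob a \<omega> (R, i)) \<partial>M) = (\<Sum>i\<in>{1..n} - R. ?e R i)"
      using R by (intro Bochner_Integration.integral_sum int) auto
    then show "tail_share n y R * (\<Sum>i\<in>{1..n} - R. ?e R i) =
        (\<integral>\<omega>. tail_share n y R * (\<Sum>i\<in>{1..n} - R. joint_prob a \<omega> (R, i)) \<partial>M)"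
      by (simp only: integral_mult_right_zero)
  qed
  also have "\<dots> = expectation (uniform_tail_mass a y)"
    unfolding uniform_tail_mass_eq
    by (intro Bochner_Integration.integral_sum[symmetric] integrable_mult_right
        Bochner_Integration.integrable_sum int) auto
  finally show ?thesis .
qed

end

section \<open>The law of large numbers for the request rates\<close>

lemma mult_exp_minus_le:
  fixes y :: real
  assumes "0 \<le> y" "0 < c"
  shows "y * exp (- (y / c)) \<le> c"
proof -
  have "y / c \<le> exp (y / c)" using exp_ge_add_one_self[of "y / c"] by linarith
  then have "(y / c) * exp (- (y / c)) \<le> exp (y / c) * exp (- (y / c))"
    by (intro mult_right_mono) auto
  then show ?thesis using assms(2) by (simp add: mult_exp_exp field_simps)
qed

lemma exp_minus_diff_le:
  fixes u v :: real
  assumes "l \<le> u" "l \<le> v"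
  shows "\<bar>exp (- u) - exp (- v)\<bar> \<le> exp (- l) * \<bar>u - v\<bar>"
proof -
  have *: "\<bar>exp (- u) - exp (- v)\<bar> \<le> exp (- l) * \<bar>u - v\<bar>" if "l \<le> u" "u \<le> v" for u v :: real
  proof -
    have "exp (- v) \<le> exp (- u)" using that by simp
    then have "\<bar>exp (- u) - exp (- v)\<bar> = exp (- u) * (1 - exp (- (v - u)))"
      by (simp add: right_diff_distrib mult_exp_exp)
    also have "\<dots> \<le> exp (- l) * (v - u)"
      using that one_minus_exp_bounds(2)[of "v - u"] by (intro mult_mono) auto
    finally show ?thesis using that by simp
  qed
  show ?thesis
    using *[of u v] *[of v u] assms by (cases "u \<le> v") (auto simp: abs_minus_commute)
qed

lemma exp_minus_scale_diff:
  fixes y s :: real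
  assumes "0 \<le> y" "1 / 2 \<le> s"
  shows "\<bar>exp (- (y * s)) - exp (- y)\<bar> \<le> y * exp (- (y / 2)) * \<bar>s - 1\<bar>"
proof -
  have "y / 2 \<le> y * s" "y / 2 \<le> y" using mult_left_mono[OF assms(2,1)] assms(1) by auto
  then have "\<bar>exp (- (y * s)) - exp (- y)\<bar> \<le> exp (- (y / 2)) * \<bar>y * s - y\<bar>"
    by (rule exp_minus_diff_le)
  also have "y * s - y = y * (s - 1)" by (simp add: algebra_simps)
  finally show ?thesis using assms(1) by (simp add: abs_mult mult_ac)
qed

lemma exp_minus_log_lipschitz:
  fixes y s :: real
  assumes "0 \<le> y" "1 / 2 \<le> s"
  shows "\<bar>exp (- (y * s)) - exp (- y)\<bar> \<le> 18 * \<bar>s - 1\<bar>"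
proof -
  have "y * exp (- (y / 2)) * \<bar>s - 1\<bar> \<le> 18 * \<bar>s - 1\<bar>"
    using mult_exp_minus_le[of y 2] assms(1) by (intro mult_right_mono) auto
  then show ?thesis using exp_minus_scale_diff[OF assms] by linarith
qed

lemma mult_exp_minus_log_lipschitz:
  fixes y s :: real
  assumes "0 \<le> y" "1 / 2 \<le> s"
  shows "\<bar>y * s * exp (- (y * s)) - y * exp (- y)\<bar> \<le> 18 * \<bar>s - 1\<bar>"
proof -
  have "y / 2 \<le> y * s" using mult_left_mono[OF assms(2,1)] by auto
  then have "y * exp (- (y * s)) \<le> y * exp (- (y / 2))"
    using assms(1) by (intro mult_left_mono) auto
  also have "\<dots> \<le> 2" using mult_exp_minus_le[of y 2] assms(1) by simp
  finally have 1: "y * exp (- (y * s)) \<le> 2" .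
  have "y * exp (- (y / 4)) \<le> 4" using mult_exp_minus_le[of y 4] assms(1) by simp
  then have "(y * exp (- (y / 4))) * (y * exp (- (y / 4))) \<le> 4 * 4"
    using assms(1) by (intro mult_mono) auto
  also have "(y * exp (- (y / 4))) * (y * exp (- (y / 4))) = y * (y * (exp (- (y / 4)) * exp (- (y / 4))))"
    by (simp only: mult_ac)
  also have "exp (- (y / 4)) * exp (- (y / 4)) = exp (- (y / 2))" by (simp add: mult_exp_exp)
  finally have 2: "y * (y * exp (- (y / 2))) \<le> 16" by simp
  have "y * s * exp (- (y * s)) - y * exp (- y) =
      (s - 1) * (y * exp (- (y * s))) + y * (exp (- (y * s)) - exp (- y))"
    by (simp add: algebra_simps)
  also have "\<bar>\<dots>\<bar> \<le> \<bar>s - 1\<bar> * (y * exp (- (y * s))) + y * \<bar>exp (- (y * s)) - exp (- y)\<bar>"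
    using assms(1) by (intro order_trans[OF abs_triangle_ineq]) (simp add: abs_mult)
  also have "\<dots> \<le> \<bar>s - 1\<bar> * 2 + y * (y * exp (- (y / 2)) * \<bar>s - 1\<bar>)"
    using 1 exp_minus_scale_diff[OF assms] assms(1) by (intro add_mono mult_left_mono) auto
  also have "y * (y * exp (- (y / 2)) * \<bar>s - 1\<bar>) \<le> 16 * \<bar>s - 1\<bar>"
    using mult_right_mono[OF 2, of "\<bar>s - 1\<bar>"] by (simp add: mult_ac)
  finally show ?thesis by simp
qed


text \<open>Test functions that tolerate a relative change of the argument. The law of large numbers concerns
  the scaled weights \<open>Z\<^sub>n w\<^sub>i\<close>, whereas the rates are normalised by the actual sum of the weights, so
  they differ by the factor \<open>\<mu>\<close> over the empirical mean, which is close to 1. The constant 18 serves both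
  functions used below.\<close>

definition log_lipschitz :: "(real \<Rightarrow> real) \<Rightarrow> bool" where
  "log_lipschitz h \<longleftrightarrow> continuous_on UNIV h \<and> (\<forall>y\<ge>0. \<bar>h y\<bar> \<le> 1) \<and>
     (\<forall>y\<ge>0. \<forall>s\<ge>1/2. \<bar>h (y * s) - h y\<bar> \<le> 18 * \<bar>s - 1\<bar>)"

lemma log_lipschitzD:
  assumes "log_lipschitz h"
  shows "continuous_on UNIV h" "h \<in> borel_measurable borel" "0 \<le> y \<Longrightarrow> \<bar>h y\<bar> \<le> 1"
    "0 \<le> y \<Longrightarrow> 1 / 2 \<le> s \<Longrightarrow> \<bar>h (y * s) - h y\<bar> \<le> 18 * \<bar>s - 1\<bar>"
proof -
  show "continuous_on UNIV h" using assms unfolding log_lipschitz_def by blast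
  then show "h \<in> borel_measurable borel" by (rule borel_measurable_continuous_onI)
qed (use assms in \<open>unfold log_lipschitz_def, blast+\<close>)

lemma log_lipschitz_exp: "log_lipschitz (\<lambda>y. exp (- y))"
  unfolding log_lipschitz_def using exp_minus_log_lipschitz by (auto intro!: continuous_intros)

lemma log_lipschitz_mult_exp: "log_lipschitz (\<lambda>y. y * exp (- y))"
  unfolding log_lipschitz_def using mult_exp_minus_log_lipschitz mult_exp_minus_le[of _ 1]
  by (auto intro!: continuous_intros simp: abs_mult)

text \<open>If \<open>m\<close> is close to \<open>\<mu>\<close>, then \<open>\<mu> / m \<ge> 1/2\<close> and the Lipschitz condition applies; otherwise the
  difference is at most 2 and the right-hand side at least 2.\<close>

lemma log_lipschitz_perturb:
  assumes h: "log_lipschitz h" and \<mu>: "0 < \<mu>" and m: "0 \<le> m" and x: "0 \<le> x"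
  shows "\<bar>h (x * (\<mu> / m)) - h x\<bar> \<le> (40 / \<mu> + 2) * min 1 \<bar>m - \<mu>\<bar>"
proof (cases "\<bar>m - \<mu>\<bar> \<le> \<mu> / 2 \<and> \<bar>m - \<mu>\<bar> \<le> 1")
  case True
  then have "\<mu> / 2 \<le> m" "m \<le> 2 * \<mu>" using \<mu> by linarith+
  then have m: "0 < m" "1 / 2 \<le> \<mu> / m" using \<mu> by (auto simp: field_simps)
  have "\<bar>h (x * (\<mu> / m)) - h x\<bar> \<le> 18 * \<bar>\<mu> / m - 1\<bar>"
    using h x m(2) unfolding log_lipschitz_def by blast
  also have "\<mu> / m - 1 = (\<mu> - m) / m" using m by (simp add: diff_divide_distrib)
  also have "\<bar>(\<mu> - m) / m\<bar> = \<bar>m - \<mu>\<bar> / m" using m by (simp add: abs_minus_commute)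
  also have "\<bar>m - \<mu>\<bar> / m \<le> \<bar>m - \<mu>\<bar> / (\<mu> / 2)"
    using \<open>\<mu> / 2 \<le> m\<close> \<mu> m by (intro divide_left_mono) auto
  also have "18 * (\<bar>m - \<mu>\<bar> / (\<mu> / 2)) = (36 / \<mu>) * \<bar>m - \<mu>\<bar>" by simp
  also have "\<dots> \<le> (40 / \<mu> + 2) * \<bar>m - \<mu>\<bar>"
  proof (rule mult_right_mono)
    have "36 / \<mu> \<le> 40 / \<mu>" using \<mu> by (intro divide_right_mono) auto
    then show "36 / \<mu> \<le> 40 / \<mu> + 2" by linarith
  qed simp
  also have "\<bar>m - \<mu>\<bar> = min 1 \<bar>m - \<mu>\<bar>" using True by simp
  finally show ?thesis by simp
next
  case False
  have "0 \<le> x * (\<mu> / m)" using x \<mu> m by simp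
  then have "\<bar>h (x * (\<mu> / m))\<bar> \<le> 1" "\<bar>h x\<bar> \<le> 1" using h x unfolding log_lipschitz_def by blast+
  then have "\<bar>h (x * (\<mu> / m)) - h x\<bar> \<le> 2" by linarith
  also have "2 \<le> (40 / \<mu> + 2) * min 1 \<bar>m - \<mu>\<bar>"
  proof (cases "\<bar>m - \<mu>\<bar> \<le> 1")
    case True
    then have "\<mu> / 2 \<le> \<bar>m - \<mu>\<bar>" using False by simp
    then have "(40 / \<mu>) * (\<mu> / 2) \<le> (40 / \<mu>) * \<bar>m - \<mu>\<bar>" using \<mu> by (intro mult_left_mono) auto
    also have "\<dots> \<le> (40 / \<mu> + 2) * \<bar>m - \<mu>\<bar>" by (intro mult_right_mono) auto
    finally show ?thesis using \<mu> True by simp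
  next
    case False
    then show ?thesis using \<mu> by simp
  qed
  finally show ?thesis .
qed


text \<open>The functional to which the convergence in law of the empirical measures is applied.\<close>

lemma weak_topology_integral_distance:
  fixes h :: "real \<Rightarrow> real"
  assumes "continuous_on UNIV h" "\<And>x. \<bar>h x\<bar> \<le> 1" "P \<in> nonneg_laws"
  defines "\<Phi> \<equiv> \<lambda>\<nu>. \<bar>(\<integral>x. h x \<partial>\<nu>) - (\<integral>x. h x \<partial>P)\<bar>"
  shows "continuous_map weak_topology euclideanreal \<Phi>" "bounded (\<Phi> ` topspace weak_topology)"
proof -
  have "h \<in> bcontfun"
    using assms(1,2) by (auto simp: bcontfun_def intro!: boundedI[where B = 1])
  then have h: "apply_bcontfun (Bcontfun h) = h" by (simp add: Bcontfun_inverse)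
  let ?\<Psi> = "\<lambda>(F :: (real \<Rightarrow>\<^sub>C real) \<Rightarrow> real). \<bar>F (Bcontfun h) - (\<integral>x. h x \<partial>P)\<bar>"
  have "continuous_map euclidean euclideanreal ?\<Psi>"
    by (simp add: continuous_map_iff_continuous2)
       (intro continuous_intros continuous_on_product_coordinates)
  then have "continuous_map weak_topology euclideanreal
      (?\<Psi> \<circ> (\<lambda>\<nu> (f :: real \<Rightarrow>\<^sub>C real). \<integral>x. apply_bcontfun f x \<partial>\<nu>))"
    unfolding weak_topology_def by (rule continuous_map_pullback)
  then show "continuous_map weak_topology euclideanreal \<Phi>"
    unfolding \<Phi>_def by (simp add: o_def h)
  have sub: "topspace weak_topology \<subseteq> nonneg_laws"
    by (simp add: weak_topology_def topspace_pullback_topology)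
  have int_le: "\<bar>\<integral>x. h x \<partial>\<nu>\<bar> \<le> 1" if "\<nu> \<in> nonneg_laws" for \<nu>
  proof -
    interpret real_distribution \<nu> using that by (simp add: nonneg_laws_def)
    have "h \<in> borel_measurable \<nu>"
      by (rule measurable_finite_borel[OF borel_measurable_continuous_onI[OF assms(1)]])
    then have int: "integrable \<nu> h"
      using assms(2) by (intro integrable_const_bound[where B = 1]) auto
    have "\<bar>\<integral>x. h x \<partial>\<nu>\<bar> \<le> (\<integral>x. \<bar>h x\<bar> \<partial>\<nu>)" by (rule integral_abs_bound)
    also have "\<dots> \<le> (\<integral>x. 1 \<partial>\<nu>)" using int assms(2) by (intro integral_mono) auto
    finally have "\<bar>\<integral>x. h x \<partial>\<nu>\<bar> \<le> prob (space \<nu>)" by simp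
    then show ?thesis by (simp only: prob_space)
  qed
  have "\<bar>\<Phi> \<nu>\<bar> \<le> 2" if "\<nu> \<in> topspace weak_topology" for \<nu>
  proof -
    have "\<bar>\<integral>x. h x \<partial>\<nu>\<bar> \<le> 1" "\<bar>\<integral>x. h x \<partial>P\<bar> \<le> 1"
      using sub int_le that assms(3) by blast+
    then show ?thesis unfolding \<Phi>_def by linarith
  qed
  then show "bounded (\<Phi> ` topspace weak_topology)"
    by (auto intro!: boundedI[where B = 2])
qed

lemma integral_empirical_law:
  assumes "n \<ge> 1" "h \<in> borel_measurable borel"
  shows "(\<integral>x. h x \<partial>empirical_law n X Z \<omega>) = (\<Sum>i = 1..n. h (Z \<omega> * weight X i \<omega>)) / real n"
  unfolding empirical_law_def using assms
  by (subst integral_distr) (auto simp: integral_uniform_count_measure measurable_def space_uniform_count_measure sets_uniform_count_measure)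

locale lln_sequence =
  fixes P :: "real measure" and X :: "nat \<Rightarrow> 'a mtf"
  assumes P_law: "P \<in> nonneg_laws" and P_mean: "integrable P (\<lambda>x. x)" "(\<integral>x. x \<partial>P) \<noteq> 0"
    and chain: "\<And>n. n \<ge> 1 \<Longrightarrow> mtf_chain n (X n)" and lln: "LLN P X"
begin

abbreviation "\<mu> \<equiv> \<integral>x. x \<partial>P"

lemma model: "n \<ge> 1 \<Longrightarrow> mtf_model n (X n)"
  using chain by (simp add: mtf_model_def)

lemma mean_pos: "0 < \<mu>"
proof -
  have "0 \<le> \<mu>" using P_law by (intro integral_nonneg_AE) (simp add: nonneg_laws_def)
  then show ?thesis using P_mean(2) by simp
qed

text \<open>A choice of the normalising variables \<open>Z\<^sub>n\<close>.\<close>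

definition scaling :: "nat \<Rightarrow> 'a \<Rightarrow> real" where
  "scaling = (SOME Z. (\<forall>n\<ge>1. Z n \<in> borel_measurable (sample (X n)) \<and> (\<forall>\<omega>\<in>space (sample (X n)). 0 < Z n \<omega>)) \<and>
        converges_in_law_to_point weak_topology
          (\<lambda>n. sample (X n)) (\<lambda>n. empirical_law n (X n) (Z n)) P \<and>
        weak_conv_m (\<lambda>n. distr (sample (X n)) borel (empirical_mean n (X n) (Z n)))
          (return borel (\<integral>x. x \<partial>P)))"

lemma scaling:
  "n \<ge> 1 \<Longrightarrow> scaling n \<in> borel_measurable (sample (X n))"
  "n \<ge> 1 \<Longrightarrow> \<omega> \<in> space (sample (X n)) \<Longrightarrow> 0 < scaling n \<omega>"
  "converges_in_law_to_point weak_topology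
     (\<lambda>n. sample (X n)) (\<lambda>n. empirical_law n (X n) (scaling n)) P"
  "weak_conv_m (\<lambda>n. distr (sample (X n)) borel (empirical_mean n (X n) (scaling n))) (return borel \<mu>)"
  using someI_ex[OF lln[unfolded LLN_def], folded scaling_def] by blast+

abbreviation "scaled_weight n i \<omega> \<equiv> scaling n \<omega> * weight (X n) i \<omega>"
abbreviation "scaled_mean n \<equiv> empirical_mean n (X n) (scaling n)"

lemma scaled_weight_measurable:
  "n \<ge> 1 \<Longrightarrow> i \<in> {1..n} \<Longrightarrow> scaled_weight n i \<in> borel_measurable (sample (X n))"
  by (intro borel_measurable_times scaling(1) mtf_model.weight_measurable[OF model])

lemma scaled_weight_nonneg:
  "n \<ge> 1 \<Longrightarrow> i \<in> {1..n} \<Longrightarrow> \<omega> \<in> space (sample (X n)) \<Longrightarrow> 0 \<le> scaled_weight n i \<omega>"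
  by (intro mult_nonneg_nonneg less_imp_le[OF scaling(2)] mtf_model.weight_nonneg[OF model])

lemma scaled_mean_measurable: "n \<ge> 1 \<Longrightarrow> scaled_mean n \<in> borel_measurable (sample (X n))"
  unfolding empirical_mean_def[abs_def]
  by (intro borel_measurable_divide borel_measurable_sum borel_measurable_const scaled_weight_measurable)

lemma scaled_mean_nonneg: "n \<ge> 1 \<Longrightarrow> \<omega> \<in> space (sample (X n)) \<Longrightarrow> 0 \<le> scaled_mean n \<omega>"
  unfolding empirical_mean_def by (intro divide_nonneg_nonneg sum_nonneg scaled_weight_nonneg) auto

text \<open>If all weights vanish, both sides are 0 because \<open>x / 0 = 0\<close>.\<close>

lemma rate_eq_scaled:
  assumes "n \<ge> 1" "\<omega> \<in> space (sample (X n))"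
  shows "request_rate n (X n) i \<omega> * (real n * \<mu> * a) = a * scaled_weight n i \<omega> * (\<mu> / scaled_mean n \<omega>)"
proof -
  have "scaled_mean n \<omega> = scaling n \<omega> * (\<Sum>j = 1..n. weight (X n) j \<omega>) / n"
    by (simp add: empirical_mean_def sum_distrib_left)
  then show ?thesis
    using scaling(2)[OF assms] assms(1) by (simp add: request_rate_def)
qed

lemma scaled_mean_tendsto:
  "(\<lambda>n. \<integral>\<omega>. min 1 \<bar>scaled_mean n \<omega> - \<mu>\<bar> \<partial>sample (X n)) \<longlonglongrightarrow> 0"
proof -
  \<comment> \<open>the hypotheses concern \<open>n \<ge> 1\<close> only, so the index is shifted\<close>
  let ?D = "\<lambda>n. distr (sample (X (Suc n))) borel (scaled_mean (Suc n))"
  let ?f = "\<lambda>x :: real. min 1 \<bar>x - \<mu>\<bar>"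
  have meas: "scaled_mean (Suc n) \<in> borel_measurable (sample (X (Suc n)))" for n
    by (rule scaled_mean_measurable) simp
  have "real_distribution (?D n)" for n
    by (intro prob_space.real_distribution_distr[OF _ meas])
       (use chain[of "Suc n"] in \<open>simp add: mtf_chain_def\<close>)
  moreover have "real_distribution (return borel \<mu>)"
    by (simp add: real_distribution_def real_distribution_axioms_def prob_space_return)
  moreover have "weak_conv_m ?D (return borel \<mu>)"
    using scaling(4) unfolding weak_conv_m_def weak_conv_def by (auto intro: LIMSEQ_Suc)
  ultimately have "(\<lambda>n. integral\<^sup>L (?D n) ?f) \<longlonglongrightarrow> integral\<^sup>L (return borel \<mu>) ?f"
    by (intro weak_conv_imp_integral_bdd_continuous_conv[where B = 1]) (auto intro!: continuous_intros)
  also have "integral\<^sup>L (return borel \<mu>) ?f = 0" by (simp add: integral_return)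
  also have "(\<lambda>n. integral\<^sup>L (?D n) ?f) = (\<lambda>n. \<integral>\<omega>. ?f (scaled_mean (Suc n) \<omega>) \<partial>sample (X (Suc n)))"
    by (intro ext integral_distr meas) simp
  finally show ?thesis by (rule LIMSEQ_imp_Suc)
qed

lemma empirical_integral_tendsto:
  assumes h: "log_lipschitz h" and a: "0 \<le> a"
  shows "(\<lambda>n. \<integral>\<omega>. \<bar>(\<Sum>i = 1..n. h (a * scaled_weight n i \<omega>)) / n - (\<integral>x. h (a * x) \<partial>P)\<bar> \<partial>sample (X n)) \<longlonglongrightarrow> 0"
proof -
  let ?h = "\<lambda>x. h (a * max 0 x)"
  let ?E = "\<lambda>n. \<integral>\<omega>. \<bar>(\<integral>x. ?h x \<partial>empirical_law n (X n) (scaling n) \<omega>) - (\<integral>x. ?h x \<partial>P)\<bar> \<partial>sample (X n)"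
  have cont: "continuous_on UNIV ?h"
    by (rule continuous_on_compose2[OF log_lipschitzD(1)[OF h]]) (auto intro!: continuous_intros)
  have h1: "\<bar>?h x\<bar> \<le> 1" for x using a by (intro log_lipschitzD(3)[OF h]) simp
  have P: "(\<integral>x. ?h x \<partial>P) = (\<integral>x. h (a * x) \<partial>P)"
  proof (rule integral_cong_AE)
    interpret real_distribution P using P_law by (simp add: nonneg_laws_def)
    have [measurable]: "h \<in> borel_measurable borel" by (rule log_lipschitzD(2)[OF h])
    show "(\<lambda>x. h (a * x)) \<in> borel_measurable P" "?h \<in> borel_measurable P"
      by simp_all
    have "AE x in P. 0 \<le> x" using P_law by (simp add: nonneg_laws_def)
    then show "AE x in P. ?h x = h (a * x)" by eventually_elim simp
  qed
  have "?E \<longlonglongrightarrow> \<bar>(\<integral>x. ?h x \<partial>P) - (\<integral>x. ?h x \<partial>P)\<bar>"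
    using scaling(3) weak_topology_integral_distance[OF cont h1 P_law]
    unfolding converges_in_law_to_point_def by blast
  then have lim: "?E \<longlonglongrightarrow> 0" by simp
  show ?thesis
  proof (rule Lim_transform_eventually[OF lim], rule eventually_sequentiallyI[of 1])
    fix n :: nat assume n: "1 \<le> n"
    show "?E n =
        (\<integral>\<omega>. \<bar>(\<Sum>i = 1..n. h (a * scaled_weight n i \<omega>)) / n - (\<integral>x. h (a * x) \<partial>P)\<bar> \<partial>sample (X n))"
    proof (rule Bochner_Integration.integral_cong[OF refl])
      fix \<omega> assume \<omega>: "\<omega> \<in> space (sample (X n))"
      have "(\<integral>x. ?h x \<partial>empirical_law n (X n) (scaling n) \<omega>) = (\<Sum>i = 1..n. ?h (scaled_weight n i \<omega>)) / n"
        using n cont by (intro integral_empirical_law borel_measurable_continuous_onI)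
      also have "(\<Sum>i = 1..n. ?h (scaled_weight n i \<omega>)) = (\<Sum>i = 1..n. h (a * scaled_weight n i \<omega>))"
        using scaled_weight_nonneg[OF n _ \<omega>] by (intro sum.cong refl) (simp add: max_absorb2)
      finally show "\<bar>(\<integral>x. ?h x \<partial>empirical_law n (X n) (scaling n) \<omega>) - (\<integral>x. ?h x \<partial>P)\<bar> =
        \<bar>(\<Sum>i = 1..n. h (a * scaled_weight n i \<omega>)) / n - (\<integral>x. h (a * x) \<partial>P)\<bar>"
        unfolding P by simp
    qed
  qed
qed

text \<open>The averages over the rates and over the scaled weights differ by at most a multiple of the distance
  of the empirical mean from \<open>\<mu>\<close>, truncated at 1, by \<open>log_lipschitz_perturb\<close>.\<close>

lemma rate_average_tendsto:
  assumes h: "log_lipschitz h" and a: "0 \<le> a"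
  shows "(\<lambda>n. \<integral>\<omega>. \<bar>(\<Sum>i = 1..n. h (request_rate n (X n) i \<omega> * (real n * \<mu> * a))) / n - (\<integral>x. h (a * x) \<partial>P)\<bar>
     \<partial>sample (X n)) \<longlonglongrightarrow> 0"
proof (rule tendsto_sandwich[OF _ _ tendsto_const])
  let ?c = "\<integral>x. h (a * x) \<partial>P" and ?C = "40 / \<mu> + 2"
  let ?L = "\<lambda>n. \<integral>\<omega>. \<bar>(\<Sum>i = 1..n. h (request_rate n (X n) i \<omega> * (real n * \<mu> * a))) / n - ?c\<bar> \<partial>sample (X n)"
  let ?g = "\<lambda>n. \<integral>\<omega>. \<bar>(\<Sum>i = 1..n. h (a * scaled_weight n i \<omega>)) / n - ?c\<bar> \<partial>sample (X n)"
  let ?m = "\<lambda>n. \<integral>\<omega>. min 1 \<bar>scaled_mean n \<omega> - \<mu>\<bar> \<partial>sample (X n)"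
  have "(\<lambda>n. ?g n + ?C * ?m n) \<longlonglongrightarrow> 0 + ?C * 0"
    by (intro tendsto_intros empirical_integral_tendsto[OF h a] scaled_mean_tendsto)
  then show "(\<lambda>n. ?g n + ?C * ?m n) \<longlonglongrightarrow> 0" by simp
  show "\<forall>\<^sub>F n in sequentially. 0 \<le> ?L n"
    by (intro always_eventually allI integral_nonneg_AE AE_I2) simp
  show "\<forall>\<^sub>F n in sequentially. ?L n
      \<le> ?g n + ?C * ?m n"
  proof (rule eventually_sequentiallyI[of 1])
    fix n :: nat assume n: "1 \<le> n"
    interpret mtf_model n "X n" by (rule model[OF n])
    note hm = log_lipschitzD(2)[OF h] and h1 = log_lipschitzD(3)[OF h]
    have x: "0 \<le> a * scaled_weight n i \<omega>" if "i \<in> {1..n}" "\<omega> \<in> space (sample (X n))" for i \<omega>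
      by (intro mult_nonneg_nonneg[OF a] scaled_weight_nonneg n that)
    let ?f = "\<lambda>\<omega>. \<bar>(\<Sum>i = 1..n. h (a * scaled_weight n i \<omega>)) / n - ?c\<bar>"
    let ?d = "\<lambda>\<omega>. min 1 \<bar>scaled_mean n \<omega> - \<mu>\<bar>"
    have int_f: "integrable (sample (X n)) ?f"
    proof (rule integrable_const_bound[where B = "1 + \<bar>?c\<bar>"])
      show "AE \<omega> in sample (X n). norm (?f \<omega>) \<le> 1 + \<bar>?c\<bar>"
        using AE_space
      proof eventually_elim
        fix \<omega> assume \<omega>: "\<omega> \<in> space (sample (X n))"
        have "\<bar>\<Sum>i = 1..n. h (a * scaled_weight n i \<omega>)\<bar> \<le> (\<Sum>i = 1..n. 1)"
          by (intro order_trans[OF sum_abs] sum_mono h1 x \<omega>)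
        then have "\<bar>(\<Sum>i = 1..n. h (a * scaled_weight n i \<omega>)) / n\<bar> \<le> 1"
          using n by (simp add: abs_divide)
        then show "norm (?f \<omega>) \<le> 1 + \<bar>?c\<bar>" unfolding real_norm_def abs_idempotent by linarith
      qed
      show "?f \<in> borel_measurable (sample (X n))"
        by (intro borel_measurable_abs borel_measurable_diff borel_measurable_divide borel_measurable_sum
            borel_measurable_const measurable_compose[OF _ hm] borel_measurable_times scaled_weight_measurable
            scaling(1)[OF n] weight_measurable)
    qed
    have int_d: "integrable (sample (X n)) ?d"
      using scaled_mean_measurable[OF n] by (intro integrable_const_bound[where B = 1]) auto
    have C: "0 \<le> ?C" using mean_pos by simp
    have nonneg: "0 \<le> ?f \<omega> + ?C * ?d \<omega>" for \<omega>
      by (intro add_nonneg_nonneg mult_nonneg_nonneg[OF C]) auto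
    have "?L n
        \<le> (\<integral>\<omega>. ?f \<omega> + ?C * ?d \<omega> \<partial>sample (X n))"
    proof (intro integral_mono_AE' AE_I2)
      fix \<omega> assume \<omega>: "\<omega> \<in> space (sample (X n))"
      let ?S = "\<Sum>i = 1..n. h (request_rate n (X n) i \<omega> * (real n * \<mu> * a))"
      let ?S' = "\<Sum>i = 1..n. h (a * scaled_weight n i \<omega>)"
      have "\<bar>?S - ?S'\<bar> \<le> (\<Sum>i = 1..n. ?C * ?d \<omega>)"
        unfolding sum_subtractf[symmetric] rate_eq_scaled[OF n \<omega>]
        by (intro order_trans[OF sum_abs] sum_mono log_lipschitz_perturb[OF h mean_pos] x \<omega>
            scaled_mean_nonneg[OF n \<omega>])
      then have "\<bar>?S / n - ?S' / n\<bar> \<le> ?C * ?d \<omega>"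
        using n by (simp add: field_simps flip: diff_divide_distrib)
      then show "\<bar>?S / n - ?c\<bar> \<le> ?f \<omega> + ?C * ?d \<omega>" by linarith
    qed (intro nonneg Bochner_Integration.integrable_add integrable_mult_right int_f int_d)+
    also have "\<dots> = ?g n + ?C * ?m n"
      using int_f int_d by simp
    finally show "?L n
        \<le> ?g n + ?C * ?m n" .
  qed
qed

end

section \<open>Limits of the expected masses\<close>

definition laplace_transform :: "real measure \<Rightarrow> real \<Rightarrow> real" where
  "laplace_transform P a = (\<integral>x. exp (- (a * x)) \<partial>P)"

text \<open>This is \<open>|\<phi>'(a)| / \<mu>\<close> for the Laplace transform \<open>\<phi>\<close> of \<open>P\<close>, expanded by \<open>a\<close> so that the integrand
  is the test function \<open>y e\<^sup>-\<^sup>y\<close> at \<open>y = a x\<close>.\<close>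

definition limit_miss_rate :: "real measure \<Rightarrow> real \<Rightarrow> real" where
  "limit_miss_rate P a = (\<integral>x. a * x * exp (- (a * x)) \<partial>P) / ((\<integral>x. x \<partial>P) * a)"

text \<open>The limiting tail probability in the exchangeable case, for \<open>z > 1 - \<phi>(t)\<close>.\<close>

definition exchangeable_tail :: "real measure \<Rightarrow> real \<Rightarrow> real \<Rightarrow> real" where
  "exchangeable_tail P t z = max 0 (1 - z) / laplace_transform P t * limit_miss_rate P t"

lemma laplace_transform_integrable:
  assumes "P \<in> nonneg_laws" "0 \<le> a"
  shows "integrable P (\<lambda>x. exp (- (a * x)))"
proof -
  interpret real_distribution P using assms(1) by (simp add: nonneg_laws_def)
  have "AE x in P. 0 \<le> x" using assms(1) by (simp add: nonneg_laws_def)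
  then have "AE x in P. norm (exp (- (a * x))) \<le> 1"
    by eventually_elim (use assms(2) in simp)
  then show ?thesis by (intro integrable_const_bound[where B = 1]) auto
qed

lemma laplace_transform_bounds:
  assumes "P \<in> nonneg_laws" "0 \<le> a"
  shows "0 < laplace_transform P a" "laplace_transform P a \<le> 1"
proof -
  interpret real_distribution P using assms(1) by (simp add: nonneg_laws_def)
  note int = laplace_transform_integrable[OF assms]
  have "laplace_transform P a \<noteq> 0"
  proof
    assume "laplace_transform P a = 0"
    then have "AE x in P. exp (- (a * x)) = 0"
      using int unfolding laplace_transform_def by (subst (asm) integral_nonneg_eq_0_iff_AE) auto
    then have "AE x in P. False" by eventually_elim simp
    then show False by simp
  qed
  moreover have "0 \<le> laplace_transform P a"
    unfolding laplace_transform_def by (intro integral_nonneg_AE) auto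
  ultimately show "0 < laplace_transform P a" by simp
  have "AE x in P. 0 \<le> x" using assms(1) by (simp add: nonneg_laws_def)
  then have "AE x in P. exp (- (a * x)) \<le> 1"
    by eventually_elim (use assms(2) in simp)
  then have "laplace_transform P a \<le> (\<integral>x. 1 \<partial>P)"
    unfolding laplace_transform_def using int by (intro integral_mono_AE) auto
  also have "\<dots> = prob (space P)" by simp
  finally show "laplace_transform P a \<le> 1" by (simp only: prob_space)
qed

lemma laplace_transform_0: "P \<in> nonneg_laws \<Longrightarrow> laplace_transform P 0 = 1"
proof -
  assume "P \<in> nonneg_laws"
  then interpret real_distribution P by (simp add: nonneg_laws_def)
  have "laplace_transform P 0 = prob (space P)" by (simp add: laplace_transform_def)
  then show ?thesis by (simp only: prob_space)
qed

lemma laplace_transform_continuous: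
  assumes "P \<in> nonneg_laws"
  shows "continuous_on {0..} (laplace_transform P)"
  unfolding continuous_on_sequentially o_def
proof (intro allI ballI impI, elim conjE)
  fix u :: "nat \<Rightarrow> real" and a :: real
  assume u: "\<forall>n. u n \<in> {0..}" "u \<longlonglongrightarrow> a" and a: "a \<in> {0..}"
  interpret real_distribution P using assms by (simp add: nonneg_laws_def)
  have pos: "AE x in P. 0 \<le> x" using assms by (simp add: nonneg_laws_def)
  show "(\<lambda>n. laplace_transform P (u n)) \<longlonglongrightarrow> laplace_transform P a"
    unfolding laplace_transform_def
  proof (rule integral_dominated_convergence[where w = "\<lambda>_. 1"])
    show "AE x in P. (\<lambda>n. exp (- (u n * x))) \<longlonglongrightarrow> exp (- (a * x))"
      by (intro AE_I2 tendsto_intros u)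
    show "AE x in P. norm (exp (- (u n * x))) \<le> 1" for n
      using pos by eventually_elim (use u(1) in simp)
  qed auto
qed

lemma rank_fraction_tendsto:
  assumes "0 \<le> z"
  shows "(\<lambda>n. real (n - nat \<lfloor>z * real n\<rfloor>) / real n) \<longlonglongrightarrow> max 0 (1 - z)"
proof (rule LIM_zero_cancel, rule tendsto_rabs_zero_cancel, rule tendsto_sandwich[OF _ _ tendsto_const])
  show "(\<lambda>n. 1 / real n) \<longlonglongrightarrow> 0" by (rule lim_1_over_n)
  show "\<forall>\<^sub>F n in sequentially. \<bar>real (n - nat \<lfloor>z * real n\<rfloor>) / real n - max 0 (1 - z)\<bar> \<le> 1 / real n"
  proof (rule eventually_sequentiallyI[of 1])
    fix n :: nat assume n: "1 \<le> n"
    define k where "k = nat \<lfloor>z * real n\<rfloor>"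
    have k: "real k \<le> z * real n" "z * real n < real k + 1"
      using assms unfolding k_def by auto
    have "\<bar>real (n - k) - max 0 ((1 - z) * real n)\<bar> \<le> 1"
      using k by (cases "k \<le> n") (auto simp: of_nat_diff algebra_simps max_def)
    moreover have "max 0 ((1 - z) * real n) = max 0 (1 - z) * real n"
      using n by (simp add: max_mult_distrib_right)
    ultimately have "\<bar>real (n - k) - max 0 (1 - z) * real n\<bar> \<le> 1" by simp
    moreover have "real (n - k) / real n - max 0 (1 - z) = (real (n - k) - max 0 (1 - z) * real n) / real n"
      using n by (simp add: diff_divide_distrib)
    ultimately show "\<bar>real (n - nat \<lfloor>z * real n\<rfloor>) / real n - max 0 (1 - z)\<bar> \<le> 1 / real n"
      unfolding k_def[symmetric] using n by (simp add: divide_right_mono)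
  qed
qed auto

context mtf_model
begin

text \<open>The bound of \<open>uniform_tail_mass_near\<close> in mean, with \<open>\<epsilon>\<close> the square root of the mean deviation, which
  balances its two terms.\<close>

lemma expectation_uniform_tail_mass_near:
  assumes "n \<ge> 1" "0 \<le> a" "0 \<le> y" "0 < f" "f \<le> 1" "real (n - nat \<lfloor>y\<rfloor>) / n \<le> f"
  shows "\<bar>(\<integral>\<omega>. uniform_tail_mass a y \<omega> \<partial>M) - real (n - nat \<lfloor>y\<rfloor>) / n / f * (\<integral>\<omega>. miss_rate a \<omega> \<partial>M)\<bar>
     \<le> 2 * sqrt (\<integral>\<omega>. deviation a f \<omega> \<partial>M) / f"
proof -
  let ?\<kappa> = "real (n - nat \<lfloor>y\<rfloor>) / n / f" and ?D = "\<integral>\<omega>. deviation a f \<omega> \<partial>M"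
  let ?\<epsilon> = "sqrt ?D"
  note int = uniform_tail_mass_integrable[OF assms(2), of y] miss_rate_integrable[OF assms(2)]
    deviation_integrable[OF assms(2), of f]
  have "1 / n \<le> deviation a f \<omega>" for \<omega> by (simp add: deviation_def)
  then have "(\<integral>\<omega>. 1 / n \<partial>M) \<le> ?D"
    using int by (intro integral_mono) auto
  then have "1 / n \<le> ?D" by (simp add: prob_space)
  moreover have "0 < 1 / real n" using assms(1) by simp
  ultimately have D: "0 < ?D" by linarith
  then have \<epsilon>: "0 < ?\<epsilon>" by simp
  have "(\<integral>\<omega>. uniform_tail_mass a y \<omega> \<partial>M) - ?\<kappa> * (\<integral>\<omega>. miss_rate a \<omega> \<partial>M) =
      (\<integral>\<omega>. uniform_tail_mass a y \<omega> - ?\<kappa> * miss_rate a \<omega> \<partial>M)"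
    using int by simp
  also have "\<bar>\<dots>\<bar> \<le> (\<integral>\<omega>. \<bar>uniform_tail_mass a y \<omega> - ?\<kappa> * miss_rate a \<omega>\<bar> \<partial>M)"
    by (rule integral_abs_bound)
  also have "\<dots> \<le> (\<integral>\<omega>. (?\<epsilon> + deviation a f \<omega> / ?\<epsilon>) / f \<partial>M)"
    using int by (intro integral_mono uniform_tail_mass_near assms \<epsilon>) auto
  also have "\<dots> = (?\<epsilon> + ?D / ?\<epsilon>) / f"
    using int by (simp add: prob_space)
  also have "?D / ?\<epsilon> = ?\<epsilon>" using D by (simp add: real_div_sqrt)
  finally show ?thesis by simp
qed

end

context lln_sequence
begin

abbreviation "request_time n a \<equiv> real n * \<mu> * a"

abbreviation "mean_deviation n a \<equiv>
  \<integral>\<omega>. mtf_model.deviation n (X n) (request_time n a) (laplace_transform P a) \<omega> \<partial>sample (X n)"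

abbreviation "mean_miss_rate n a \<equiv>
  \<integral>\<omega>. mtf_model.miss_rate n (X n) (request_time n a) \<omega> \<partial>sample (X n)"

abbreviation "prob_zero_weights n \<equiv> measure (sample (X n)) (mtf_model.zero_weights_event n (X n))"

abbreviation "mean_tail n a y \<equiv>
  \<integral>\<omega>. mtf_model.pair_mass n (X n) (request_time n a) (tail_ranks n y) \<omega> \<partial>sample (X n)"

abbreviation "mean_uniform_tail n a y \<equiv>
  \<integral>\<omega>. mtf_model.uniform_tail_mass n (X n) (request_time n a) y \<omega> \<partial>sample (X n)"

lemma request_time_nonneg: "0 \<le> a \<Longrightarrow> 0 \<le> request_time n a"
  using mean_pos by simp

lemma deviation_tendsto:
  assumes "0 \<le> a"
  shows "(\<lambda>n. mean_deviation n a) \<longlonglongrightarrow> 0"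
proof -
  let ?E = "\<lambda>n. \<integral>\<omega>. \<bar>(\<Sum>i = 1..n. exp (- (request_rate n (X n) i \<omega> * request_time n a))) / n
      - laplace_transform P a\<bar> \<partial>sample (X n)"
  have avg: "(\<lambda>n. ?E n) \<longlonglongrightarrow> 0"
    using rate_average_tendsto[OF log_lipschitz_exp assms] unfolding laplace_transform_def .
  have "(\<lambda>n. 1 / real n + ?E n) \<longlonglongrightarrow> 0 + 0"
    by (intro tendsto_add lim_1_over_n avg)
  then have lim: "(\<lambda>n. 1 / real n + ?E n) \<longlonglongrightarrow> 0" by simp
  show ?thesis
  proof (rule Lim_transform_eventually[OF lim], rule eventually_sequentiallyI[of 1])
    fix n :: nat assume n: "1 \<le> n"
    interpret mtf_model n "X n" by (rule model[OF n])
    have "integrable M (\<lambda>\<omega>. deviation (request_time n a) (laplace_transform P a) \<omega> - 1 / n)"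
      by (intro Bochner_Integration.integrable_diff deviation_integrable request_time_nonneg assms) simp
    then have "integrable M (\<lambda>\<omega>. \<bar>miss_fraction (request_time n a) \<omega> - laplace_transform P a\<bar>)"
      by (simp add: deviation_def)
    then show "1 / real n + ?E n =
      (\<integral>\<omega>. deviation (request_time n a) (laplace_transform P a) \<omega> \<partial>sample (X n))"
      unfolding deviation_def by (simp add: prob_space miss_fraction_def)
  qed
qed

text \<open>Up to the factor \<open>\<mu> a\<close>, the miss rate is the average of the test function \<open>y e\<^sup>-\<^sup>y\<close> over
  \<open>y = p\<^sub>i n \<mu> a\<close>.\<close>

lemma miss_rate_tendsto:
  assumes "0 < a"
  shows "(\<lambda>n. mean_miss_rate n a)
     \<longlonglongrightarrow> limit_miss_rate P a"
proof -
  let ?c = "\<integral>x. a * x * exp (- (a * x)) \<partial>P"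
  let ?y = "\<lambda>n i \<omega>. request_rate n (X n) i \<omega> * request_time n a"
  let ?A = "\<lambda>n \<omega>. (\<Sum>i = 1..n. ?y n i \<omega> * exp (- ?y n i \<omega>)) / n"
  have avg: "(\<lambda>n. \<integral>\<omega>. \<bar>?A n \<omega> - ?c\<bar> \<partial>sample (X n)) \<longlonglongrightarrow> 0"
    using rate_average_tendsto[OF log_lipschitz_mult_exp less_imp_le[OF assms]] .
  have bound: "\<forall>\<^sub>F n in sequentially.
      \<bar>(mean_miss_rate n a) - limit_miss_rate P a\<bar>
        \<le> (\<integral>\<omega>. \<bar>?A n \<omega> - ?c\<bar> \<partial>sample (X n)) / (\<mu> * a)"
  proof (rule eventually_sequentiallyI[of 1])
    fix n :: nat assume n: "1 \<le> n"
    interpret mtf_model n "X n" by (rule model[OF n])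
    have pos: "0 < \<mu> * a" using mean_pos assms by simp
    have A: "?A n \<omega> = miss_rate (request_time n a) \<omega> * (\<mu> * a)" for \<omega>
    proof -
      have "(\<Sum>i = 1..n. ?y n i \<omega> * exp (- ?y n i \<omega>)) = (\<mu> * a * n) * miss_rate (request_time n a) \<omega>"
        unfolding miss_rate_def sum_distrib_left by (intro sum.cong refl) (simp only: mult_ac)
      moreover have "c * real n * R / real n = R * c" for c R :: real using n by simp
      ultimately show ?thesis by (simp only:)
    qed
    have int: "integrable M (miss_rate (request_time n a))"
      by (intro miss_rate_integrable request_time_nonneg) (use assms in simp)
    then have int_A: "integrable M (?A n)" unfolding A by (rule integrable_mult_left)
    have "(\<integral>\<omega>. miss_rate (request_time n a) \<omega> \<partial>M) = (\<integral>\<omega>. ?A n \<omega> \<partial>M) / (\<mu> * a)"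
    proof -
      have "\<mu> * a \<noteq> 0" using pos by linarith
      then show ?thesis
        unfolding A integral_mult_left_zero by (rule nonzero_mult_div_cancel_right[symmetric])
    qed
    then have "(\<integral>\<omega>. miss_rate (request_time n a) \<omega> \<partial>M) - limit_miss_rate P a =
        ((\<integral>\<omega>. ?A n \<omega> \<partial>M) - ?c) / (\<mu> * a)"
      by (simp only: limit_miss_rate_def diff_divide_distrib)
    moreover have "(\<integral>\<omega>. ?A n \<omega> \<partial>M) - ?c = (\<integral>\<omega>. ?A n \<omega> - ?c \<partial>M)"
      using Bochner_Integration.integral_diff[OF int_A, of "\<lambda>_. ?c"]
      by (simp only: lebesgue_integral_const prob_space scaleR_one integrable_const)
    ultimately have "\<bar>(\<integral>\<omega>. miss_rate (request_time n a) \<omega> \<partial>M) - limit_miss_rate P a\<bar> =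
        \<bar>\<integral>\<omega>. ?A n \<omega> - ?c \<partial>M\<bar> / (\<mu> * a)"
      using pos by (simp only: abs_divide abs_of_pos)
    also have "\<dots> \<le> (\<integral>\<omega>. \<bar>?A n \<omega> - ?c\<bar> \<partial>M) / (\<mu> * a)"
      by (intro divide_right_mono integral_abs_bound less_imp_le[OF pos])
    finally show "\<bar>(\<integral>\<omega>. miss_rate (request_time n a) \<omega> \<partial>M) - limit_miss_rate P a\<bar>
        \<le> (\<integral>\<omega>. \<bar>?A n \<omega> - ?c\<bar> \<partial>M) / (\<mu> * a)" .
  qed
  have "(\<lambda>n. (\<integral>\<omega>. \<bar>?A n \<omega> - ?c\<bar> \<partial>sample (X n)) / (\<mu> * a)) \<longlonglongrightarrow> 0 / (\<mu> * a)"
    by (intro tendsto_divide avg tendsto_const) (use mean_pos assms in simp)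
  then have "(\<lambda>n. (\<integral>\<omega>. \<bar>?A n \<omega> - ?c\<bar> \<partial>sample (X n)) / (\<mu> * a)) \<longlonglongrightarrow> 0" by (simp only: div_0)
  from tendsto_rabs_zero_cancel[OF tendsto_sandwich[OF always_eventually bound tendsto_const this]]
  show ?thesis by (rule LIM_zero_cancel) simp
qed

text \<open>If all weights vanish, the empirical mean is at distance \<open>\<mu>\<close> from \<open>\<mu>\<close>.\<close>

lemma zero_weights_tendsto:
  "(\<lambda>n. prob_zero_weights n) \<longlonglongrightarrow> 0"
proof (rule tendsto_sandwich[OF _ _ tendsto_const])
  let ?m = "\<lambda>n. \<integral>\<omega>. min 1 \<bar>scaled_mean n \<omega> - \<mu>\<bar> \<partial>sample (X n)"
  have pos: "0 < min 1 \<mu>" using mean_pos by simp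
  have "(\<lambda>n. ?m n / min 1 \<mu>) \<longlonglongrightarrow> 0 / min 1 \<mu>"
    by (intro tendsto_divide scaled_mean_tendsto tendsto_const) (use pos in simp)
  then show "(\<lambda>n. ?m n / min 1 \<mu>) \<longlonglongrightarrow> 0" by simp
  show "\<forall>\<^sub>F n in sequentially. prob_zero_weights n \<le> ?m n / min 1 \<mu>"
  proof (rule eventually_sequentiallyI[of 1])
    fix n :: nat assume n: "1 \<le> n"
    interpret mtf_model n "X n" by (rule model[OF n])
    have "prob zero_weights_event * min 1 \<mu> = (\<integral>\<omega>. indicator zero_weights_event \<omega> * min 1 \<mu> \<partial>M)"
      using sets.sets_into_space[OF zero_weights_event] by (simp add: Int_absorb1)
    also have "\<dots> \<le> ?m n"
    proof (intro integral_mono)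
      show "integrable M (\<lambda>\<omega>. min 1 \<bar>scaled_mean n \<omega> - \<mu>\<bar>)"
        using scaled_mean_measurable[OF n] by (intro integrable_const_bound[where B = 1]) auto
      fix \<omega> assume "\<omega> \<in> space M"
      have "scaled_mean n \<omega> = 0" if "\<omega> \<in> zero_weights_event"
        using that by (simp add: zero_weights_event_def empirical_mean_def)
      then show "indicator zero_weights_event \<omega> * min 1 \<mu> \<le> min 1 \<bar>scaled_mean n \<omega> - \<mu>\<bar>"
        using mean_pos by (auto simp: indicator_def)
    qed (simp add: emeasure_eq_measure)
    finally show "prob zero_weights_event \<le> ?m n / min 1 \<mu>"
      using pos by (simp add: pos_le_divide_eq)
  qed
qed auto

lemma uniform_tail_mass_tendsto:
  assumes t: "0 < t" and z: "1 - laplace_transform P t < z"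
  shows "(\<lambda>n. mean_uniform_tail n t (z * real n))
     \<longlonglongrightarrow> exchangeable_tail P t z"
proof -
  let ?f = "laplace_transform P t"
  have f: "0 < ?f" "?f \<le> 1" using laplace_transform_bounds[OF P_law] t by auto
  have z0: "0 \<le> z" using z f by simp
  let ?r = "\<lambda>n. real (n - nat \<lfloor>z * real n\<rfloor>) / real n"
  have "\<forall>\<^sub>F n in sequentially. ?r n < ?f"
    using z f by (intro order_tendstoD(2)[OF rank_fraction_tendsto[OF z0]]) simp
  then have bound: "\<forall>\<^sub>F n in sequentially. \<bar>mean_uniform_tail n t (z * real n) - ?r n / ?f * mean_miss_rate n t\<bar> \<le> 2 * sqrt (mean_deviation n t) / ?f"
    using eventually_ge_at_top[of 1]
  proof eventually_elim
    fix n :: nat assume n: "?r n < ?f" "1 \<le> n"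
    interpret mtf_model n "X n" by (rule model[OF n(2)])
    show "\<bar>mean_uniform_tail n t (z * real n) - ?r n / ?f * mean_miss_rate n t\<bar> \<le> 2 * sqrt (mean_deviation n t) / ?f"
      using n z0 f t mean_pos by (intro expectation_uniform_tail_mass_near) auto
  qed
  have "(\<lambda>n. 2 * sqrt (mean_deviation n t) / ?f) \<longlonglongrightarrow> 2 * sqrt 0 / ?f"
    using f t by (intro tendsto_intros deviation_tendsto) auto
  then have "(\<lambda>n. mean_uniform_tail n t (z * real n) - ?r n / ?f * mean_miss_rate n t) \<longlonglongrightarrow> 0"
    by (intro tendsto_rabs_zero_cancel[OF tendsto_sandwich[OF always_eventually bound tendsto_const]])
       (simp_all only: real_sqrt_zero mult_zero_right div_0 abs_ge_zero simp_thms)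
  moreover have "(\<lambda>n. ?r n / ?f * mean_miss_rate n t) \<longlonglongrightarrow> max 0 (1 - z) / ?f * limit_miss_rate P t"
    using f by (intro tendsto_intros rank_fraction_tendsto z0 miss_rate_tendsto t) auto
  ultimately have "(\<lambda>n. (mean_uniform_tail n t (z * real n) - ?r n / ?f * mean_miss_rate n t) + ?r n / ?f * mean_miss_rate n t) \<longlonglongrightarrow>
      0 + max 0 (1 - z) / ?f * limit_miss_rate P t"
    by (rule tendsto_add)
  then show ?thesis by (simp add: exchangeable_tail_def)
qed

end

section \<open>The limiting laws and their comparison\<close>

text \<open>A Borel set whose preimage is not measurable and its complement would both get mass 0, whereas their
  union gets mass 1. So the set function underlying \<^const>\<open>distr\<close> is not additive, and \<^const>\<open>distr\<close> is
  then the null measure by convention.\<close>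

lemma distr_not_measurable:
  assumes "prob_space M" "f \<notin> borel_measurable M"
  shows "emeasure (distr M borel f) A = 0"
proof (rule ccontr)
  assume "emeasure (distr M borel f) A \<noteq> 0"
  let ?\<mu> = "\<lambda>A. emeasure M (f -` A \<inter> space M)"
  have "measure_space UNIV (sets borel) ?\<mu>"
  proof (rule ccontr)
    assume "\<not> measure_space UNIV (sets borel) ?\<mu>"
    then have "emeasure (distr M borel f) A = 0"
      unfolding distr_def by (simp add: emeasure_measure_of_conv sets.sigma_sets_eq[of borel, simplified])
    then show False using \<open>emeasure (distr M borel f) A \<noteq> 0\<close> by simp
  qed
  then have add: "countably_additive (sets borel) ?\<mu>" by (simp add: measure_space_def)
  interpret prob_space M by fact
  obtain B where B: "B \<in> sets borel" "f -` B \<inter> space M \<notin> sets M"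
    using assms(2) by (auto simp: measurable_def)
  have "f -` (- B) \<inter> space M \<notin> sets M"
  proof
    assume "f -` (- B) \<inter> space M \<in> sets M"
    then have "space M - (f -` (- B) \<inter> space M) \<in> sets M" by auto
    also have "space M - (f -` (- B) \<inter> space M) = f -` B \<inter> space M" by auto
    finally show False using B by simp
  qed
  then have zero: "?\<mu> B = 0" "?\<mu> (- B) = 0"
    using B(2) by (simp_all add: emeasure_notin_sets)
  have "additive (sets borel) ?\<mu>"
    using add by (rule ring_of_sets.countably_additive_additive[rotated 2])
      (auto simp: positive_def sets.sigma_algebra_axioms intro: sets.ring_of_sets_axioms)
  then have "?\<mu> (B \<union> - B) = ?\<mu> B + ?\<mu> (- B)"
    using B(1) by (intro additiveD) auto
  then show False using zero by (simp add: emeasure_space_1)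
qed

locale search_cost_limit = lln_sequence +
  fixes t :: real and N :: "'b measure" and S :: "'b \<Rightarrow> real"
  assumes t_pos: "0 < t" and init_id: "\<And>n. n \<ge> 1 \<Longrightarrow> init_pos (X n) = id"
    and limit: "limiting_search_cost P t X N S"
begin

abbreviation "cost n \<equiv> search_cost n (X n) (request_time n t)"

sublocale N: prob_space N using limit by (simp add: limiting_search_cost_def)

definition limit_cdf :: "real \<Rightarrow> real" where
  "limit_cdf = cdf (distr N borel S)"

lemma S_measurable [measurable]: "S \<in> borel_measurable N"
  using limit by (simp add: limiting_search_cost_def)

sublocale L: real_distribution "distr N borel S" by (rule N.real_distribution_distr) measurable

lemma limit_cdf_eq: "limit_cdf z = measure N {\<omega>\<in>space N. S \<omega> \<le> z}"
  unfolding limit_cdf_def cdf_def by (subst measure_distr) (auto intro!: arg_cong[where f = "measure N"])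

lemma cdf_tendsto:
  assumes "isCont limit_cdf z"
  shows "(\<lambda>n. cdf (distr (sample (X n)) borel (\<lambda>\<omega>. real (cost n \<omega>) / real n)) z) \<longlonglongrightarrow> limit_cdf z"
  using limit assms
  unfolding limiting_search_cost_def weak_conv_m_def weak_conv_def limit_cdf_def[symmetric] by blast

text \<open>Convergence to a probability law forces the distribution functions to be positive somewhere, which
  \<open>distr_not_measurable\<close> excludes for a non-measurable search cost.\<close>

lemma eventually_cost_measurable:
  "\<forall>\<^sub>F n in sequentially. (\<lambda>\<omega>. real (cost n \<omega>) / real n) \<in> borel_measurable (sample (X n))"
proof -
  have "((\<lambda>z. limit_cdf z) \<longlongrightarrow> 1) at_top"
    unfolding limit_cdf_def by (rule L.cdf_lim_at_top_prob)
  then have "\<forall>\<^sub>F z in at_top. 0 < limit_cdf z" by (rule order_tendstoD) simp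
  then obtain b where b: "\<And>z. b \<le> z \<Longrightarrow> 0 < limit_cdf z"
    unfolding eventually_at_top_linorder by blast
  have "countable {z. \<not> isCont limit_cdf z}"
    unfolding limit_cdf_def by (intro mono_ctble_discont monoI L.cdf_nondecreasing)
  moreover have "uncountable {b<..<b + 1}" by (simp add: uncountable_open_interval)
  ultimately have "\<not> {b<..<b + 1} \<subseteq> {z. \<not> isCont limit_cdf z}"
    using countable_subset by blast
  then obtain z where z: "b < z" "isCont limit_cdf z" by auto
  have "\<forall>\<^sub>F n in sequentially. 0 < cdf (distr (sample (X n)) borel (\<lambda>\<omega>. real (cost n \<omega>) / real n)) z"
    using cdf_tendsto[OF z(2)] b[of z] z(1) by (intro order_tendstoD(1)) auto
  then show ?thesis
    using eventually_ge_at_top[of 1]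
  proof eventually_elim
    fix n :: nat assume n: "0 < cdf (distr (sample (X n)) borel (\<lambda>\<omega>. real (cost n \<omega>) / real n)) z" "1 \<le> n"
    have "prob_space (sample (X n))" using chain[OF n(2)] by (simp add: mtf_chain_def)
    then show "(\<lambda>\<omega>. real (cost n \<omega>) / real n) \<in> borel_measurable (sample (X n))"
      using distr_not_measurable[of "sample (X n)" "\<lambda>\<omega>. real (cost n \<omega>) / real n" "{..z}"] n(1)
      unfolding cdf_def measure_def by fastforce
  qed
qed

definition exceed :: "nat \<Rightarrow> real \<Rightarrow> real" where
  "exceed n z = measure (sample (X n)) (transient_mtf_model.cost_exceeds n (X n) (request_time n t) z)"

lemma eventually_transient_model:
  "\<forall>\<^sub>F n in sequentially. transient_mtf_model n (X n) (request_time n t)"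
  using eventually_cost_measurable eventually_ge_at_top[of 1]
proof eventually_elim
  fix n :: nat
  assume meas: "(\<lambda>\<omega>. real (cost n \<omega>) / real n) \<in> borel_measurable (sample (X n))" and n: "1 \<le> n"
  have "(\<lambda>\<omega>. real (cost n \<omega>) / real n * real n) \<in> borel_measurable (sample (X n))"
    by (intro borel_measurable_times meas borel_measurable_const)
  then have "(\<lambda>\<omega>. real (cost n \<omega>)) \<in> borel_measurable (sample (X n))" using n by simp
  then show "transient_mtf_model n (X n) (request_time n t)"
    using n model[OF n] init_id[OF n] request_time_nonneg[of t n] t_pos
    by (simp add: transient_mtf_model_def transient_mtf_model_axioms_def)
qed

lemma exceed_tendsto:
  assumes "isCont limit_cdf z"
  shows "(\<lambda>n. exceed n z) \<longlonglongrightarrow> 1 - limit_cdf z"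
proof (rule Lim_transform_eventually)
  show "(\<lambda>n. 1 - cdf (distr (sample (X n)) borel (\<lambda>\<omega>. real (cost n \<omega>) / real n)) z) \<longlonglongrightarrow> 1 - limit_cdf z"
    by (intro tendsto_diff tendsto_const cdf_tendsto assms)
  show "\<forall>\<^sub>F n in sequentially.
      1 - cdf (distr (sample (X n)) borel (\<lambda>\<omega>. real (cost n \<omega>) / real n)) z = exceed n z"
    using eventually_transient_model eventually_cost_measurable
  proof eventually_elim
    fix n :: nat
    assume "transient_mtf_model n (X n) (request_time n t)"
      and meas: "(\<lambda>\<omega>. real (cost n \<omega>) / real n) \<in> borel_measurable (sample (X n))"
    then interpret transient_mtf_model n "X n" "request_time n t" by simp
    have "cdf (distr M borel (\<lambda>\<omega>. real (cost n \<omega>) / real n)) z = prob (space M - cost_exceeds z)"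
    proof -
      have "(\<lambda>\<omega>. real (cost n \<omega>) / real n) -` {..z} \<inter> space M = space M - cost_exceeds z"
        using n_pos by (auto simp: cost_exceeds_def pos_divide_le_eq)
      then show ?thesis unfolding cdf_def using measure_distr[OF meas, of "{..z}"] by simp
    qed
    also have "\<dots> = 1 - prob (cost_exceeds z)" by (intro prob_compl cost_exceeds_sets)
    finally show "1 - cdf (distr M borel (\<lambda>\<omega>. real (cost n \<omega>) / real n)) z = exceed n z"
      by (simp add: exceed_def)
  qed
qed

lemma limit_cdf_negative:
  assumes "isCont limit_cdf z" "z < 0"
  shows "limit_cdf z = 0"
proof -
  have "\<forall>\<^sub>F n in sequentially. exceed n z = 1"
    using eventually_transient_model
  proof eventually_elim
    fix n :: nat
    assume "transient_mtf_model n (X n) (request_time n t)"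
    then interpret transient_mtf_model n "X n" "request_time n t" .
    have "z * n < 0" using assms(2) n_pos by (simp add: mult_neg_pos)
    then have "cost_exceeds z = space M"
      unfolding cost_exceeds_def by (auto intro: less_le_trans)
    then show "exceed n z = 1" by (simp add: exceed_def prob_space)
  qed
  then have "(\<lambda>n. exceed n z) \<longlonglongrightarrow> 1" by (rule tendsto_eventually)
  then show ?thesis using LIMSEQ_unique[OF exceed_tendsto[OF assms(1)]] by force
qed

lemma limit_tail_le:
  assumes "isCont limit_cdf z" "B \<longlonglongrightarrow> b"
    and "\<And>n. transient_mtf_model n (X n) (request_time n t) \<Longrightarrow> exceed n z \<le> B n"
  shows "1 - limit_cdf z \<le> b"
  using eventually_mono[OF eventually_transient_model assms(3)]
  by (intro tendsto_le[OF sequentially_bot assms(2) exceed_tendsto[OF assms(1)]])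

lemma limit_tail_ge:
  assumes "isCont limit_cdf z" "B \<longlonglongrightarrow> b"
    and "\<And>n. transient_mtf_model n (X n) (request_time n t) \<Longrightarrow> B n \<le> exceed n z"
  shows "b \<le> 1 - limit_cdf z"
  using eventually_mono[OF eventually_transient_model assms(3)]
  by (intro tendsto_le[OF sequentially_bot exceed_tendsto[OF assms(1)] assms(2)])

text \<open>Together with \<open>limit_cdf_ge_above\<close> this determines the law below \<open>1 - \<phi>(t)\<close>, independently of the
  order of the weights.\<close>

lemma limit_cdf_le_below:
  assumes a: "0 < a" "a \<le> t" and z: "z < 1 - laplace_transform P a" and cont: "isCont limit_cdf z"
  shows "limit_miss_rate P a \<le> 1 - limit_cdf z"
proof (rule limit_tail_ge[OF cont])
  let ?f = "laplace_transform P a"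
  let ?B = "\<lambda>n. mean_miss_rate n a - mean_deviation n a / (z - (1 - ?f))\<^sup>2 - prob_zero_weights n"
  have "?B \<longlonglongrightarrow> limit_miss_rate P a - 0 / (z - (1 - ?f))\<^sup>2 - 0"
    using a z by (intro tendsto_intros miss_rate_tendsto deviation_tendsto zero_weights_tendsto) auto
  then show "?B \<longlonglongrightarrow> limit_miss_rate P a" by simp
  fix n assume "transient_mtf_model n (X n) (request_time n t)"
  then interpret transient_mtf_model n "X n" "request_time n t" .
  have "request_time n a \<le> request_time n t" using a mean_pos by (intro mult_left_mono) auto
  then have "mean_miss_rate n a - mean_deviation n a / (z - (1 - ?f))\<^sup>2
      \<le> prob (cost_exceeds z) + prob_zero_weights n"
    using laplace_transform_bounds[OF P_law, of a] a z
    by (intro cost_exceeds_lower_below request_time_nonneg) auto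
  then show "?B n \<le> exceed n z" by (simp add: exceed_def)
qed

lemma limit_cdf_ge_above:
  assumes a: "0 < a" "a \<le> t" and z: "1 - laplace_transform P a < z" and cont: "isCont limit_cdf z"
  shows "1 - limit_cdf z \<le> limit_miss_rate P a"
proof (rule limit_tail_le[OF cont])
  let ?f = "laplace_transform P a"
  let ?B = "\<lambda>n. mean_miss_rate n a + mean_deviation n a / (z - (1 - ?f))\<^sup>2 + 2 * prob_zero_weights n"
  have "?B \<longlonglongrightarrow> limit_miss_rate P a + 0 / (z - (1 - ?f))\<^sup>2 + 2 * 0"
    using a z by (intro tendsto_intros miss_rate_tendsto deviation_tendsto zero_weights_tendsto) auto
  then show "?B \<longlonglongrightarrow> limit_miss_rate P a" by simp
  fix n assume "transient_mtf_model n (X n) (request_time n t)"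
  then interpret transient_mtf_model n "X n" "request_time n t" .
  have "request_time n a \<le> request_time n t" using a mean_pos by (intro mult_left_mono) auto
  then show "exceed n z \<le> ?B n"
    unfolding exceed_def using laplace_transform_bounds[OF P_law, of a] a z
    by (intro cost_exceeds_upper_above request_time_nonneg) auto
qed

text \<open>The hypothesis \<open>le\<close> is the only place where the order of the weights enters.\<close>

lemma limit_cdf_le_exchangeable_tail:
  assumes z: "1 - laplace_transform P t < z" and cont: "isCont limit_cdf z"
    and le: "\<And>n y. n \<ge> 1 \<Longrightarrow> mean_tail n t y \<le> mean_uniform_tail n t y"
  shows "1 - limit_cdf z \<le> exchangeable_tail P t z"
proof (rule limit_tail_le[OF cont])
  let ?f = "laplace_transform P t"
  let ?e = "\<lambda>n. mean_deviation n t / (z - (1 - ?f))\<^sup>2 + 2 * prob_zero_weights n"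
  have "(\<lambda>n. mean_uniform_tail n t (z * real n) + ?e n) \<longlonglongrightarrow>
      exchangeable_tail P t z + (0 / (z - (1 - ?f))\<^sup>2 + 2 * 0)"
    using t_pos z
    by (intro tendsto_intros uniform_tail_mass_tendsto deviation_tendsto zero_weights_tendsto) auto
  then show "(\<lambda>n. mean_uniform_tail n t (z * real n) + ?e n) \<longlonglongrightarrow> exchangeable_tail P t z" by simp
  fix n assume "transient_mtf_model n (X n) (request_time n t)"
  then interpret transient_mtf_model n "X n" "request_time n t" .
  show "exceed n z \<le> mean_uniform_tail n t (z * real n) + ?e n"
    using cost_exceeds_tail_ranks(2)[of ?f z] le[OF n_pos, of "z * n"]
      laplace_transform_bounds[OF P_law, of t] t_pos z unfolding exceed_def by simp
qed

lemma limit_cdf_ge_exchangeable_tail: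
  assumes z: "1 - laplace_transform P t < z" and cont: "isCont limit_cdf z"
    and ge: "\<And>n y. n \<ge> 1 \<Longrightarrow> mean_uniform_tail n t y \<le> mean_tail n t y"
  shows "exchangeable_tail P t z \<le> 1 - limit_cdf z"
proof (rule limit_tail_ge[OF cont])
  let ?f = "laplace_transform P t"
  let ?B = "\<lambda>n. mean_uniform_tail n t (z * real n) - prob_zero_weights n"
  have "?B \<longlonglongrightarrow> exchangeable_tail P t z - 0"
    using t_pos z by (intro tendsto_intros uniform_tail_mass_tendsto zero_weights_tendsto) auto
  then show "?B \<longlonglongrightarrow> exchangeable_tail P t z" by simp
  fix n assume "transient_mtf_model n (X n) (request_time n t)"
  then interpret transient_mtf_model n "X n" "request_time n t" .
  show "?B n \<le> exceed n z"
    using cost_exceeds_tail_ranks(1)[of ?f z] ge[OF n_pos, of "z * n"]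
      laplace_transform_bounds[OF P_law, of t] t_pos z unfolding exceed_def by simp
qed

end


text \<open>The two arguments \<open>z' < z\<close> leave room for comparisons that lose an arbitrarily small amount of the
  argument; right continuity removes the loss.\<close>

lemma right_continuous_le:
  fixes F G :: "real \<Rightarrow> real"
  assumes mono: "mono F" "mono G" and right: "continuous (at_right x) G" and e: "x < e"
    and le: "\<And>z' z. x < z' \<Longrightarrow> z' < z \<Longrightarrow> z < e \<Longrightarrow> isCont F z' \<Longrightarrow> isCont F z \<Longrightarrow> isCont G z \<Longrightarrow> F z' \<le> G z"
  shows "F x \<le> G x"
proof (rule ccontr)
  assume "\<not> F x \<le> G x"
  then have "\<forall>\<^sub>F z in at_right x. G z < F x"
    using right by (intro order_tendstoD(2)) (auto simp: continuous_within)
  then obtain d where d: "x < d" "\<And>z. x < z \<Longrightarrow> z < d \<Longrightarrow> G z < F x"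
    unfolding eventually_at_right_field by blast
  have cont: "\<exists>z. u < z \<and> z < v \<and> isCont F z \<and> isCont G z" if "u < v" for u v
  proof -
    have "countable ({z. \<not> isCont F z} \<union> {z. \<not> isCont G z})"
      using mono_ctble_discont[OF mono(1)] mono_ctble_discont[OF mono(2)] by blast
    then have "\<not> {u<..<v} \<subseteq> {z. \<not> isCont F z} \<union> {z. \<not> isCont G z}"
      using uncountable_open_interval[of u v] that countable_subset by blast
    then show ?thesis by auto
  qed
  obtain z where z: "x < z" "z < min d e" "isCont F z" "isCont G z"
    using cont[of x "min d e"] d(1) e by auto
  obtain z' where z': "x < z'" "z' < z" "isCont F z'" using cont[of x z] z(1) by auto
  have "F x \<le> F z'" using mono(1) z'(1) by (simp add: monoD)
  also have "\<dots> \<le> G z" using z z' by (intro le) auto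
  also have "\<dots> < F x" using z by (intro d(2)) auto
  finally show False by simp
qed

text \<open>Below 0 the larger variable has no mass, and between 0 and \<open>1 - \<phi>(t)\<close> both tails are squeezed
  between values of \<open>\<beta>\<close>: since \<open>\<phi>\<close> is continuous, each value there is \<open>1 - \<phi>(a)\<close> for some \<open>a\<close> in
  \<open>(0, t]\<close>. Only above \<open>1 - \<phi>(t)\<close> do the tail hypotheses come in.\<close>

lemma stochastically_smaller_if_tails:
  assumes lo: "search_cost_limit P X\<^sub>1 t N\<^sub>1 S\<^sub>1" and hi: "search_cost_limit P X\<^sub>2 t N\<^sub>2 S\<^sub>2"
    and tail_lo: "\<And>z. 1 - laplace_transform P t < z \<Longrightarrow> isCont (search_cost_limit.limit_cdf N\<^sub>1 S\<^sub>1) z \<Longrightarrow>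
      1 - search_cost_limit.limit_cdf N\<^sub>1 S\<^sub>1 z \<le> exchangeable_tail P t z"
    and tail_hi: "\<And>z. 1 - laplace_transform P t < z \<Longrightarrow> isCont (search_cost_limit.limit_cdf N\<^sub>2 S\<^sub>2) z \<Longrightarrow>
      exchangeable_tail P t z \<le> 1 - search_cost_limit.limit_cdf N\<^sub>2 S\<^sub>2 z"
  shows "stochastically_smaller N\<^sub>1 S\<^sub>1 N\<^sub>2 S\<^sub>2"
proof -
  interpret lo: search_cost_limit P X\<^sub>1 t N\<^sub>1 S\<^sub>1 by (rule lo)
  interpret hi: search_cost_limit P X\<^sub>2 t N\<^sub>2 S\<^sub>2 by (rule hi)
  let ?\<phi> = "laplace_transform P"
  have mono: "mono hi.limit_cdf" "mono lo.limit_cdf"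
    unfolding hi.limit_cdf_def lo.limit_cdf_def
    by (auto intro!: monoI hi.L.cdf_nondecreasing lo.L.cdf_nondecreasing)
  have right: "continuous (at_right x) lo.limit_cdf" for x
    unfolding lo.limit_cdf_def by (rule lo.L.cdf_is_right_cont)
  have "hi.limit_cdf x \<le> lo.limit_cdf x" for x
  proof -
    consider "x < 0" | "0 \<le> x" "x < 1 - ?\<phi> t" | "1 - ?\<phi> t \<le> x" by linarith
    then show ?thesis
    proof cases
      case 1
      then show ?thesis
      proof (rule right_continuous_le[OF mono right])
        fix z' z :: real assume "z' < z" "z < 0" "isCont hi.limit_cdf z'"
        then have "hi.limit_cdf z' = 0" by (intro hi.limit_cdf_negative) auto
        then show "hi.limit_cdf z' \<le> lo.limit_cdf z" by (simp add: lo.limit_cdf_eq)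
      qed
    next
      case 2
      from 2(2) show ?thesis
      proof (rule right_continuous_le[OF mono right])
        fix z' z assume z: "x < z'" "z' < z" "z < 1 - ?\<phi> t" "isCont hi.limit_cdf z'" "isCont lo.limit_cdf z"
        \<comment> \<open>a value of \<open>1 - \<phi>\<close> strictly between the two arguments\<close>
        let ?y = "(z' + z) / 2"
        have "continuous_on {0..t} (\<lambda>a. 1 - ?\<phi> a)"
          by (intro continuous_on_diff continuous_on_const
              continuous_on_subset[OF laplace_transform_continuous[OF lo.P_law]]) auto
        moreover have "1 - ?\<phi> 0 \<le> ?y" "?y \<le> 1 - ?\<phi> t"
          using z 2(1) laplace_transform_0[OF lo.P_law] by auto
        ultimately obtain a where a: "0 \<le> a" "a \<le> t" "1 - ?\<phi> a = ?y"
          using IVT'[of "\<lambda>a. 1 - ?\<phi> a" 0 ?y t] lo.t_pos by auto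
        have "a \<noteq> 0" using a(3) laplace_transform_0[OF lo.P_law] z 2(1) by auto
        then have "0 < a" using a(1) by simp
        have "limit_miss_rate P a \<le> 1 - hi.limit_cdf z'"
          using \<open>0 < a\<close> a(2) by (rule hi.limit_cdf_le_below) (use a(3) z in auto)
        moreover have "1 - lo.limit_cdf z \<le> limit_miss_rate P a"
          using \<open>0 < a\<close> a(2) by (rule lo.limit_cdf_ge_above) (use a(3) z in auto)
        ultimately show "hi.limit_cdf z' \<le> lo.limit_cdf z" by linarith
      qed
    next
      case 3
      show ?thesis
      proof (rule right_continuous_le[OF mono right])
        show "x < x + 1" by simp
        fix z' z assume z: "x < z'" "z' < z" "isCont hi.limit_cdf z" "isCont lo.limit_cdf z"
        have "hi.limit_cdf z' \<le> hi.limit_cdf z" using mono(1) z(2) by (simp add: monoD)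
        moreover have "1 - lo.limit_cdf z \<le> 1 - hi.limit_cdf z"
          using tail_lo[of z] tail_hi[of z] z 3 by linarith
        ultimately show "hi.limit_cdf z' \<le> lo.limit_cdf z" by linarith
      qed
    qed
  qed
  then show ?thesis
    unfolding stochastically_smaller_def by (simp add: lo.limit_cdf_eq hi.limit_cdf_eq)
qed

theorem corollary3p3:
  fixes P :: "real measure" and t :: real
    and X_ex :: "nat \<Rightarrow> 'a mtf" and X_plus :: "nat \<Rightarrow> 'b mtf" and X_minus :: "nat \<Rightarrow> 'c mtf"
    and N_ex :: "'d measure" and N_plus :: "'e measure" and N_minus :: "'f measure"
    and S_ex :: "'d \<Rightarrow> real" and S_plus :: "'e \<Rightarrow> real" and S_minus :: "'f \<Rightarrow> real"
  assumes P: "P \<in> nonneg_laws" "integrable P (\<lambda>x. x)" "(\<integral>x. x \<partial>P) \<noteq> 0"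
    and t: "t > 0"
    and ex: "\<And>n. n \<ge> 1 \<Longrightarrow> mtf_chain n (X_ex n)" "LLN_ex P X_ex"
      "limiting_search_cost P t X_ex N_ex S_ex"
    and plus: "\<And>n. n \<ge> 1 \<Longrightarrow> mtf_chain n (X_plus n)" "LLN_plus P X_plus"
      "limiting_search_cost P t X_plus N_plus S_plus"
    and minus: "\<And>n. n \<ge> 1 \<Longrightarrow> mtf_chain n (X_minus n)" "LLN_minus P X_minus"
      "limiting_search_cost P t X_minus N_minus S_minus"
  shows "stochastically_smaller N_minus S_minus N_ex S_ex \<and>
         stochastically_smaller N_ex S_ex N_plus S_plus"
proof -
  interpret ex: search_cost_limit P X_ex t N_ex S_ex
    using P t ex by unfold_locales (auto simp: LLN_ex_def)
  interpret plus: search_cost_limit P X_plus t N_plus S_plus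
    using P t plus by unfold_locales (auto simp: LLN_plus_def)
  interpret minus: search_cost_limit P X_minus t N_minus S_minus
    using P t minus by unfold_locales (auto simp: LLN_minus_def)
  have ex_eq: "ex.mean_tail n t y = ex.mean_uniform_tail n t y"
    if "n \<ge> 1" for n y
    using ex(2) that t by (intro mtf_model.exchangeable_tail_ranks ex.model ex.request_time_nonneg)
      (auto simp: LLN_ex_def)
  have plus_ge: "plus.mean_uniform_tail n t y \<le> plus.mean_tail n t y"
    if n: "n \<ge> 1" for n y
  proof -
    interpret mtf_model n "X_plus n" by (rule plus.model[OF n])
    have T: "0 \<le> plus.request_time n t" using t by (intro plus.request_time_nonneg) simp
    have "AE \<omega> in M. mono_on {1..n} (\<lambda>i. weight (X_plus n) i \<omega>)"
      using plus(2) n by (simp add: LLN_plus_def)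
    then have "AE \<omega> in M. uniform_tail_mass (plus.request_time n t) y \<omega> \<le> pair_mass (plus.request_time n t) (tail_ranks n y) \<omega>"
      using AE_space by eventually_elim (rule pair_mass_tail_ranks_ge[OF T])
    then show ?thesis
      using tail_ranks_subset by (intro integral_mono_AE uniform_tail_mass_integrable pair_mass_integrable T) blast+
  qed
  have minus_le: "minus.mean_tail n t y \<le> minus.mean_uniform_tail n t y"
    if n: "n \<ge> 1" for n y
  proof -
    interpret mtf_model n "X_minus n" by (rule minus.model[OF n])
    have T: "0 \<le> minus.request_time n t" using t by (intro minus.request_time_nonneg) simp
    have "AE \<omega> in M. antimono_on {1..n} (\<lambda>i. weight (X_minus n) i \<omega>)"
      using minus(2) n by (simp add: LLN_minus_def)
    then have "AE \<omega> in M. pair_mass (minus.request_time n t) (tail_ranks n y) \<omega> \<le> uniform_tail_mass (minus.request_time n t) y \<omega>"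
      using AE_space by eventually_elim (rule pair_mass_tail_ranks_le[OF T])
    then show ?thesis
      using tail_ranks_subset by (intro integral_mono_AE uniform_tail_mass_integrable pair_mass_integrable T) blast+
  qed
  have "stochastically_smaller N_minus S_minus N_ex S_ex"
    by (rule stochastically_smaller_if_tails[OF minus.search_cost_limit_axioms ex.search_cost_limit_axioms])
       (intro minus.limit_cdf_le_exchangeable_tail ex.limit_cdf_ge_exchangeable_tail minus_le
         eq_refl[OF ex_eq[symmetric]]; assumption)+
  moreover have "stochastically_smaller N_ex S_ex N_plus S_plus"
    by (rule stochastically_smaller_if_tails[OF ex.search_cost_limit_axioms plus.search_cost_limit_axioms])
       (intro ex.limit_cdf_le_exchangeable_tail plus.limit_cdf_ge_exchangeable_tail plus_ge
         eq_refl[OF ex_eq]; assumption)+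
  ultimately show ?thesis ..
qed

end
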